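(* Let $B$ be a connected skew-symmetrizable $n\times n$ integer matrix such that the cluster algebra $\mathcal{A}(B)$ is acyclic, i.e. $B$ is mutation equivalent to an acyclic skew-symmetrizable matrix. Then the $g$-vector fan $\mathcal{F}(B)$ is dense in $\mathbb{R}^n$ if and only if $B$ is of finite type or of affine type.
   Context: An $n\times n$ integer matrix $B=(b_{ij})$ is skew-symmetrizable if there is a diagonal matrix $D=\mathrm{diag}(d_1,\dots,d_n)$ with positive integer entries such that $d_ib_{ij}=-d_jb_{ji}$ for all $i,j$. For an $m\times n$ integer matrix $B=(b_{ij})$ ($m\ge n$) whose upper $n\times n$ part is skew-symmetrizable and $1\le k\le n$, the mutation $\mu_kB=(b'_{ij})$ is defined by $b'_{ij}=-b_{ij}$ if $i=k$ or $j=k$, and $b'_{ij}=b_{ij}+b_{ik}[b_{kj}]_++[-b_{ik}]_+b_{kj}$ otherwise, where $[a]_+=\max(a,0)$. Two matrices are mutation equivalent if one is obtained from the other by a finite sequence of mutations. The diagram $\Gamma(B)$ of a skew-symmetrizable $n\times n$ matrix $B$ is the weighted directed graph on vertices $1,\dots,n$ with an arrow $j\to i$ of weight $|b_{ij}b_{ji}|$ whenever $b_{ij}>0$. $B$ is connected if $\Gamma(B)$ is connected and acyclic if $\Gamma(B)$ has no oriented cycle. $B$ is of finite type (resp. affine type) if it is mutation equivalent to an acyclic skew-symmetrizable matrix $B'$ whose Cartan companion $A=(a_{ij})$, $a_{ii}=2$, $a_{ij}=-|b'_{ij}|$ ($i\ne j$), is a Cartan matrix of finite type (resp. a generalized Cartan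 matrix of affine type); equivalently, the underlying weighted graph of $\Gamma(B')$ is a Dynkin graph $A_n,B_n(=C_n),D_n,E_6,E_7,E_8,F_4,G_2$ (resp. an extended Dynkin graph $A_1^{(1)}$ (two vertices, weight 4), $A_n^{(1)}$ (a cycle, not oriented cyclically), $B_n^{(1)},C_n^{(1)},D_n^{(1)},E_6^{(1)},E_7^{(1)},E_8^{(1)},F_4^{(1)},G_2^{(1)}$). Cluster algebra with principal coefficients: let $\mathcal{F}$ be the field of rational functions over $\mathbb{Q}$ in $2n$ variables. A seed is a pair $(\mathbf{x},C)$ with $\mathbf{x}=(x_1,\dots,x_n,y_1,\dots,y_n)$ a free generating set of $\mathcal{F}$ and $C=(c_{ij})$ a $2n\times n$ integer matrix with skew-symmetrizable upper part, rows indexed by $1,\dots,n,1',\dots,n'$. Its mutation at $k$ replaces $C$ by $\mu_kC$ and $x_k$ by $x_k'$ with $x_kx_k'=\prod_i x_i^{[c_{ik}]_+}+\prod_i x_i^{[-c_{ik}]_+}$ (with $x_{i'}=y_i$), other entries unchanged. Let $\hat B$ be the $2n\times n$ matrix with upper part $B$ and lower part the identity. $\mathcal{A}(B)$ is the $\mathbb{Z}$-subalgebra of $\mathcal{F}$ generated by all cluster variables and coefficients of all seeds obtained from $(\mathbf{x},\hat B)$ by sequences of mutations; the $n$-tuples $(x_1,\dots,x_n)$ of these seeds are clusters. Every cluster variable lies in $\mathbb{Z}[x_1^{\pm1},\dots,x_n^{\pm1},y_1,\dots,y_n]$ and is homogeneous for the $\mathbb{Z}^n$-grading $\deg x_i=e_i$,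 $\deg y_j=-\sum_i b_{ij}e_i$; its degree is its $g$-vector. The $g$-vector fan $\mathcal{F}(B)$ is the simplicial fan in $\mathbb{R}^n$ whose maximal cones are the cones spanned by the $g$-vectors of the cluster variables of a cluster (and their faces). $\mathcal{F}(B)$ is dense if the union of its cones is dense in $\mathbb{R}^n$. *)

theory Defs
  imports "HOL-Analysis.Analysis" "HOL-Library.Poly_Mapping" "HOL-Library.Countable"
          "HOL-Computational_Algebra.Fraction_Field"
begin

section \<open>Exchange matrices and their mutation\<close>

definition posp :: "int \<Rightarrow> int" where
  "posp a = max a 0"

text \<open>Mutation at k of an (m x n) matrix whose rows are indexed by 'r and columns by 'n;
  the embedding e sends a column index k to the row index of the same vertex
  (identity for square matrices, Inl for the extended 2n x n matrices).\<close>
definition mat_mut :: "('n \<Rightarrow> 'r) \<Rightarrow> 'n \<Rightarrow> ('r \<Rightarrow> 'n \<Rightarrow> int) \<Rightarrow> 'r \<Rightarrow> 'n \<Rightarrow> int" where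
  "mat_mut e k M = (\<lambda>i j. if i = e k \<or> j = k then - M i j
      else M i j + M i k * posp (M (e k) j) + posp (- M i k) * M (e k) j)"

definition skew_symmetrizable :: "('n::finite \<Rightarrow> 'n \<Rightarrow> int) \<Rightarrow> bool" where
  "skew_symmetrizable B \<longleftrightarrow>
     (\<exists>d::'n \<Rightarrow> int. (\<forall>i. d i > 0) \<and> (\<forall>i j. d i * B i j = - (d j * B j i)))"

definition mut_equiv :: "('n::finite \<Rightarrow> 'n \<Rightarrow> int) \<Rightarrow> ('n \<Rightarrow> 'n \<Rightarrow> int) \<Rightarrow> bool" where
  "mut_equiv B B' \<longleftrightarrow> (\<exists>ks. B' = foldl (\<lambda>M k. mat_mut id k M) B ks)"

text \<open>Diagram: arrow j \<rightarrow> i iff b_ij > 0.\<close>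
definition diagram_arrows :: "('n \<Rightarrow> 'n \<Rightarrow> int) \<Rightarrow> ('n \<times> 'n) set" where
  "diagram_arrows B = {(j, i). B i j > 0}"

definition connected_mat :: "('n::finite \<Rightarrow> 'n \<Rightarrow> int) \<Rightarrow> bool" where
  "connected_mat B \<longleftrightarrow>
     (\<forall>i j. (i, j) \<in> (diagram_arrows B \<union> (diagram_arrows B)\<inverse>)\<^sup>*)"

definition acyclic_mat :: "('n::finite \<Rightarrow> 'n \<Rightarrow> int) \<Rightarrow> bool" where
  "acyclic_mat B \<longleftrightarrow> acyclic (diagram_arrows B)"

section \<open>Cartan companion and Kac's finite / affine type\<close>

definition cartan_companion :: "('n::finite \<Rightarrow> 'n \<Rightarrow> int) \<Rightarrow> real^'n^'n" where
  "cartan_companion B = (\<chi> i j. if i = j then 2 else - \<bar>real_of_int (B i j)\<bar>)"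

text \<open>Kac, Infinite dimensional Lie algebras, Thm 4.3 (Fin) and (Aff).\<close>
definition gcm_finite_type :: "real^'n^'n \<Rightarrow> bool" where
  "gcm_finite_type A \<longleftrightarrow> det A \<noteq> 0
     \<and> (\<exists>u. (\<forall>i. u $ i > 0) \<and> (\<forall>i. (A *v u) $ i > 0))
     \<and> (\<forall>v. (\<forall>i. (A *v v) $ i \<ge> 0) \<longrightarrow> ((\<forall>i. v $ i > 0) \<or> v = 0))"

definition gcm_affine_type :: "real^'n^'n \<Rightarrow> bool" where
  "gcm_affine_type A \<longleftrightarrow> rank A = CARD('n) - 1
     \<and> (\<exists>u. (\<forall>i. u $ i > 0) \<and> A *v u = 0)
     \<and> (\<forall>v. (\<forall>i. (A *v v) $ i \<ge> 0) \<longrightarrow> A *v v = 0)"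

definition finite_type :: "('n::finite \<Rightarrow> 'n \<Rightarrow> int) \<Rightarrow> bool" where
  "finite_type B \<longleftrightarrow> (\<exists>B'. mut_equiv B B' \<and> skew_symmetrizable B' \<and> acyclic_mat B'
      \<and> gcm_finite_type (cartan_companion B'))"

definition affine_type :: "('n::finite \<Rightarrow> 'n \<Rightarrow> int) \<Rightarrow> bool" where
  "affine_type B \<longleftrightarrow> (\<exists>B'. mut_equiv B B' \<and> skew_symmetrizable B' \<and> acyclic_mat B'
      \<and> gcm_affine_type (cartan_companion B'))"

section \<open>Cluster algebra with principal coefficients\<close>

text \<open>The ambient field: rational functions over Q in the 2n variables x_i (= Inl i)
  and y_i (= Inr i); variable v is encoded as the polynomial variable number to_nat v.\<close>
type_synonym qpoly = "(nat \<Rightarrow>\<^sub>0 nat) \<Rightarrow>\<^sub>0 rat"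
type_synonym ratfun = "qpoly fract"

definition xvar :: "('n::finite + 'n) \<Rightarrow> ratfun" where
  "xvar v = Fract (Poly_Mapping.single (Poly_Mapping.single (to_nat v) 1) 1) 1"

type_synonym 'n seed = "('n \<Rightarrow> ratfun) \<times> (('n + 'n) \<Rightarrow> 'n \<Rightarrow> int)"

definition seed_var :: "'n::finite seed \<Rightarrow> ('n + 'n) \<Rightarrow> ratfun" where
  "seed_var s v = (case v of Inl i \<Rightarrow> fst s i | Inr j \<Rightarrow> xvar (Inr j))"

definition seed_mut :: "'n::finite \<Rightarrow> 'n seed \<Rightarrow> 'n seed" where
  "seed_mut k s = ((fst s)(k := ((\<Prod>r\<in>UNIV. seed_var s r ^ nat (posp (snd s r k)))
                               + (\<Prod>r\<in>UNIV. seed_var s r ^ nat (posp (- snd s r k)))) / fst s k),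
                   mat_mut Inl k (snd s))"

definition principal_ext :: "('n::finite \<Rightarrow> 'n \<Rightarrow> int) \<Rightarrow> ('n + 'n) \<Rightarrow> 'n \<Rightarrow> int" where
  "principal_ext B = (\<lambda>r j. case r of Inl i \<Rightarrow> B i j | Inr i \<Rightarrow> (if i = j then 1 else 0))"

definition init_seed :: "('n::finite \<Rightarrow> 'n \<Rightarrow> int) \<Rightarrow> 'n seed" where
  "init_seed B = ((\<lambda>i. xvar (Inl i)), principal_ext B)"

text \<open>The cluster of the seed reached from the initial seed by mutating along ks.\<close>
definition cluster :: "('n::finite \<Rightarrow> 'n \<Rightarrow> int) \<Rightarrow> 'n list \<Rightarrow> 'n \<Rightarrow> ratfun" where
  "cluster B ks = fst (foldl (\<lambda>s k. seed_mut k s) (init_seed B) ks)"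

text \<open>f is a (nonzero) Laurent polynomial in x, polynomial in y, homogeneous of degree g
  for deg x_i = e_i, deg y_j = - sum_i b_ij e_i.\<close>
definition homog :: "('n::finite \<Rightarrow> 'n \<Rightarrow> int) \<Rightarrow> ratfun \<Rightarrow> ('n \<Rightarrow> int) \<Rightarrow> bool" where
  "homog B f g \<longleftrightarrow> (\<exists>(p::qpoly) (a::'n \<Rightarrow> nat). p \<noteq> 0 \<and>
      f = Fract p (Poly_Mapping.single (\<Sum>i\<in>UNIV. Poly_Mapping.single (to_nat (Inl i :: 'n + 'n)) (a i)) 1)
    \<and> (\<forall>m \<in> Poly_Mapping.keys p. Poly_Mapping.keys m \<subseteq> range (to_nat :: 'n + 'n \<Rightarrow> nat)
        \<and> (\<forall>i. int (Poly_Mapping.lookup m (to_nat (Inl i :: 'n + 'n)))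
               - (\<Sum>j\<in>UNIV. B i j * int (Poly_Mapping.lookup m (to_nat (Inr j :: 'n + 'n))))
               - int (a i) = g i)))"

text \<open>Union of the cones of the g-vector fan: nonnegative combinations of the
  g-vectors of the cluster variables of some cluster.\<close>
definition gfan_support :: "('n::finite \<Rightarrow> 'n \<Rightarrow> int) \<Rightarrow> (real^'n) set" where
  "gfan_support B = {v. \<exists>ks (g::'n \<Rightarrow> 'n \<Rightarrow> int) (c::'n \<Rightarrow> real).
      (\<forall>i. homog B (cluster B ks i) (g i)) \<and> (\<forall>i. c i \<ge> 0)
      \<and> v = (\<Sum>i\<in>UNIV. c i *\<^sub>R (\<chi> j. real_of_int (g i j)))}"

definition gfan_dense :: "('n::finite \<Rightarrow> 'n \<Rightarrow> int) \<Rightarrow> bool" where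
  "gfan_dense B \<longleftrightarrow> closure (gfan_support B) = UNIV"

end

theory Submission
  imports Defs "HOL-Library.Function_Algebras"
begin

text \<open>The g-vector of the \<open>i\<close>-th cluster variable after the mutations \<open>ks\<close> is the vector that the
  piecewise linear maps \<open>gmut\<close> along \<open>ks\<close> carry to the \<open>i\<close>-th unit vector. Hence the support of the fan
  consists of the vectors \<open>p\<close> for which \<open>gmuts B ks p\<close> is nonnegative for some \<open>ks\<close>, and density is
  invariant under mutation. The link with the Laurent expansions is made by tropicalization: by the
  Laurent phenomenon the max-plus exchange maps \<open>amuts\<close> are convex, they are dual to \<open>gmuts\<close>, and
  convexity yields the sign-coherence of c-vectors.

  Let \<open>B\<close> be acyclic with Cartan companion \<open>A\<close>; a Perron eigenvector of \<open>A\<close> gives \<open>u > 0\<close> with \<open>A u\<close>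
  positive, zero or negative. In the first two cases mutations at sources (or sinks) act on an integral
  vector either as simple reflections, which decrease a nonnegative quadratic form, or reduce the
  question to the positive definite matrix with one vertex isolated; this reaches every integral vector
  in finite type and every integral vector off the hyperplane orthogonal to the null root in affine
  type. In the third case, conjugating a sequence of mutations at all sources yields for every seed
  a sequence whose G-matrix is minus the identity; by duality with the convex functions \<open>amuts\<close> it
  follows that the Tits form is nonnegative along the fan, which fails on an open set of vectors.\<close>

section \<open>Laurent polynomials\<close>

text \<open>Nothing is known about the signs of the coefficients of Laurent expansions, so the
  passage to the max-plus maps is analytic: at positive reals the logarithms of the exchange
  relations stay within a bounded distance of the max-plus relations, and along a generic ray a
  single exponent dominates, so leading terms cannot cancel. The Laurent phenomenon rests on
  coprimality of exchange polynomials, which is drawn from independent columns, and \<open>B\<close>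
  itself may have dependent ones. The arguments therefore concern a square matrix in which only the
  vertices of a set \<open>K\<close> are mutated; \<open>pext\<close> enlarges \<open>B\<close> to
  such a matrix by one frozen vertex per vertex. Sign-coherence has a short cause: the pairing of a
  g-vector with a point is conserved while two signs agree, convexity bounds the final pairing from
  below, and a disagreement of signs would make it drop strictly. The indefinite case uses the same
  pairing: all sinks followed by \<open>ks\<close> take the g-vector to a nonpositive vector and a
  suitable test point to nonnegative mutable coordinates, so the conserved pairing is at most
  0.\<close>

type_synonym 'm laurent = "('m \<Rightarrow> int) \<Rightarrow>\<^sub>0 rat"

definition pw :: "('m::finite \<Rightarrow> real) \<Rightarrow> ('m \<Rightarrow> int) \<Rightarrow> real" where
  "pw z m = (\<Prod>i\<in>UNIV. z i powi m i)"

definition lev :: "('m::finite \<Rightarrow> real) \<Rightarrow> 'm laurent \<Rightarrow> real" where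
  "lev z p = (\<Sum>m\<in>Poly_Mapping.keys p. of_rat (Poly_Mapping.lookup p m) * pw z m)"

abbreviation lmon :: "('m \<Rightarrow> int) \<Rightarrow> 'm laurent" where
  "lmon m \<equiv> Poly_Mapping.single m 1"

lemma pw_pos: "(\<And>i. z i > 0) \<Longrightarrow> pw z m > 0"
  unfolding pw_def by (intro prod_pos) auto

lemma pw_add: "(\<And>i. z i > 0) \<Longrightarrow> pw z (m + n) = pw z m * pw z n"
  unfolding pw_def prod.distrib[symmetric]
  by (intro prod.cong) (auto simp: power_int_add less_imp_neq[symmetric])

lemma pw_zero: "pw z 0 = 1"
  unfolding pw_def by simp

lemma poly_mapping_sum_singles:
  "p = (\<Sum>m\<in>Poly_Mapping.keys p. Poly_Mapping.single m (Poly_Mapping.lookup p m))"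
  by (rule poly_mapping_eqI)
    (auto simp: lookup_sum lookup_single when_def in_keys_iff if_distrib cong: if_cong)

lemma lev_superset:
  assumes "finite A" "Poly_Mapping.keys p \<subseteq> A"
  shows "lev z p = (\<Sum>m\<in>A. of_rat (Poly_Mapping.lookup p m) * pw z m)"
  unfolding lev_def using assms by (intro sum.mono_neutral_left) (auto simp: in_keys_iff)

lemma lev_add: "lev z (p + q) = lev z p + lev z q"
proof -
  let ?A = "Poly_Mapping.keys p \<union> Poly_Mapping.keys q"
  have "lev z (p + q) = (\<Sum>m\<in>?A. of_rat (Poly_Mapping.lookup (p + q) m) * pw z m)"
    by (rule lev_superset) (auto simp: Poly_Mapping.keys_add)
  also have "\<dots> = (\<Sum>m\<in>?A. of_rat (Poly_Mapping.lookup p m) * pw z m)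
      + (\<Sum>m\<in>?A. of_rat (Poly_Mapping.lookup q m) * pw z m)"
    by (simp add: lookup_add of_rat_add distrib_right sum.distrib)
  also have "\<dots> = lev z p + lev z q"
    by (simp add: lev_superset[of ?A p] lev_superset[of ?A q])
  finally show ?thesis .
qed

lemma lev_zero [simp]: "lev z 0 = 0"
  unfolding lev_def by simp

lemma lev_single [simp]: "lev z (Poly_Mapping.single m c) = of_rat c * pw z m"
  unfolding lev_def by simp

lemma lev_one [simp]: "lev z 1 = 1"
  unfolding single_one[symmetric] by (simp only: lev_single) (simp add: pw_zero)

lemma lev_sum: "lev z (sum f A) = (\<Sum>a\<in>A. lev z (f a))"
  by (induction A rule: infinite_finite_induct) (auto simp: lev_add)

lemma lev_mult:
  assumes "\<And>i. z i > 0"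
  shows "lev z (p * q) = lev z p * lev z q"
proof -
  have "p * q = (\<Sum>m\<in>Poly_Mapping.keys p. \<Sum>n\<in>Poly_Mapping.keys q.
     Poly_Mapping.single (m + n) (Poly_Mapping.lookup p m * Poly_Mapping.lookup q n))"
    unfolding mult_single[symmetric] sum_product[symmetric] poly_mapping_sum_singles[symmetric] ..
  then have "lev z (p * q) = (\<Sum>m\<in>Poly_Mapping.keys p. \<Sum>n\<in>Poly_Mapping.keys q.
     of_rat (Poly_Mapping.lookup p m * Poly_Mapping.lookup q n) * pw z (m + n))"
    by (simp add: lev_sum)
  also have "\<dots> = lev z p * lev z q"
    unfolding lev_def sum_product
    by (intro sum.cong refl) (simp add: pw_add[OF assms] of_rat_mult)
  finally show ?thesis .
qed

lemma lev_diff: "lev z (p - q) = lev z p - lev z q"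
  using lev_add[of z "p - q" q] by simp

lemma lev_power: "(\<And>i. z i > 0) \<Longrightarrow> lev z (p ^ n) = lev z p ^ n"
  by (induction n) (auto simp: lev_mult)

lemma lev_prod: "(\<And>i. z i > 0) \<Longrightarrow> lev z (prod f A) = (\<Prod>a\<in>A. lev z (f a))"
  by (induction A rule: infinite_finite_induct) (auto simp: lev_mult)

lemma lmon_mult: "lmon m * lmon n = lmon (m + n)"
  by (simp add: mult_single)

lemma lmon_unit: "lmon m * lmon (- m) = 1" "lmon (- m) * lmon m = 1"
  by (simp_all add: mult_single)

lemma dvd_lmon_mult_iff: "p dvd lmon m * q \<longleftrightarrow> p dvd q"
proof
  assume "p dvd lmon m * q"
  then have "p dvd lmon (- m) * (lmon m * q)"
    by (rule dvd_mult)
  then show "p dvd q"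
    by (simp only: mult.assoc[symmetric] lmon_unit mult_1)
qed simp

subsection \<open>Growth along rays\<close>

definition ldot :: "('m::finite \<Rightarrow> int) \<Rightarrow> ('m \<Rightarrow> real) \<Rightarrow> real" where
  "ldot m x = (\<Sum>i\<in>UNIV. of_int (m i) * x i)"

lemma pw_exp: "pw (\<lambda>i. exp (s * x i)) m = exp (s * ldot m x)"
proof -
  have "exp (s * x i) powi m i = exp (s * (of_int (m i) * x i))" for i
    by (simp add: exp_power_int mult_ac)
  then show ?thesis
    unfolding pw_def ldot_def sum_distrib_left exp_sum[OF finite] by simp
qed

text \<open>A point on the moment curve works: for two distinct exponents the difference of the
  values of \<open>ldot\<close> is a nonzero polynomial in the parameter \<open>t\<close>, and
  finitely many such polynomials have only finitely many roots.\<close>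

lemma exists_ldot_inj_on:
  assumes "finite (S :: ('m::finite \<Rightarrow> int) set)"
  obtains \<zeta> where "inj_on (\<lambda>m. ldot m \<zeta>) S"
proof -
  define q :: "('m \<Rightarrow> int) \<times> ('m \<Rightarrow> int) \<Rightarrow> real poly" where
    "q = (\<lambda>(m, m'). \<Sum>i\<in>UNIV. monom (of_int (m i - m' i)) (to_nat i))"
  have "q (m, m') \<noteq> 0" if "m \<noteq> m'" for m m'
  proof -
    from that obtain j where "m j \<noteq> m' j" by auto
    have "coeff (q (m, m')) (to_nat j) = (\<Sum>i\<in>UNIV. if i = j then of_int (m i - m' i) else 0)"
      unfolding q_def by (auto simp: coeff_sum intro!: sum.cong)
    also have "\<dots> \<noteq> 0"
      using \<open>m j \<noteq> m' j\<close> by simp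
    finally show ?thesis by auto
  qed
  then have q0: "finite {t. poly (q mm) t = 0}" if "mm \<in> {(m, m') \<in> S \<times> S. m \<noteq> m'}" for mm
    using that by (intro poly_roots_finite) auto
  have "finite {(m, m') \<in> S \<times> S. m \<noteq> m'}"
    by (rule finite_subset[OF _ finite_cartesian_product[OF assms assms]]) auto
  from finite_UN_I[OF this q0]
  have "finite (\<Union>mm\<in>{(m, m') \<in> S \<times> S. m \<noteq> m'}. {t. poly (q mm) t = 0})" .
  then obtain t where t: "t \<notin> (\<Union>mm\<in>{(m, m') \<in> S \<times> S. m \<noteq> m'}. {t. poly (q mm) t = 0})"
    using ex_new_if_finite[OF infinite_UNIV_char_0] by blast
  have "ldot m (\<lambda>i. t ^ to_nat i) \<noteq> ldot m' (\<lambda>i. t ^ to_nat i)" if "m \<in> S" "m' \<in> S" "m \<noteq> m'" for m m'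
  proof -
    have "poly (q (m, m')) t = ldot m (\<lambda>i. t ^ to_nat i) - ldot m' (\<lambda>i. t ^ to_nat i)"
      unfolding q_def ldot_def by (simp add: poly_sum poly_monom left_diff_distrib sum_subtractf)
    with t that show ?thesis by fastforce
  qed
  then have "inj_on (\<lambda>m. ldot m (\<lambda>i. t ^ to_nat i)) S"
    unfolding inj_on_def by blast
  then show ?thesis by (rule that)
qed

text \<open>When \<open>x\<close> separates the exponents, all terms but one become negligible after
  division by the largest exponential, whatever the signs of the coefficients. Half the absolute
  value of the leading coefficient serves as \<open>c\<close>.\<close>

lemma lev_dominant:
  assumes "p \<noteq> 0" "inj_on (\<lambda>m. ldot m x) (Poly_Mapping.keys p)"
  obtains m c where "m \<in> Poly_Mapping.keys p" "\<And>m'. m' \<in> Poly_Mapping.keys p \<Longrightarrow> ldot m' x \<le> ldot m x"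
    "c > 0" "\<forall>\<^sub>F s in at_top. c * exp (s * ldot m x) \<le> \<bar>lev (\<lambda>i. exp (s * x i)) p\<bar>"
proof -
  let ?K = "Poly_Mapping.keys p"
  have K: "finite ?K" "?K \<noteq> {}"
    using assms(1) by auto
  obtain m where m: "m \<in> ?K" "ldot m x = Max ((\<lambda>m. ldot m x) ` ?K)"
    using Max_in[of "(\<lambda>m. ldot m x) ` ?K"] K by (metis (no_types, lifting) finite_imageI image_iff image_is_empty)
  have le: "ldot m' x \<le> ldot m x" if "m' \<in> ?K" for m'
    using m(2) K that by simp
  let ?c = "of_rat (Poly_Mapping.lookup p m) :: real"
  have c0: "?c \<noteq> 0"
    using m(1) by (simp add: in_keys_iff)
  have lim: "((\<lambda>s. of_rat (Poly_Mapping.lookup p m') * exp (s * (ldot m' x - ldot m x)))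
      \<longlongrightarrow> (if m' = m then ?c else 0)) at_top" if "m' \<in> ?K" for m'
  proof (cases "m' = m")
    case False
    then have "ldot m' x - ldot m x < 0"
      using le[OF that] assms(2) that m(1) by (auto simp: inj_on_def order_less_le)
    then have "filterlim (\<lambda>s. s * (ldot m' x - ldot m x)) at_bot at_top"
      using filterlim_tendsto_neg_mult_at_bot[OF tendsto_const _ filterlim_ident,
          of "ldot m' x - ldot m x"] by (simp only: mult.commute)
    then have "((\<lambda>s. exp (s * (ldot m' x - ldot m x))) \<longlongrightarrow> 0) at_top"
      by (rule filterlim_compose[OF exp_at_bot])
    with False show ?thesis
      by (auto intro: tendsto_mult_right_zero)
  qed simp
  have "((\<lambda>s. \<Sum>m'\<in>?K. of_rat (Poly_Mapping.lookup p m') * exp (s * (ldot m' x - ldot m x)))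
      \<longlongrightarrow> (\<Sum>m'\<in>?K. if m' = m then ?c else 0)) at_top"
    by (intro tendsto_sum lim)
  then have "((\<lambda>s. \<Sum>m'\<in>?K. of_rat (Poly_Mapping.lookup p m') * exp (s * (ldot m' x - ldot m x)))
      \<longlongrightarrow> ?c) at_top"
    using m(1) by simp
  then have "((\<lambda>s. \<bar>\<Sum>m'\<in>?K. of_rat (Poly_Mapping.lookup p m') * exp (s * (ldot m' x - ldot m x))\<bar>)
      \<longlongrightarrow> \<bar>?c\<bar>) at_top"
    by (rule tendsto_rabs)
  then have ev: "\<forall>\<^sub>F s in at_top. \<bar>\<Sum>m'\<in>?K. of_rat (Poly_Mapping.lookup p m') * exp (s * (ldot m' x - ldot m x))\<bar> > \<bar>?c\<bar> / 2"
    using c0 by (intro order_tendstoD(1)) auto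
  have eq: "lev (\<lambda>i. exp (s * x i)) p = exp (s * ldot m x) *
     (\<Sum>m'\<in>?K. of_rat (Poly_Mapping.lookup p m') * exp (s * (ldot m' x - ldot m x)))" for s
    unfolding lev_def pw_exp sum_distrib_left
    by (intro sum.cong) (auto simp: right_diff_distrib exp_diff)
  have "\<forall>\<^sub>F s in at_top. \<bar>?c\<bar> / 2 * exp (s * ldot m x) \<le> \<bar>lev (\<lambda>i. exp (s * x i)) p\<bar>"
    using ev by eventually_elim (auto simp: eq abs_mult mult.commute)
  with that[of m "\<bar>?c\<bar> / 2"] m(1) le c0 show ?thesis by auto
qed

lemma lev_eq_zero:
  assumes "\<And>z :: 'm::finite \<Rightarrow> real. (\<And>i. z i > 0) \<Longrightarrow> lev z p = 0"
  shows "p = 0"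
proof (rule ccontr)
  assume "p \<noteq> 0"
  obtain \<zeta> where "inj_on (\<lambda>m. ldot m \<zeta>) (Poly_Mapping.keys p)"
    using exists_ldot_inj_on[OF finite_keys] by blast
  then obtain m c where
    c: "c > 0" "\<forall>\<^sub>F s in at_top. c * exp (s * ldot m \<zeta>) \<le> \<bar>lev (\<lambda>i. exp (s * \<zeta> i)) p\<bar>"
    using lev_dominant[OF \<open>p \<noteq> 0\<close>] by blast
  from eventually_happens[OF c(2)] obtain s where "c * exp (s * ldot m \<zeta>) \<le> \<bar>lev (\<lambda>i. exp (s * \<zeta> i)) p\<bar>"
    by (auto simp: trivial_limit_at_top_linorder)
  with assms[of "\<lambda>i. exp (s * \<zeta> i)"] c(1) show False
    by (simp add: mult_le_0_iff)
qed

lemma lev_inject: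
  assumes "\<And>z :: 'm::finite \<Rightarrow> real. (\<And>i. z i > 0) \<Longrightarrow> lev z p = lev z q"
  shows "p = q"
  using lev_eq_zero[of "p - q"] assms by (simp add: lev_diff)

subsection \<open>A coprimality criterion\<close>

text \<open>\<open>U\<close> is a non-zero-divisor modulo \<open>P\<close>. In this form coprimality
  passes to products and along congruences modulo \<open>P\<close> by divisibility alone.\<close>

definition lcoprime :: "'m laurent \<Rightarrow> 'm laurent \<Rightarrow> bool" where
  "lcoprime P U \<longleftrightarrow> (\<forall>g. P dvd U * g \<longrightarrow> P dvd g)"

lemma lcoprime_mult: "lcoprime P U \<Longrightarrow> lcoprime P V \<Longrightarrow> lcoprime P (U * V)"
  unfolding lcoprime_def mult.assoc by blast

lemma lcoprime_one: "lcoprime P 1"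
  unfolding lcoprime_def mult_1 by blast

lemma lcoprime_power: "lcoprime P U \<Longrightarrow> lcoprime P (U ^ n)"
  by (induction n) (auto simp: lcoprime_one lcoprime_mult)

lemma lcoprime_prod: "(\<And>a. a \<in> A \<Longrightarrow> lcoprime P (f a)) \<Longrightarrow> lcoprime P (prod f A)"
  by (induction A rule: infinite_finite_induct) (auto simp: lcoprime_one lcoprime_mult)

lemma lcoprime_lmon: "lcoprime P (lmon m)"
  unfolding lcoprime_def by (simp add: dvd_lmon_mult_iff)

lemma lcoprime_cong:
  assumes "lcoprime P U" "P dvd V - U"
  shows "lcoprime P V"
  unfolding lcoprime_def
proof (intro allI impI)
  fix g assume "P dvd V * g"
  moreover have "P dvd (V - U) * g"
    using assms(2) by simp
  ultimately have "P dvd V * g - (V - U) * g"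
    by (rule dvd_diff)
  then have "P dvd U * g"
    by (simp add: algebra_simps)
  with assms(1) show "P dvd g"
    unfolding lcoprime_def by blast
qed

text \<open>One factor \<open>P\<close> is cancelled at a time. Cancellability of \<open>P\<close>
  is a hypothesis because it is obtained later from positivity of the values of
  \<open>P\<close>.\<close>

lemma lcoprime_power_dvd:
  assumes "lcoprime P U" "P ^ a * h = U * g" "\<And>p q :: 'm laurent. P * p = P * q \<Longrightarrow> p = q"
  shows "P ^ a dvd g"
  using assms(2)
proof (induction a arbitrary: g h)
  case (Suc a)
  then have "P dvd U * g"
    by (metis dvd_triv_left mult.assoc power_Suc)
  then obtain g' where g: "g = P * g'"
    using assms(1) unfolding lcoprime_def by (meson dvdE)
  have "P * (P ^ a * h) = P * (U * g')"
    using Suc.prems by (simp add: g ac_simps)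
  then have "P ^ a * h = U * g'"
    by (rule assms(3))
  from Suc.IH[OF this] show ?case
    unfolding g power_Suc by (rule mult_dvd_mono[OF dvd_refl])
qed simp

definition lproj :: "(('m \<Rightarrow> int) \<Rightarrow> int) \<Rightarrow> int \<Rightarrow> 'm laurent \<Rightarrow> 'm laurent" where
  "lproj L d p = (\<Sum>m\<in>{m \<in> Poly_Mapping.keys p. L m = d}. Poly_Mapping.single m (Poly_Mapping.lookup p m))"

lemma lookup_lproj: "Poly_Mapping.lookup (lproj L d p) m = (if L m = d then Poly_Mapping.lookup p m else 0)"
  unfolding lproj_def
  by (auto simp: lookup_sum lookup_single when_def in_keys_iff if_distrib cong: if_cong)

lemma lproj_add: "lproj L d (p + q) = lproj L d p + lproj L d q"
  by (rule poly_mapping_eqI) (simp add: lookup_lproj lookup_add)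

lemma lproj_zero: "lproj L d 0 = 0"
  by (rule poly_mapping_eqI) (simp add: lookup_lproj)

lemma lproj_sum: "lproj L d (sum f A) = (\<Sum>a\<in>A. lproj L d (f a))"
  by (induction A rule: infinite_finite_induct) (auto simp: lproj_add lproj_zero)

lemma lproj_single: "lproj L d (Poly_Mapping.single m c) = (if L m = d then Poly_Mapping.single m c else 0)"
  by (rule poly_mapping_eqI) (auto simp: lookup_lproj lookup_single when_def)

lemma lproj_mult_homogeneous:
  assumes L: "\<And>m n. L (m + n) = L m + L n" and P: "\<And>m. m \<in> Poly_Mapping.keys P \<Longrightarrow> L m = e"
  shows "lproj L (e + d) (P * g) = P * lproj L d g"
proof -
  have *: "lproj L (e + d) (Poly_Mapping.single m a * Poly_Mapping.single n b)
      = Poly_Mapping.single m a * lproj L d (Poly_Mapping.single n b)" if "m \<in> Poly_Mapping.keys P" for m n a b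
    using P[OF that] by (auto simp: mult_single lproj_single L)
  have "lproj L (e + d) (P * g) = lproj L (e + d) (\<Sum>m\<in>Poly_Mapping.keys P. \<Sum>n\<in>Poly_Mapping.keys g.
     Poly_Mapping.single m (Poly_Mapping.lookup P m) * Poly_Mapping.single n (Poly_Mapping.lookup g n))"
    unfolding sum_product[symmetric] poly_mapping_sum_singles[symmetric] ..
  also have "\<dots> = (\<Sum>m\<in>Poly_Mapping.keys P. \<Sum>n\<in>Poly_Mapping.keys g.
     Poly_Mapping.single m (Poly_Mapping.lookup P m) * lproj L d (Poly_Mapping.single n (Poly_Mapping.lookup g n)))"
    by (simp add: lproj_sum *)
  also have "\<dots> = (\<Sum>m\<in>Poly_Mapping.keys P. Poly_Mapping.single m (Poly_Mapping.lookup P m))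
      * (\<Sum>n\<in>Poly_Mapping.keys g. lproj L d (Poly_Mapping.single n (Poly_Mapping.lookup g n)))"
    by (simp only: sum_product)
  also have "\<dots> = P * lproj L d g"
    unfolding lproj_sum[symmetric] poly_mapping_sum_singles[symmetric] ..
  finally show ?thesis .
qed

text \<open>Comparing the components of highest \<open>L\<close>-degree peels off one component of the cofactor at a time.\<close>

lemma lcoprime_top_monomial:
  fixes L :: "('m \<Rightarrow> int) \<Rightarrow> int"
  assumes L: "\<And>m n. L (m + n) = L m + L n" and P: "\<And>m. m \<in> Poly_Mapping.keys P \<Longrightarrow> L m = e"
    and U': "\<And>m. m \<in> Poly_Mapping.keys U' \<Longrightarrow> L m < L M"
  shows "lcoprime P (lmon M + U')"
  unfolding lcoprime_def
proof (intro allI)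
  fix g show "P dvd (lmon M + U') * g \<longrightarrow> P dvd g"
  proof (induction "card (Poly_Mapping.keys g)" arbitrary: g rule: less_induct)
    case less
    show ?case
    proof (cases "g = 0")
      case False
      define D where "D = Max (L ` Poly_Mapping.keys g)"
      have D: "L m \<le> D" if "m \<in> Poly_Mapping.keys g" for m
        unfolding D_def using that by simp
      have "D \<in> L ` Poly_Mapping.keys g"
        unfolding D_def using False by (intro Max_in) auto
      then obtain m0 where m0: "m0 \<in> Poly_Mapping.keys g" "L m0 = D" by auto
      \<comment> \<open>The monomials of \<open>U'\<close> have degree below \<open>L M\<close> and
        those of \<open>g\<close> at most \<open>D\<close>, so only \<open>lmon M\<close> reaches
        the top degree.\<close>
      have U'g: "lproj L (L M + D) (U' * g) = 0"
      proof (rule poly_mapping_eqI)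
        fix m
        have "m \<notin> Poly_Mapping.keys (U' * g)" if "L m = L M + D"
        proof
          assume "m \<in> Poly_Mapping.keys (U' * g)"
          then obtain a b where ab: "a \<in> Poly_Mapping.keys U'" "b \<in> Poly_Mapping.keys g" "m = a + b"
            using Poly_Mapping.keys_mult[of U' g] by auto
          with U'[of a] D[of b] that show False by (simp add: L)
        qed
        then show "Poly_Mapping.lookup (lproj L (L M + D) (U' * g)) m = Poly_Mapping.lookup 0 m"
          by (auto simp: lookup_lproj in_keys_iff)
      qed
      show ?thesis
      proof
        assume "P dvd (lmon M + U') * g"
        then obtain h where h: "(lmon M + U') * g = P * h" by auto
        have "lproj L (L M + D) (P * h) = P * lproj L (L M + D - e) h"
          using lproj_mult_homogeneous[where L = L and e = e and d = "L M + D - e", OF L P] by simp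
        moreover have "lproj L (L M + D) (lmon M * g) = lmon M * lproj L D g"
          by (rule lproj_mult_homogeneous[where L = L, OF L]) simp
        then have "lproj L (L M + D) ((lmon M + U') * g) = lmon M * lproj L D g"
          by (simp only: distrib_right lproj_add U'g add_0_right)
        ultimately have "P dvd lmon M * lproj L D g"
          using h by (metis dvd_triv_left)
        then have top: "P dvd lproj L D g"
          by (simp only: dvd_lmon_mult_iff)
        have "Poly_Mapping.keys (g - lproj L D g) \<subseteq> Poly_Mapping.keys g - {m0}"
          using m0 by (auto simp: in_keys_iff lookup_minus lookup_lproj split: if_splits)
        then have "card (Poly_Mapping.keys (g - lproj L D g)) < card (Poly_Mapping.keys g)"
          using m0 by (intro psubset_card_mono) auto
        moreover have "P dvd (lmon M + U') * (g - lproj L D g)"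
          unfolding right_diff_distrib
          by (rule dvd_diff[OF \<open>P dvd (lmon M + U') * g\<close> dvd_mult[OF top]])
        ultimately have "P dvd g - lproj L D g"
          using less by blast
        from dvd_add[OF this top] show "P dvd g" by simp
      qed
    qed simp
  qed
qed

section \<open>Mutation\<close>

abbreviation mmut :: "'m \<Rightarrow> ('m \<Rightarrow> 'm \<Rightarrow> int) \<Rightarrow> 'm \<Rightarrow> 'm \<Rightarrow> int" where
  "mmut \<equiv> mat_mut id"

text \<open>The symmetrizer is named because every mutation preserves the same \<open>d\<close>;
  later it converts rows into columns and weights the quadratic form.\<close>

definition skew_by :: "('m \<Rightarrow> int) \<Rightarrow> ('m \<Rightarrow> 'm \<Rightarrow> int) \<Rightarrow> bool" where
  "skew_by d B \<longleftrightarrow> (\<forall>i. d i > 0) \<and> (\<forall>i j. d i * B i j = - (d j * B j i))"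

lemma posp_nonneg [simp]: "posp a \<ge> 0"
  by (simp add: posp_def)

lemma posp_zero [simp]: "posp 0 = 0"
  by (simp add: posp_def)

lemma posp_of_nonneg: "a \<ge> 0 \<Longrightarrow> posp a = a" and posp_of_nonpos: "a \<le> 0 \<Longrightarrow> posp a = 0"
  by (auto simp: posp_def)

lemma posp_diff: "posp a - posp (- a) = a"
  by (simp add: posp_def)

lemma posp_scale: "c \<ge> 0 \<Longrightarrow> posp (c * a) = c * posp a"
  by (auto simp: posp_def max_def mult_le_0_iff zero_le_mult_iff)

text \<open>In this symmetric form the paths through \<open>k\<close> in the two directions enter
  with opposite signs, which makes the behaviour under negation, transposition and repetition
  visible.\<close>

lemma mmut_apply: "mmut k B i j = (if i = k \<or> j = k then - B i j
    else B i j + posp (B i k) * posp (B k j) - posp (- B i k) * posp (- B k j))"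
  by (auto simp: mat_mut_def posp_def max_def algebra_simps)

lemma mmut_neg: "mmut k (\<lambda>i j. - B i j) = (\<lambda>i j. - mmut k B i j)"
  by (intro ext) (auto simp: mmut_apply)

context
  fixes d :: "'m \<Rightarrow> int" and B :: "'m \<Rightarrow> 'm \<Rightarrow> int"
  assumes skew: "skew_by d B"
begin

lemma skew_by_pos: "d i > 0"
  using skew by (simp add: skew_by_def)

lemma skew_by_eq: "d i * B i j = - (d j * B j i)"
  using skew unfolding skew_by_def by blast

lemma skew_by_diag: "B i i = 0"
  using skew_by_eq[of i i] skew_by_pos[of i] by auto

lemma skew_by_posp: "d i * posp (B i j) = d j * posp (- B j i)"
  using posp_scale[of "d i" "B i j"] posp_scale[of "d j" "- B j i"] skew_by_pos[of i] skew_by_pos[of j]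
    skew_by_eq[of i j] by simp

lemma skew_by_posp': "d i * posp (- B i j) = d j * posp (B j i)"
  using posp_scale[of "d i" "- B i j"] posp_scale[of "d j" "B j i"] skew_by_pos[of i] skew_by_pos[of j]
    skew_by_eq[of i j] by simp

lemma skew_by_pos_iff: "B i j > 0 \<longleftrightarrow> B j i < 0"
proof -
  have "B i j > 0 \<longleftrightarrow> d i * B i j > 0" "B j i < 0 \<longleftrightarrow> d j * B j i < 0"
    using skew_by_pos[of i] skew_by_pos[of j] by (simp_all add: zero_less_mult_iff mult_less_0_iff)
  then show ?thesis using skew_by_eq[of i j] by linarith
qed

lemma skew_by_zero_iff: "B i j = 0 \<longleftrightarrow> B j i = 0"
  using skew_by_eq[of i j] skew_by_pos[of i] skew_by_pos[of j] by auto

lemma skew_by_neg: "skew_by d (\<lambda>i j. - B i j)"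
  unfolding skew_by_def
proof (intro conjI allI)
  fix i j
  show "d i * - B i j = - (d j * - B j i)"
    using skew_by_eq[of i j] by simp
qed (rule skew_by_pos)

lemma skew_by_mmut: "skew_by d (mmut k B)"
  unfolding skew_by_def
proof (intro conjI allI)
  fix i j
  show "d i * mmut k B i j = - (d j * mmut k B j i)"
  proof (cases "i = k \<or> j = k")
    case False
    have "d i * (posp (B i k) * posp (B k j)) = d j * (posp (- B j k) * posp (- B k i))"
    proof -
      have "d i * (posp (B i k) * posp (B k j)) = posp (- B k i) * (d k * posp (B k j))"
        using skew_by_posp[of i k] by (simp add: ac_simps)
      also have "\<dots> = d j * (posp (- B j k) * posp (- B k i))"
        using skew_by_posp[of k j] by (simp add: ac_simps)
      finally show ?thesis .
    qed
    moreover have "d i * (posp (- B i k) * posp (- B k j)) = d j * (posp (B j k) * posp (B k i))"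
    proof -
      have "d i * (posp (- B i k) * posp (- B k j)) = posp (B k i) * (d k * posp (- B k j))"
        using skew_by_posp'[of i k] by (simp add: ac_simps)
      also have "\<dots> = d j * (posp (B j k) * posp (B k i))"
        using skew_by_posp'[of k j] by (simp add: ac_simps)
      finally show ?thesis .
    qed
    ultimately show ?thesis
      using False skew_by_eq[of i j] by (simp add: mmut_apply algebra_simps)
  qed (use skew_by_eq[of i j] in \<open>auto simp: mmut_apply\<close>)
qed (simp add: skew_by_pos)

lemma mmut_mmut: "mmut k (mmut k B) = B"
  by (intro ext) (auto simp: mmut_apply)

end

lemma skew_symmetrizable_iff: "skew_symmetrizable B \<longleftrightarrow> (\<exists>d. skew_by d B)"
  by (simp add: skew_symmetrizable_def skew_by_def)

section \<open>Linear independence of the mutable columns\<close>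

definition cols_indep :: "'m set \<Rightarrow> ('m::finite \<Rightarrow> 'm \<Rightarrow> int) \<Rightarrow> bool" where
  "cols_indep K B \<longleftrightarrow> (\<forall>c. (\<forall>k. k \<notin> K \<longrightarrow> c k = 0) \<longrightarrow> (\<forall>i. (\<Sum>k\<in>UNIV. c k * B i k) = 0) \<longrightarrow> (\<forall>k. c k = 0))"

lemma cols_indepD:
  assumes "cols_indep K B" "\<And>k. k \<notin> K \<Longrightarrow> c k = 0" "\<And>i. (\<Sum>k\<in>UNIV. c k * B i k) = 0"
  shows "c k = 0"
  using assms unfolding cols_indep_def by blast

text \<open>Row \<open>k\<close> of a relation among the new columns shows that the terms with the
  factor \<open>B k j\<close> cancel in total. What remains is a relation among the old columns in
  which only the coefficient of column \<open>k\<close> has changed.\<close>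

lemma cols_indep_mmut:
  assumes "cols_indep K B" "k \<in> K" "B k k = 0"
  shows "cols_indep K (mmut k B)"
  unfolding cols_indep_def
proof (intro allI impI)
  fix c l
  assume c: "\<forall>l. l \<notin> K \<longrightarrow> c l = 0" and s: "\<forall>i. (\<Sum>j\<in>UNIV. c j * mmut k B i j) = 0"
  define c' where "c' = c(k := (\<Sum>j\<in>UNIV - {k}. c j * posp (B k j)) - c k)"
  have split: "(\<Sum>j\<in>UNIV. f j) = f k + (\<Sum>j\<in>UNIV - {k}. f j)" for f :: "'a \<Rightarrow> int"
    by (simp add: sum.remove[of UNIV k])
  have row: "(\<Sum>j\<in>UNIV - {k}. c j * B k j) = 0"
    using s[rule_format, of k] assms(3) by (simp add: split mmut_apply sum_negf)
  have "(\<Sum>j\<in>UNIV. c' j * B i j) = 0" for i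
  proof (cases "i = k")
    case True
    then show ?thesis using row assms(3) by (simp add: split c'_def)
  next
    case False
    have "0 = c k * (- B i k) + (\<Sum>j\<in>UNIV - {k}. c j * (B i j + B i k * posp (B k j) + posp (- B i k) * B k j))"
      using s[rule_format, of i] False by (simp add: split mat_mut_def)
    also have "\<dots> = c k * (- B i k) + ((\<Sum>j\<in>UNIV - {k}. c j * B i j) + B i k * (\<Sum>j\<in>UNIV - {k}. c j * posp (B k j))
        + posp (- B i k) * (\<Sum>j\<in>UNIV - {k}. c j * B k j))"
      by (simp add: sum_distrib_left sum.distrib[symmetric] algebra_simps)
    also have "\<dots> = (\<Sum>j\<in>UNIV. c' j * B i j)"
      unfolding row by (simp add: split c'_def algebra_simps)
    finally show ?thesis by simp
  qed
  moreover have "c' j = 0" if "j \<notin> K" for j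
    using that c assms(2) by (auto simp: c'_def)
  ultimately have z: "c' j = 0" for j
    using cols_indepD[OF assms(1)] by blast
  then have "c j = 0" if "j \<noteq> k" for j
    using that by (metis c'_def fun_upd_other)
  moreover from this have "c k = 0"
    using z[of k] by (simp add: c'_def)
  ultimately show "c l = 0" by (cases "l = k") auto
qed

text \<open>Two independent columns have a nonvanishing 2 by 2 minor. Expanding along column
  \<open>j\<close> gives a functional that kills column \<open>j\<close> and takes this minor as its
  value on column \<open>k\<close>.\<close>

lemma cols_indep_functional:
  assumes "cols_indep K B" "j \<in> K" "k \<in> K" "j \<noteq> k"
  obtains \<phi> where "(\<Sum>i\<in>UNIV. \<phi> i * B i j) = (0 :: int)" "(\<Sum>i\<in>UNIV. \<phi> i * B i k) \<noteq> 0"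
proof -
  have two: "(\<Sum>l\<in>UNIV. (if l = j then x else if l = k then y else 0) * B i l) = x * B i j + y * B i k" for x y i
  proof -
    have "(\<Sum>l\<in>UNIV. (if l = j then x else if l = k then y else 0) * B i l)
      = (\<Sum>l\<in>UNIV. (if l = j then x * B i l else 0) + (if l = k then y * B i l else 0))"
      using assms(4) by (intro sum.cong) auto
    then show ?thesis by (simp add: sum.distrib)
  qed
  have "\<exists>i l. B i j * B l k - B l j * B i k \<noteq> 0"
  proof (rule ccontr)
    assume "\<not> ?thesis"
    then have e: "B i j * B l k = B l j * B i k" for i l by auto
    show False
    proof (cases "\<exists>i. B i j \<noteq> 0")
      case True
      then obtain i where i: "B i j \<noteq> 0" by auto
      have "(if k = j then B i k else if k = k then - B i j else 0) = 0"
        by (rule cols_indepD[OF assms(1), where c = "\<lambda>l. if l = j then B i k else if l = k then - B i j else 0"])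
          (use assms e in \<open>auto simp only: two, auto simp: ac_simps\<close>)
      with i assms(4) show False by simp
    next
      case False
      have "(if j = j then 1 else if j = k then 0 else 0 :: int) = 0"
        by (rule cols_indepD[OF assms(1), where c = "\<lambda>l. if l = j then 1 else if l = k then 0 else 0"])
          (use assms False in \<open>auto simp only: two, auto\<close>)
      then show False by simp
    qed
  qed
  then obtain i l where il: "B i j * B l k - B l j * B i k \<noteq> 0" by blast
  then have "i \<noteq> l" by auto
  have two': "(\<Sum>r\<in>UNIV. (if r = i then - B l j else if r = l then B i j else 0) * B r m)
      = - B l j * B i m + B i j * B l m" for m
  proof -
    have "(\<Sum>r\<in>UNIV. (if r = i then - B l j else if r = l then B i j else 0) * B r m)
      = (\<Sum>r\<in>UNIV. (if r = i then - B l j * B r m else 0) + (if r = l then B i j * B r m else 0))"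
      using \<open>i \<noteq> l\<close> by (intro sum.cong) auto
    then show ?thesis by (simp add: sum.distrib)
  qed
  show ?thesis
    by (rule that[of "\<lambda>r. if r = i then - B l j else if r = l then B i j else 0"])
      (use il in \<open>auto simp only: two', auto simp: ac_simps\<close>)
qed

section \<open>Exchange relations on positive reals and the Laurent phenomenon\<close>

definition pmut :: "('m::finite \<Rightarrow> 'm \<Rightarrow> int) \<Rightarrow> 'm \<Rightarrow> ('m \<Rightarrow> real) \<Rightarrow> 'm \<Rightarrow> real" where
  "pmut B k z = z(k := (pw z (\<lambda>i. posp (B i k)) + pw z (\<lambda>i. posp (- B i k))) / z k)"

primrec pmuts :: "('m::finite \<Rightarrow> 'm \<Rightarrow> int) \<Rightarrow> 'm list \<Rightarrow> ('m \<Rightarrow> real) \<Rightarrow> 'm \<Rightarrow> real" where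
  "pmuts B [] z = z"
| "pmuts B (k # ks) z = pmuts (mmut k B) ks (pmut B k z)"

lemma pmut_pos: "(\<And>i. z i > 0) \<Longrightarrow> pmut B k z i > 0"
  by (simp add: pmut_def pw_pos add_pos_pos)

lemma pmuts_pos: "(\<And>i. z i > 0) \<Longrightarrow> pmuts B ks z i > 0"
  by (induction ks arbitrary: B z) (auto simp: pmut_pos)

lemma pw_upd: "pw (z(j := y)) m = y powi m j * pw z (m(j := 0))"
proof -
  have "pw (z(j := y)) m = y powi m j * (\<Prod>i\<in>UNIV - {j}. z i powi m i)"
    unfolding pw_def by (subst prod.remove[of UNIV j]) (auto intro!: prod.cong)
  moreover have "pw z (m(j := 0)) = (\<Prod>i\<in>UNIV - {j}. z i powi m i)"
    unfolding pw_def by (subst prod.remove[of UNIV j]) (auto intro!: prod.cong)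
  ultimately show ?thesis by simp
qed

lemma pw_upd_zero: "m j = 0 \<Longrightarrow> pw (z(j := y)) m = pw z m"
  by (simp add: pw_upd fun_upd_idem)

lemma pmut_pmut:
  assumes "\<And>i. z i > 0" "B k k = 0"
  shows "pmut (mmut k B) k (pmut B k z) = z"
proof -
  let ?s = "pw z (\<lambda>i. posp (B i k)) + pw z (\<lambda>i. posp (- B i k))"
  have "?s > 0" using assms(1) by (simp add: pw_pos add_pos_pos)
  moreover have "z k > 0" by (rule assms(1))
  ultimately show ?thesis
    using assms(2) unfolding pmut_def by (auto simp: mmut_apply pw_upd_zero add.commute)
qed

definition laurent_fun :: "(('m::finite \<Rightarrow> real) \<Rightarrow> real) \<Rightarrow> bool" where
  "laurent_fun f \<longleftrightarrow> (\<exists>p. \<forall>z. (\<forall>i. z i > 0) \<longrightarrow> f z = lev z p)"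

abbreviation unitv :: "'m \<Rightarrow> 'm \<Rightarrow> int" where
  "unitv i \<equiv> (\<lambda>r. if r = i then 1 else 0)"

lemma pw_unitv: "pw z (unitv i) = z i"
proof -
  have "(\<Prod>r\<in>UNIV. z r powi unitv i r) = (\<Prod>r\<in>UNIV. if r = i then z r else 1)"
    by (intro prod.cong) auto
  then show ?thesis by (simp add: pw_def)
qed

lemma pw_neg_unitv: "pw z (- unitv i) = inverse (z i)"
proof -
  have "(\<Prod>r\<in>UNIV. z r powi (- unitv i) r) = (\<Prod>r\<in>UNIV. if r = i then inverse (z r) else 1)"
    by (intro prod.cong) (auto simp: power_int_minus)
  then show ?thesis by (simp add: pw_def)
qed

lemma lmon_prod: "(\<Prod>a\<in>A. lmon (f a)) = lmon (\<Sum>a\<in>A. f a)"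
  by (induction A rule: infinite_finite_induct)
    (simp_all only: prod.infinite sum.infinite prod.empty sum.empty prod.insert sum.insert lmon_mult
      single_one not_False_eq_True)

text \<open>Substitution of Laurent polynomials is harmless once all exponents are nonnegative, and
  a high power of the product of all \<open>W i\<close> achieves this. The exponent \<open>a\<close>
  is a crude bound, the sum of the absolute values of all exponents in \<open>q\<close>.\<close>

lemma laurent_clear_denominators:
  fixes W :: "'m::finite \<Rightarrow> 'm laurent"
  assumes W: "\<And>z i. (\<And>i. z i > 0) \<Longrightarrow> w z i = lev z (W i)" and pos: "\<And>z i. (\<And>i. z i > 0) \<Longrightarrow> w z i > 0"
  obtains a h where "\<And>z. (\<And>i. z i > 0) \<Longrightarrow> lev z (prod W UNIV) ^ a * lev (w z) q = lev z h"
proof -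
  define a where "a = (\<Sum>m\<in>Poly_Mapping.keys q. \<Sum>i\<in>UNIV. nat \<bar>m i\<bar>)"
  have a: "m i + int a \<ge> 0" if "m \<in> Poly_Mapping.keys q" for m i
  proof -
    have "nat \<bar>m i\<bar> \<le> (\<Sum>i\<in>UNIV. nat \<bar>m i\<bar>)" by (intro member_le_sum) auto
    also have "\<dots> \<le> a" unfolding a_def using that by (intro member_le_sum) auto
    finally show ?thesis by linarith
  qed
  define h where "h = (\<Sum>m\<in>Poly_Mapping.keys q.
    Poly_Mapping.single 0 (Poly_Mapping.lookup q m) * (\<Prod>i\<in>UNIV. W i ^ nat (m i + int a)))"
  have "lev z (prod W UNIV) ^ a * lev (w z) q = lev z h" if z: "\<And>i. z i > 0" for z
  proof -
    have *: "lev z (W i) ^ nat (m i + int a) = lev z (W i) ^ a * w z i powi m i"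
      if "m \<in> Poly_Mapping.keys q" for m i
    proof -
      have "w z i \<noteq> 0" using pos[of z i] z by force
      then have "w z i powi (m i + int a) = w z i powi m i * w z i ^ a"
        by (simp add: power_int_add)
      then show ?thesis
        using a[OF that, of i] W[of z i] z by (simp add: power_int_def mult.commute)
    qed
    have "lev z h = (\<Sum>m\<in>Poly_Mapping.keys q. of_rat (Poly_Mapping.lookup q m)
      * (\<Prod>i\<in>UNIV. lev z (W i) ^ nat (m i + int a)))"
      unfolding h_def by (simp add: lev_sum lev_mult z lev_prod lev_power pw_zero)
    also have "\<dots> = (\<Sum>m\<in>Poly_Mapping.keys q. of_rat (Poly_Mapping.lookup q m)
      * (\<Prod>i\<in>UNIV. lev z (W i) ^ a * w z i powi m i))"
      using * by (intro sum.cong arg_cong2[where f = "(*)"] prod.cong refl) auto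
    also have "\<dots> = lev z (prod W UNIV) ^ a * lev (w z) q"
      unfolding lev_def[of "w z"] pw_def
      by (simp add: prod.distrib lev_prod z prod_power_distrib sum_distrib_left ac_simps)
    finally show ?thesis by simp
  qed
  then show ?thesis using that by blast
qed

text \<open>If \<open>f\<close> has one denominator built from \<open>P\<close> and a monomial, and
  another one coprime to \<open>P\<close>, then the power of \<open>P\<close> divides the numerator
  \<open>h1\<close>, and only the monomial, a unit, remains as denominator.\<close>

lemma laurent_fun_divide:
  assumes P: "\<And>z. (\<And>i. z i > 0) \<Longrightarrow> lev z P > 0" and U: "lcoprime P U"
    and h1: "\<And>z. (\<And>i. z i > 0) \<Longrightarrow> lev z (P * lmon \<mu>) ^ a * f z = lev z h1"
    and h2: "\<And>z. (\<And>i. z i > 0) \<Longrightarrow> lev z U ^ b * f z = lev z h2"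
  shows "laurent_fun f"
proof -
  have cancel: "p = q" if "P * p = P * q" for p q
  proof (rule lev_inject)
    fix z :: "'a \<Rightarrow> real" assume z: "\<And>i. z i > 0"
    have "lev z P * lev z p = lev z P * lev z q"
      using arg_cong[OF that, of "lev z"] by (simp add: lev_mult z)
    with P[of z, OF z] show "lev z p = lev z q" by simp
  qed
  have "P ^ a * (lmon \<mu> ^ a * h2) = U ^ b * h1"
  proof (rule lev_inject)
    fix z :: "'a \<Rightarrow> real" assume z: "\<And>i. z i > 0"
    have "lev z (P ^ a * (lmon \<mu> ^ a * h2)) = lev z (P * lmon \<mu>) ^ a * lev z h2"
      by (simp add: lev_mult[of z, OF z] lev_power[of z, OF z] power_mult_distrib)
    also have "\<dots> = lev z U ^ b * (lev z (P * lmon \<mu>) ^ a * f z)"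
      by (simp only: h2[of z, OF z, symmetric] ac_simps)
    also have "\<dots> = lev z (U ^ b * h1)"
      by (subst h1[of z, OF z]) (simp only: lev_mult[of z, OF z] lev_power[of z, OF z])
    finally show "lev z (P ^ a * (lmon \<mu> ^ a * h2)) = lev z (U ^ b * h1)" .
  qed
  then have "P ^ a dvd h1"
    by (rule lcoprime_power_dvd[OF lcoprime_power[OF U]]) (rule cancel)
  then obtain h where h: "h1 = P ^ a * h" by auto
  have "f z = lev z (lmon (- \<mu>) ^ a * h)" if z: "\<And>i. z i > 0" for z
  proof -
    have m: "pw z \<mu> * pw z (- \<mu>) = 1"
      using pw_add[of z, OF z, of \<mu> "- \<mu>"] by (simp add: pw_zero)
    have "lev z P ^ a * (pw z \<mu> ^ a * f z) = lev z P ^ a * lev z h"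
      using h1[of z, OF z] by (simp add: h lev_mult[of z, OF z] lev_power[of z, OF z] power_mult_distrib ac_simps)
    then have "pw z \<mu> ^ a * f z = lev z h"
      using P[of z, OF z] by simp
    then have "(pw z (- \<mu>) * pw z \<mu>) ^ a * f z = pw z (- \<mu>) ^ a * lev z h"
      by (simp add: power_mult_distrib ac_simps)
    then show ?thesis
      using m by (simp add: lev_mult[of z, OF z] lev_power[of z, OF z] ac_simps)
  qed
  then show ?thesis unfolding laurent_fun_def by blast
qed

section \<open>Exchange polynomials and their coprimality\<close>

definition exch :: "('m::finite \<Rightarrow> 'm \<Rightarrow> int) \<Rightarrow> 'm \<Rightarrow> 'm laurent" where
  "exch B k = lmon (\<lambda>i. posp (B i k)) + lmon (\<lambda>i. posp (- B i k))"

lemma lev_exch: "lev z (exch B k) = pw z (\<lambda>i. posp (B i k)) + pw z (\<lambda>i. posp (- B i k))"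
  by (simp add: exch_def lev_add)

lemma lev_exch_pos: "(\<And>i. z i > 0) \<Longrightarrow> lev z (exch B k) > 0"
  by (simp add: lev_exch pw_pos add_pos_pos)

lemma pmut_exch: "(\<And>i. z i > 0) \<Longrightarrow> pmut B k z k = lev z (exch B k * lmon (- unitv k))"
  by (simp add: pmut_def lev_exch[symmetric] lev_mult pw_neg_unitv divide_inverse)

lemma exch_neg: "exch (\<lambda>i j. - B i j) k = exch B k"
  by (simp add: exch_def add.commute)

lemma pmut_neg: "pmut (\<lambda>i j. - B i j) k z = pmut B k z"
  by (simp add: pmut_def add.commute)

lemma keys_exch: "m \<in> Poly_Mapping.keys (exch B k) \<Longrightarrow> m = (\<lambda>i. posp (B i k)) \<or> m = (\<lambda>i. posp (- B i k))"
  unfolding exch_def using Poly_Mapping.keys_add by fastforce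

text \<open>A functional that kills column \<open>j\<close> but not column \<open>k\<close> grades
  the monomials so that \<open>exch B j\<close> is homogeneous while the two terms of
  \<open>exch B k\<close> have different degrees. Hence \<open>exch B k\<close> has a single top
  monomial.\<close>

lemma lcoprime_exch:
  assumes "cols_indep K B" "j \<in> K" "k \<in> K" "j \<noteq> k"
  shows "lcoprime (exch B j) (exch B k)"
proof -
  obtain \<phi> where 0: "(\<Sum>i\<in>UNIV. \<phi> i * B i j) = 0" and 1: "(\<Sum>i\<in>UNIV. \<phi> i * B i k) \<noteq> 0"
    using cols_indep_functional[OF assms] by blast
  define L where "L m = (\<Sum>i\<in>UNIV. \<phi> i * m i)" for m :: "'a \<Rightarrow> int"
  have L: "L (m + n) = L m + L n" for m n
    by (simp add: L_def algebra_simps sum.distrib)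
  have dif: "L (\<lambda>i. posp (B i l)) - L (\<lambda>i. posp (- B i l)) = (\<Sum>i\<in>UNIV. \<phi> i * B i l)" for l
    unfolding L_def sum_subtractf[symmetric] right_diff_distrib[symmetric] posp_diff ..
  have P: "L m = L (\<lambda>i. posp (B i j))" if "m \<in> Poly_Mapping.keys (exch B j)" for m
    using keys_exch[OF that] dif[of j] 0 by auto
  consider "L (\<lambda>i. posp (- B i k)) < L (\<lambda>i. posp (B i k))" | "L (\<lambda>i. posp (B i k)) < L (\<lambda>i. posp (- B i k))"
    using dif[of k] 1 by linarith
  then show ?thesis
  proof cases
    case 1
    then show ?thesis unfolding exch_def[of B k]
      by (intro lcoprime_top_monomial[where L = L, OF L P]) auto
  next
    case 2
    then show ?thesis unfolding exch_def[of B k] add.commute[of "lmon (\<lambda>i. posp (B i k))"]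
      by (intro lcoprime_top_monomial[where L = L, OF L P]) auto
  qed
qed

definition free_of :: "'m \<Rightarrow> 'm laurent \<Rightarrow> bool" where
  "free_of j p \<longleftrightarrow> (\<forall>m\<in>Poly_Mapping.keys p. m j = 0)"

lemma free_of_mult: "free_of j p \<Longrightarrow> free_of j q \<Longrightarrow> free_of j (p * q)"
  unfolding free_of_def using Poly_Mapping.keys_mult[of p q] by fastforce

lemma free_of_add: "free_of j p \<Longrightarrow> free_of j q \<Longrightarrow> free_of j (p + q)"
  unfolding free_of_def using Poly_Mapping.keys_add[of p q] by fastforce

lemma free_of_lmon: "m j = 0 \<Longrightarrow> free_of j (lmon m)"
  unfolding free_of_def by simp

lemma free_of_one: "free_of j 1"
  unfolding free_of_def by simp

lemma free_of_power: "free_of j p \<Longrightarrow> free_of j (p ^ n)"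
  by (induction n) (auto simp: free_of_one free_of_mult)

lemma free_of_of_nat: "free_of j (of_nat n)"
  by (induction n) (auto simp: free_of_one free_of_add, simp add: free_of_def)

lemma lmon_power: "lmon m ^ n = lmon (\<lambda>i. int n * m i)"
proof (induction n)
  case 0
  then show ?case by (simp add: zero_fun_def[symmetric])
next
  case (Suc n)
  have "m + (\<lambda>i. int n * m i) = (\<lambda>i. int (Suc n) * m i)"
    by (intro ext) (simp add: algebra_simps)
  with Suc show ?case by (simp add: lmon_mult)
qed

lemma pmut_upd: "pmut B k z = z(k := pmut B k z k)"
  by (simp add: pmut_def)

text \<open>\<open>X2\<close> and \<open>X3\<close> are the variables created at the second and
  third of the mutations \<open>j\<close>, \<open>k\<close>, \<open>j\<close>. Modulo
  \<open>P = exch B j\<close> the first new variable \<open>X1\<close> vanishes, which makes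
  \<open>X2\<close> congruent to a monomial and leaves one or two simple terms of \<open>X3\<close>.
  The assumed sign puts \<open>X1\<close>, with exponent \<open>\<beta>\<close>, into the first term
  of the exchange at \<open>k\<close>; \<open>\<gamma>\<close> is the exponent of \<open>X2\<close>
  in the second exchange at \<open>j\<close>.\<close>

lemma three_step_neg:
  fixes B :: "'m::finite \<Rightarrow> 'm \<Rightarrow> int"
  assumes skew: "skew_by d B" and jk: "j \<noteq> k" "B j k < 0"
  obtains X2 X3 where
    "\<And>z. (\<And>i. z i > 0) \<Longrightarrow> pmut (mmut j B) k (pmut B j z) k = lev z X2"
    "\<And>z. (\<And>i. z i > 0) \<Longrightarrow>
      pmut (mmut k (mmut j B)) j (pmut (mmut j B) k (pmut B j z)) j = lev z X3"
    "lcoprime (exch B j) X2" "lcoprime (exch B j) X3"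
proof -
  define B1 where "B1 = mmut j B"
  define B2 where "B2 = mmut k B1"
  define \<beta> where "\<beta> = nat (- B j k)"
  define \<gamma> where "\<gamma> = nat (B k j)"
  have pos: "B k j > 0"
    using skew_by_pos_iff[OF skew] jk by blast
  have \<beta>: "int \<beta> = - B j k" "\<beta> > 0" and \<gamma>: "int \<gamma> = B k j" "\<gamma> > 0"
    using jk pos by (auto simp: \<beta>_def \<gamma>_def)
  have s1: "skew_by d B1" and s2: "skew_by d B2"
    unfolding B1_def B2_def by (intro skew_by_mmut skew)+
  have B1jk: "B1 j k = int \<beta>" and B1kj: "B1 k j = - int \<gamma>" and B1ij: "B1 i j = - B i j" for i
    using jk by (auto simp: B1_def mmut_apply \<beta> \<gamma>)
  have B2kj: "B2 k j = int \<gamma>"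
    using jk by (simp add: B2_def mmut_apply B1kj)
  have B2ij: "B2 i j = - B i j - int \<gamma> * posp (- B1 i k)" if "i \<noteq> k" for i
    using that jk(1) by (simp add: B2_def mmut_apply B1ij \<gamma>(1)[symmetric] posp_of_nonneg posp_of_nonpos)
  define pp where "pp = (\<lambda>i. posp (B i j))"
  define pm where "pm = (\<lambda>i. posp (- B i j))"
  define q1 where "q1 = (\<lambda>i. posp (B1 i k))(j := 0)"
  define q0 where "q0 = (\<lambda>i. posp (- B1 i k))"
  define r1 where "r1 = (\<lambda>i. posp (B2 i j))(k := 0)"
  define r0 where "r0 = (\<lambda>i. posp (- B2 i j))"
  have zeros: "q1 j = 0" "q0 j = 0" "r1 j = 0" "r0 j = 0" "r0 k = 0" "r1 k = 0" "q0 k = 0" "pp j = 0" "pm j = 0"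
    using jk(1) skew_by_diag[OF skew] skew_by_diag[OF s1] skew_by_diag[OF s2]
    by (auto simp: q1_def q0_def r1_def r0_def pp_def pm_def B1jk B2kj posp_of_nonpos)
  define P where "P = exch B j"
  define X1 where "X1 = P * lmon (- unitv j)"
  define a where "a = lmon q0 * lmon (- unitv k)"
  define b where "b = lmon q1 * lmon (- unitv k)"
  define X2 where "X2 = b * X1 ^ \<beta> + a"
  define S where "S = (\<Sum>s<\<gamma>. a ^ (\<gamma> - Suc s) * X2 ^ s)"
  define H where "H = b * X1 ^ (\<beta> - 1) * S"
  define U where "U = lmon r0 * lmon (- pp)"
  define X3 where "X3 = U * lmon (unitv j) + lmon r1 * H"
  \<comment> \<open>Since \<open>X2 - a\<close> is \<open>b * X1 ^ \<beta>\<close>, the difference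
    of the \<open>\<gamma>\<close>-th powers is divisible by \<open>X1\<close>; \<open>H\<close> is
    the explicit quotient.\<close>
  have XH: "X1 * H = X2 ^ \<gamma> - a ^ \<gamma>"
  proof -
    have "X1 * H = b * (X1 * X1 ^ (\<beta> - 1)) * S"
      unfolding H_def by (simp only: ac_simps)
    also have "X1 * X1 ^ (\<beta> - 1) = X1 ^ \<beta>"
      using \<beta>(2) by (metis power_minus_mult mult.commute)
    also have "b * X1 ^ \<beta> * S = (X2 - a) * S"
      by (simp add: X2_def)
    also have "\<dots> = X2 ^ \<gamma> - a ^ \<gamma>"
      unfolding S_def by (simp only: power_diff_sumr2)
    finally show ?thesis .
  qed
  \<comment> \<open>The comparison of exponents is the formula \<open>B2ij\<close>; coordinate
    \<open>k\<close> is matched by the denominator in \<open>a\<close>.\<close>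
  have aexp: "a ^ \<gamma> * lmon r1 = U * lmon pm"
  proof -
    have "(\<lambda>i. int \<gamma> * (q0 + - unitv k) i) + r1 = (r0 + - pp) + pm"
    proof
      fix i
      show "((\<lambda>i. int \<gamma> * (q0 + - unitv k) i) + r1) i = ((r0 + - pp) + pm) i"
      proof (cases "i = k")
        case True
        have "- int \<gamma> = - posp (B k j) + posp (- B k j)"
          using posp_diff[of "B k j"] \<gamma>(1) by simp
        then show ?thesis using True zeros by (simp add: pp_def pm_def)
      next
        case False
        have "int \<gamma> * posp (- B1 i k) + posp (B2 i j) = posp (- B2 i j) - B i j"
          using B2ij[OF False] posp_diff[of "B2 i j"] by simp
        then show ?thesis
          using False posp_diff[of "B i j"] by (simp add: q0_def r1_def r0_def pp_def pm_def)
      qed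
    qed
    then show ?thesis
      unfolding a_def U_def lmon_mult lmon_power by (simp only:)
  qed
  have UP: "U * P = lmon r0 + a ^ \<gamma> * lmon r1"
  proof -
    have "U * P = lmon r0 * (lmon (- pp) * lmon pp) + U * lmon pm"
      unfolding U_def P_def exch_def pp_def pm_def by (simp only: distrib_left mult.assoc)
    then show ?thesis by (simp only: lmon_unit mult_1_right aexp)
  qed
  \<comment> \<open>The exchange relation of the second mutation at \<open>j\<close>:
    \<open>lmon r0\<close> completes the part with \<open>a ^ \<gamma>\<close> to a multiple of
    \<open>P\<close>, and the rest is a multiple of \<open>X1\<close>.\<close>
  have XX: "X1 * X3 = X2 ^ \<gamma> * lmon r1 + lmon r0"
  proof -
    have "X1 * X3 = U * P * (lmon (- unitv j) * lmon (unitv j)) + lmon r1 * (X1 * H)"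
      unfolding X3_def X1_def by (simp only: distrib_left ac_simps)
    also have "\<dots> = (lmon r0 + a ^ \<gamma> * lmon r1) + lmon r1 * (X2 ^ \<gamma> - a ^ \<gamma>)"
      by (simp only: lmon_unit mult_1_right UP XH)
    also have "\<dots> = X2 ^ \<gamma> * lmon r1 + lmon r0"
      by (simp add: right_diff_distrib mult.commute)
    finally show ?thesis .
  qed
  have PX1: "P dvd X1" unfolding X1_def by simp
  have PX2: "P dvd X2 - a"
  proof -
    have "P dvd X1 ^ \<beta>"
      using PX1 \<beta>(2) by (metis dvd_power dvd_trans)
    then have "P dvd b * X1 ^ \<beta>" by (rule dvd_mult)
    then show ?thesis unfolding X2_def by simp
  qed
  have cop2: "lcoprime P X2"
  proof (rule lcoprime_cong)
    show "lcoprime P a" unfolding a_def lmon_mult by (rule lcoprime_lmon)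
  qed (rule PX2)
  \<comment> \<open>For \<open>\<beta>\<close> at least 2 the factor \<open>H\<close> still contains
    \<open>X1\<close>, so \<open>X3\<close> is a monomial modulo \<open>P\<close>. For
    \<open>\<beta> = 1\<close> a second term \<open>V\<close> survives.\<close>
  have cop3: "lcoprime P X3"
  proof (cases "\<beta> = 1")
    case False
    then have "\<beta> - 1 > 0" using \<beta>(2) by simp
    then have "P dvd X1 ^ (\<beta> - 1)"
      using PX1 by (metis dvd_power dvd_trans)
    then have "P dvd lmon r1 * H"
      unfolding H_def by (intro dvd_mult dvd_mult2)
    then have "P dvd X3 - U * lmon (unitv j)"
      unfolding X3_def by simp
    moreover have "lcoprime P (U * lmon (unitv j))"
      unfolding U_def lmon_mult by (rule lcoprime_lmon)
    ultimately show ?thesis by (rule lcoprime_cong[rotated])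
  next
    case True
    define V where "V = lmon r1 * (b * (of_nat \<gamma> * a ^ (\<gamma> - 1)))"
    have Xa: "P dvd X2 ^ s - a ^ s" for s
      unfolding power_diff_sumr2[of X2] using PX2 by (rule dvd_mult2)
    have "S - of_nat \<gamma> * a ^ (\<gamma> - 1) = (\<Sum>s<\<gamma>. a ^ (\<gamma> - Suc s) * (X2 ^ s - a ^ s))"
    proof -
      have "a ^ (\<gamma> - Suc s) * a ^ s = a ^ (\<gamma> - 1)" if "s < \<gamma>" for s
        using that by (simp add: power_add[symmetric])
      then have "(\<Sum>s<\<gamma>. a ^ (\<gamma> - Suc s) * a ^ s) = of_nat \<gamma> * a ^ (\<gamma> - 1)" by simp
      then show ?thesis unfolding S_def right_diff_distrib sum_subtractf by (simp only:)
    qed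
    then have "P dvd S - of_nat \<gamma> * a ^ (\<gamma> - 1)"
      using Xa by (auto intro!: dvd_sum dvd_mult)
    then have "P dvd lmon r1 * (b * (S - of_nat \<gamma> * a ^ (\<gamma> - 1)))"
      by (intro dvd_mult)
    moreover have "X3 - (U * lmon (unitv j) + V) = lmon r1 * (b * (S - of_nat \<gamma> * a ^ (\<gamma> - 1)))"
      unfolding X3_def V_def H_def using True by (simp add: right_diff_distrib)
    ultimately have d: "P dvd X3 - (U * lmon (unitv j) + V)" by (simp only:)
    have fV: "free_of j V"
      unfolding V_def a_def b_def using zeros jk(1)
      by (intro free_of_mult free_of_power free_of_of_nat free_of_lmon) auto
    \<comment> \<open>Graded by the exponent of variable \<open>j\<close>, both \<open>P\<close> and
      \<open>V\<close> have degree 0 while the monomial has degree 1, so it is the top term.\<close>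
    have "lcoprime P (lmon (r0 + - pp + unitv j) + V)"
    proof (rule lcoprime_top_monomial[where L = "\<lambda>m. m j" and e = 0])
      fix m assume "m \<in> Poly_Mapping.keys P"
      then show "m j = 0"
        using keys_exch[of m B j] zeros by (auto simp: P_def pp_def pm_def)
    next
      fix m assume "m \<in> Poly_Mapping.keys V"
      then have "m j = 0" using fV unfolding free_of_def by blast
      then show "m j < (r0 + - pp + unitv j) j"
        using zeros by simp
    qed simp
    then have "lcoprime P (U * lmon (unitv j) + V)"
      unfolding U_def lmon_mult .
    then show ?thesis using d by (rule lcoprime_cong)
  qed
  have ev1: "pmut B j z = z(j := lev z X1)" if z: "\<And>i. z i > 0" for z
    by (subst pmut_upd) (simp add: pmut_exch[of z, OF z] X1_def P_def)
  have ev2: "pmut B1 k (pmut B j z) k = lev z X2" if z: "\<And>i. z i > 0" for z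
  proof -
    have "pmut B1 k (pmut B j z) k
      = (pw (z(j := lev z X1)) (\<lambda>i. posp (B1 i k)) + pw (z(j := lev z X1)) q0) / z k"
      using jk(1) unfolding ev1[of z, OF z] by (simp add: pmut_def q0_def)
    also have "pw (z(j := lev z X1)) (\<lambda>i. posp (B1 i k)) = lev z X1 ^ \<beta> * pw z q1"
      unfolding pw_upd by (simp add: q1_def B1jk posp_of_nonneg)
    also have "pw (z(j := lev z X1)) q0 = pw z q0"
      using zeros by (simp add: pw_upd_zero)
    also have "(lev z X1 ^ \<beta> * pw z q1 + pw z q0) / z k = lev z X2"
      unfolding X2_def a_def b_def
      by (simp add: lev_add lev_mult[of z, OF z] lev_power[of z, OF z] pw_neg_unitv divide_inverse algebra_simps)
    finally show ?thesis .
  qed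
  have ev3: "pmut B2 j (pmut B1 k (pmut B j z)) j = lev z X3" if z: "\<And>i. z i > 0" for z
  proof -
    let ?z1 = "z(j := lev z X1)" and ?z2 = "z(j := lev z X1, k := lev z X2)"
    have "pmut B1 k (pmut B j z) = ?z2"
      by (subst pmut_upd, subst ev2[of z, OF z]) (simp add: ev1[of z, OF z])
    then have "pmut B2 j (pmut B1 k (pmut B j z)) j = (pw ?z2 (\<lambda>i. posp (B2 i j)) + pw ?z2 r0) / lev z X1"
      using jk(1) by (simp add: pmut_def r0_def)
    also have "pw ?z2 (\<lambda>i. posp (B2 i j)) = lev z X2 ^ \<gamma> * pw ?z1 r1"
      unfolding pw_upd[of _ k] by (simp add: r1_def B2kj posp_of_nonneg)
    also have "pw ?z1 r1 = pw z r1" using zeros by (simp add: pw_upd_zero)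
    also have "pw ?z2 r0 = pw z r0" using zeros by (simp add: pw_upd_zero)
    also have "lev z X2 ^ \<gamma> * pw z r1 + pw z r0 = lev z (X1 * X3)"
      unfolding XX by (simp add: lev_add lev_mult[of z, OF z] lev_power[of z, OF z])
    also have "\<dots> / lev z X1 = lev z X3"
    proof -
      have "lev z X1 > 0"
        unfolding X1_def P_def pmut_exch[of z, OF z, symmetric] by (rule pmut_pos) (rule z)
      then show ?thesis by (simp add: lev_mult[of z, OF z])
    qed
    finally show ?thesis .
  qed
  show ?thesis
    using that[of X2 X3] ev2 ev3 cop2 cop3 unfolding B2_def B1_def P_def by blast
qed

text \<open>The sign of \<open>B j k\<close> is normalised by negating the matrix, which leaves
  exchange polynomials unchanged. If the entry vanishes, the two mutations do not interact:
  \<open>X2\<close> is \<open>exch B k\<close> up to a monomial, \<open>X3\<close> is the original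
  variable, and coprimality comes from independence of the columns.\<close>

lemma three_step:
  fixes B :: "'m::finite \<Rightarrow> 'm \<Rightarrow> int"
  assumes skew: "skew_by d B" and jk: "j \<noteq> k" and K: "cols_indep K B" "j \<in> K" "k \<in> K"
  obtains X2 X3 where
    "\<And>z. (\<And>i. z i > 0) \<Longrightarrow> pmut (mmut j B) k (pmut B j z) k = lev z X2"
    "\<And>z. (\<And>i. z i > 0) \<Longrightarrow>
      pmut (mmut k (mmut j B)) j (pmut (mmut j B) k (pmut B j z)) j = lev z X3"
    "lcoprime (exch B j) X2" "lcoprime (exch B j) X3"
proof -
  consider "B j k < 0" | "B j k > 0" | "B j k = 0" by linarith
  then show ?thesis
  proof cases
    case 1
    from three_step_neg[OF skew jk this] that show ?thesis by blast
  next
    case 2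
    then have "(\<lambda>i j. - B i j) j k < 0" by simp
    from three_step_neg[OF skew_by_neg[OF skew] jk this] that show ?thesis
      unfolding mmut_neg pmut_neg exch_neg by blast
  next
    case 3
    then have 0: "B j k = 0" "B k j = 0"
      using skew_by_zero_iff[OF skew] by auto
    define B1 where "B1 = mmut j B"
    define B2 where "B2 = mmut k B1"
    have B1ik: "B1 i k = B i k" for i
      using jk 0 by (auto simp: B1_def mmut_apply)
    have B1kj: "B1 k j = 0"
      using 0 by (simp add: B1_def mmut_apply)
    have B2ij: "B2 i j = - B i j" for i
      using jk 0 B1kj by (auto simp: B2_def mmut_apply) (auto simp: B1_def mmut_apply)
    have diag: "B j j = 0"
      by (rule skew_by_diag[OF skew])
    have ev2: "pmut B1 k (pmut B j z) k = lev z (exch B k * lmon (- unitv k))" if z: "\<And>i. z i > 0" for z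
    proof -
      have "pmut B1 k (pmut B j z) k = pmut B k z k"
        using jk 0 by (subst pmut_upd[of B j]) (simp add: pmut_def B1ik pw_upd_zero)
      then show ?thesis by (simp add: pmut_exch[of z, OF z])
    qed
    have ev3: "pmut B2 j (pmut B1 k (pmut B j z)) j = lev z (lmon (unitv j))" if z: "\<And>i. z i > 0" for z
    proof -
      have "pmut B j z j > 0" using z by (rule pmut_pos)
      moreover have "pmut B2 j (pmut B1 k (pmut B j z)) j = pmut B j z j * z j / pmut B j z j"
      proof -
        have "pmut B2 j (pmut B1 k (pmut B j z)) j
            = (pw z (\<lambda>i. posp (B i j)) + pw z (\<lambda>i. posp (- B i j))) / pmut B j z j"
          using jk 0 diag
          by (subst pmut_upd[of B1 k], subst pmut_upd[of B j]) (simp add: pmut_def[of B2] B2ij pw_upd_zero add.commute)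
        moreover have "z j \<noteq> 0" using z[of j] by simp
        ultimately show ?thesis by (simp add: pmut_def)
      qed
      ultimately show ?thesis by (simp add: pw_unitv)
    qed
    show ?thesis
      using that[of "exch B k * lmon (- unitv k)" "lmon (unitv j)"] ev2 ev3 lcoprime_lmon
        lcoprime_mult[OF lcoprime_exch[OF K jk] lcoprime_lmon] unfolding B2_def B1_def by blast
  qed
qed

lemma prod_if_single:
  "(\<Prod>i\<in>(UNIV :: 'm::finite set). if i = j then x else f i) = x * (\<Prod>i\<in>UNIV - {j}. f i :: 'a :: comm_monoid_mult)"
  by (subst prod.remove[of UNIV j]) (auto intro!: arg_cong2[where f = "(*)"] prod.cong)

text \<open>Laurentness is known by induction in two other seeds: the one after \<open>j\<close>,
  and the one after \<open>j\<close>, \<open>k\<close>, \<open>j\<close>. In the initial variables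
  the denominators are, up to monomials, powers of \<open>exch B j\<close> in the first case and
  products of powers of \<open>X2\<close> and \<open>X3\<close> in the second, and these are
  coprime.\<close>

theorem laurent_phenomenon:
  fixes B :: "'m::finite \<Rightarrow> 'm \<Rightarrow> int"
  assumes "skew_by d B" "cols_indep K B" "set ks \<subseteq> K"
  shows "laurent_fun (\<lambda>z. pmuts B ks z i)"
  using assms
proof (induction "length ks" arbitrary: B ks rule: less_induct)
  case less
  note skew = less.prems(1)
  consider "ks = []" | j where "ks = [j]" | j rest where "ks = j # j # rest"
    | j k rest where "ks = j # k # rest" "j \<noteq> k"
    by (metis list.exhaust)
  then show ?case
  proof cases
    case 1
    then have "\<forall>z. (\<forall>i. z i > 0) \<longrightarrow> pmuts B ks z i = lev z (lmon (unitv i))"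
      by (simp add: pw_unitv)
    then show ?thesis unfolding laurent_fun_def by blast
  next
    case (2 j)
    have "pmuts B ks z i = lev z (if i = j then exch B j * lmon (- unitv j) else lmon (unitv i))"
      if "\<forall>i. z i > 0" for z
    proof (cases "i = j")
      case True
      then show ?thesis using 2 pmut_exch[of z B j] that by simp
    next
      case False
      then show ?thesis using 2 by (simp add: pmut_def pw_unitv)
    qed
    then show ?thesis unfolding laurent_fun_def by blast
  next
    case (3 j rest)
    have "pmuts B ks z i = pmuts B rest z i" if "\<forall>i. z i > 0" for z
      using that 3 by (simp add: mmut_mmut[OF skew] pmut_pmut skew_by_diag[OF skew])
    moreover have "laurent_fun (\<lambda>z. pmuts B rest z i)"
      using less.prems 3 by (intro less.hyps) auto
    ultimately show ?thesis unfolding laurent_fun_def by auto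
  next
    case (4 j k rest)
    define B1 where "B1 = mmut j B"
    define B2 where "B2 = mmut k B1"
    define B3 where "B3 = mmut j B2"
    have K: "j \<in> K" "k \<in> K" "set rest \<subseteq> K"
      using less.prems(3) 4 by auto
    have s: "skew_by d B1" "skew_by d B2" "skew_by d B3"
      unfolding B1_def B2_def B3_def by (intro skew_by_mmut skew)+
    have c1: "cols_indep K B1"
      unfolding B1_def by (intro cols_indep_mmut less.prems K skew_by_diag[OF skew])
    have c2: "cols_indep K B2"
      unfolding B2_def by (intro cols_indep_mmut c1 K skew_by_diag[OF s(1)])
    have c3: "cols_indep K B3"
      unfolding B3_def by (intro cols_indep_mmut c2 K skew_by_diag[OF s(2)])
    obtain X2 X3 where X2: "\<And>z. (\<And>i. z i > 0) \<Longrightarrow> pmut B1 k (pmut B j z) k = lev z X2"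
      and X3: "\<And>z. (\<And>i. z i > 0) \<Longrightarrow> pmut B2 j (pmut B1 k (pmut B j z)) j = lev z X3"
      and cop: "lcoprime (exch B j) X2" "lcoprime (exch B j) X3"
      using three_step[OF skew 4(2) less.prems(2) K(1,2)] unfolding B2_def B1_def by blast
    have "laurent_fun (\<lambda>z. pmuts B1 (k # rest) z i)"
      using 4 s c1 K by (intro less.hyps) auto
    then obtain q1 where q1: "\<And>z. (\<And>i. z i > 0) \<Longrightarrow> pmuts B1 (k # rest) z i = lev z q1"
      unfolding laurent_fun_def by blast
    \<comment> \<open>The repeated mutation at \<open>j\<close> cancels, so \<open>j # rest\<close>
      from the seed of \<open>B3\<close> ends where \<open>ks\<close> does, and it is shorter than
      \<open>ks\<close>.\<close>
    have "laurent_fun (\<lambda>z. pmuts B3 (j # rest) z i)"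
      using 4 s c3 K by (intro less.hyps) auto
    then obtain q3 where q3: "\<And>z. (\<And>i. z i > 0) \<Longrightarrow> pmuts B3 (j # rest) z i = lev z q3"
      unfolding laurent_fun_def by blast
    define w1 where "w1 = pmut B j"
    define w3 where "w3 = (\<lambda>z. pmut B2 j (pmut B1 k (pmut B j z)))"
    define f where "f = (\<lambda>z. pmuts B ks z i)"
    have w1pos: "w1 z i > 0" if "\<And>i. z i > 0" for z i
      unfolding w1_def by (intro pmut_pos that)
    have w3pos: "w3 z i > 0" if "\<And>i. z i > 0" for z i
      unfolding w3_def by (intro pmut_pos that)
    have f1: "f z = lev (w1 z) q1" if z: "\<And>i. z i > 0" for z
      using q1[of "w1 z"] w1pos[of z, OF z] 4 by (simp add: f_def w1_def B1_def)
    have f3: "f z = lev (w3 z) q3" if z: "\<And>i. z i > 0" for z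
    proof -
      have "pmuts B3 (j # rest) (w3 z) i = pmuts B2 rest (pmut B1 k (pmut B j z)) i"
        using s(2) by (simp add: B3_def w3_def mmut_mmut[OF s(2)])
          (subst pmut_pmut, auto intro!: pmut_pos z simp: skew_by_diag[OF s(2)])
      also have "\<dots> = f z"
        using 4 by (simp add: f_def B2_def B1_def)
      finally show ?thesis using q3[of "w3 z"] w3pos[of z, OF z] by simp
    qed
    define W1 where "W1 = (\<lambda>i. if i = j then exch B j * lmon (- unitv j) else lmon (unitv i))"
    define W3 where "W3 = (\<lambda>i. if i = j then X3 else if i = k then X2 else lmon (unitv i))"
    have w1: "w1 z i = lev z (W1 i)" if z: "\<And>i. z i > 0" for z i
    proof (cases "i = j")
      case True
      then show ?thesis using pmut_exch[of z B j, OF z] by (simp add: w1_def W1_def)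
    next
      case False
      then show ?thesis by (simp add: w1_def W1_def pmut_def pw_unitv)
    qed
    have w3: "w3 z i = lev z (W3 i)" if z: "\<And>i. z i > 0" for z i
    proof -
      consider "i = j" | "i = k" | "i \<noteq> j" "i \<noteq> k" by blast
      then show ?thesis
      proof cases
        case 1
        then show ?thesis using X3[of z, OF z] by (simp add: w3_def W3_def)
      next
        case 2
        then have "w3 z i = pmut B1 k (pmut B j z) k"
          using 4(2) unfolding w3_def by (subst pmut_upd) simp
        then show ?thesis using X2[of z, OF z] 2 4(2) by (simp add: W3_def)
      next
        case 3
        then have "w3 z i = z i"
          unfolding w3_def by (simp add: pmut_def)
        then show ?thesis using 3 by (simp add: W3_def pw_unitv)
      qed
    qed
    obtain a h1 where h1: "\<And>z. (\<And>i. z i > 0) \<Longrightarrow> lev z (prod W1 UNIV) ^ a * lev (w1 z) q1 = lev z h1"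
      using laurent_clear_denominators[of w1 W1 q1] w1 w1pos by blast
    obtain b h3 where h3: "\<And>z. (\<And>i. z i > 0) \<Longrightarrow> lev z (prod W3 UNIV) ^ b * lev (w3 z) q3 = lev z h3"
      using laurent_clear_denominators[of w3 W3 q3] w3 w3pos by blast
    have W1prod: "prod W1 UNIV = exch B j * lmon (- unitv j + (\<Sum>i\<in>UNIV - {j}. unitv i))"
      unfolding W1_def prod_if_single lmon_prod mult.assoc lmon_mult ..
    have "laurent_fun f"
    proof (rule laurent_fun_divide)
      show "lcoprime (exch B j) (prod W3 UNIV)"
        by (intro lcoprime_prod) (auto simp: W3_def cop lcoprime_lmon)
      show "lev z (prod W3 UNIV) ^ b * f z = lev z h3" if "\<And>i. z i > 0" for z
        using h3[of z] f3[of z] that by simp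
      show "lev z (exch B j * lmon (- unitv j + (\<Sum>i\<in>UNIV - {j}. unitv i))) ^ a * f z = lev z h1" if "\<And>i. z i > 0" for z
        using h1[of z] f1[of z] that unfolding W1prod by simp
    qed (rule lev_exch_pos)
    then show ?thesis unfolding f_def .
  qed
qed

section \<open>Tropicalization\<close>

definition amut :: "('m::finite \<Rightarrow> 'm \<Rightarrow> int) \<Rightarrow> 'm \<Rightarrow> ('m \<Rightarrow> real) \<Rightarrow> 'm \<Rightarrow> real" where
  "amut B k x = x(k := - x k + max (ldot (\<lambda>i. posp (B i k)) x) (ldot (\<lambda>i. posp (- B i k)) x))"

primrec amuts :: "('m::finite \<Rightarrow> 'm \<Rightarrow> int) \<Rightarrow> 'm list \<Rightarrow> ('m \<Rightarrow> real) \<Rightarrow> 'm \<Rightarrow> real" where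
  "amuts B [] x = x"
| "amuts B (k # ks) x = amuts (mmut k B) ks (amut B k x)"

lemma ln_pw:
  assumes "\<And>i. z i > 0"
  shows "ln (pw z m) = ldot m (\<lambda>i. ln (z i))"
proof -
  have "pw (\<lambda>i. exp (1 * ln (z i))) m = exp (1 * ldot m (\<lambda>i. ln (z i)))" by (rule pw_exp)
  moreover have "(\<lambda>i. exp (1 * ln (z i))) = z" using assms by simp
  ultimately show ?thesis by simp
qed

lemma ldot_diff_bound:
  assumes "\<And>i. \<bar>x i - y i\<bar> \<le> c"
  shows "\<bar>ldot m x - ldot m y\<bar> \<le> (\<Sum>i\<in>UNIV. \<bar>of_int (m i)\<bar>) * c"
proof -
  have "ldot m x - ldot m y = (\<Sum>i\<in>UNIV. of_int (m i) * (x i - y i))"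
    by (simp add: ldot_def sum_subtractf right_diff_distrib)
  also have "\<bar>\<dots>\<bar> \<le> (\<Sum>i\<in>UNIV. \<bar>of_int (m i) * (x i - y i)\<bar>)" by (rule sum_abs)
  also have "\<dots> \<le> (\<Sum>i\<in>UNIV. \<bar>of_int (m i)\<bar> * c)"
    by (intro sum_mono) (auto simp: abs_mult intro!: mult_left_mono assms)
  finally show ?thesis by (simp add: sum_distrib_right)
qed

lemma ln_add_max:
  fixes a b :: real
  assumes "a > 0" "b > 0" "\<bar>ln a - \<alpha>\<bar> \<le> K" "\<bar>ln b - \<beta>\<bar> \<le> K"
  shows "\<bar>ln (a + b) - max \<alpha> \<beta>\<bar> \<le> K + ln 2"
proof -
  have "ln (a + b) \<le> ln (2 * max a b)" using assms by (subst ln_le_cancel_iff) auto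
  also have "\<dots> = ln 2 + max (ln a) (ln b)" using assms by (auto simp: ln_mult max_def)
  finally have 1: "ln (a + b) \<le> ln 2 + max (ln a) (ln b)" .
  have 2: "max (ln a) (ln b) \<le> ln (a + b)" using assms by auto
  have "\<bar>max (ln a) (ln b) - max \<alpha> \<beta>\<bar> \<le> K" using assms(3,4) by (auto simp: max_def)
  moreover have "ln 2 \<ge> (0::real)" by simp
  ultimately show ?thesis using 1 2 by linarith
qed

lemma pmut_amut_bound:
  obtains C where "\<And>z x i. (\<And>i. z i > 0) \<Longrightarrow> (\<And>i. \<bar>ln (z i) - x i\<bar> \<le> c) \<Longrightarrow> \<bar>ln (pmut B k z i) - amut B k x i\<bar> \<le> C"
proof -
  define K where "K = ((\<Sum>i\<in>UNIV. \<bar>of_int (posp (B i k))\<bar>) + (\<Sum>i\<in>UNIV. \<bar>of_int (posp (- B i k))\<bar>)) * c"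
  have "\<bar>ln (pmut B k z i) - amut B k x i\<bar> \<le> c + K + ln 2"
    if z: "\<And>i. z i > 0" and x: "\<And>i. \<bar>ln (z i) - x i\<bar> \<le> c" for z x i
  proof -
    have c0: "c \<ge> 0" using x[of i] by simp
    then have K0: "K \<ge> 0" unfolding K_def by (simp add: sum_nonneg)
    show ?thesis
    proof (cases "i = k")
      case False
      then have "ln (pmut B k z i) - amut B k x i = ln (z i) - x i" by (simp add: pmut_def amut_def)
      moreover have "ln 2 \<ge> (0::real)" by simp
      ultimately show ?thesis using x[of i] K0 by linarith
    next
      case True
      have p: "(\<Sum>i\<in>UNIV. \<bar>of_int (posp (B i k))\<bar>) * c \<le> K" "(\<Sum>i\<in>UNIV. \<bar>of_int (posp (- B i k))\<bar>) * c \<le> K"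
        unfolding K_def distrib_right using c0 by (simp_all add: sum_nonneg)
      have "\<bar>ln (pw z (\<lambda>i. posp (B i k)) + pw z (\<lambda>i. posp (- B i k)))
          - max (ldot (\<lambda>i. posp (B i k)) x) (ldot (\<lambda>i. posp (- B i k)) x)\<bar> \<le> K + ln 2"
      proof (rule ln_add_max)
        show "\<bar>ln (pw z (\<lambda>i. posp (B i k))) - ldot (\<lambda>i. posp (B i k)) x\<bar> \<le> K"
          using ldot_diff_bound[of "\<lambda>i. ln (z i)" x c "\<lambda>i. posp (B i k)"] x p by (simp add: ln_pw z)
        show "\<bar>ln (pw z (\<lambda>i. posp (- B i k))) - ldot (\<lambda>i. posp (- B i k)) x\<bar> \<le> K"
          using ldot_diff_bound[of "\<lambda>i. ln (z i)" x c "\<lambda>i. posp (- B i k)"] x p by (simp add: ln_pw z)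
      qed (simp_all add: pw_pos z)
      moreover have "ln (pmut B k z k) = ln (pw z (\<lambda>i. posp (B i k)) + pw z (\<lambda>i. posp (- B i k))) - ln (z k)"
      proof -
        have "pw z (\<lambda>i. posp (B i k)) + pw z (\<lambda>i. posp (- B i k)) > 0" by (intro add_pos_pos pw_pos z)
        then show ?thesis unfolding pmut_def using z[of k] by (simp add: ln_divide_pos)
      qed
      ultimately show ?thesis
        using x[of k] True by (simp add: amut_def)
    qed
  qed
  then show ?thesis using that by blast
qed

text \<open>The bound does not depend on the point. When the logarithms are scaled by a large
  \<open>s\<close>, the error becomes negligible and only the max-plus map remains.\<close>

lemma pmuts_amuts_bound:
  "\<exists>C. \<forall>z x. (\<forall>i. z i > 0) \<longrightarrow> (\<forall>i. \<bar>ln (z i) - x i\<bar> \<le> c) \<longrightarrow> (\<forall>i. \<bar>ln (pmuts B ks z i) - amuts B ks x i\<bar> \<le> C)"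
proof (induction ks arbitrary: B c)
  case (Cons k ks)
  obtain C where C: "\<And>z x i. (\<And>i. z i > 0) \<Longrightarrow> (\<And>i. \<bar>ln (z i) - x i\<bar> \<le> c) \<Longrightarrow> \<bar>ln (pmut B k z i) - amut B k x i\<bar> \<le> C"
    using pmut_amut_bound by blast
  obtain C' where C': "\<forall>z x. (\<forall>i. z i > 0) \<longrightarrow> (\<forall>i. \<bar>ln (z i) - x i\<bar> \<le> C) \<longrightarrow>
      (\<forall>i. \<bar>ln (pmuts (mmut k B) ks z i) - amuts (mmut k B) ks x i\<bar> \<le> C')"
    using Cons by blast
  show ?case
  proof (intro exI[of _ C'] allI impI)
    fix z x :: "'a \<Rightarrow> real" and i assume "\<forall>i. 0 < z i" "\<forall>i. \<bar>ln (z i) - x i\<bar> \<le> c"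
    then show "\<bar>ln (pmuts B (k # ks) z i) - amuts B (k # ks) x i\<bar> \<le> C'"
      using C'[rule_format, of "pmut B k z" "amut B k x" i] C[of z x] by (simp add: pmut_pos)
  qed
qed auto

lemma ldot_scale: "ldot m (\<lambda>i. s * x i) = s * ldot m x"
  by (simp add: ldot_def sum_distrib_left ac_simps)

lemma amuts_scale: "s \<ge> 0 \<Longrightarrow> amuts B ks (\<lambda>i. s * x i) = (\<lambda>i. s * amuts B ks x i)"
proof (induction ks arbitrary: B x)
  case (Cons k ks)
  have "amut B k (\<lambda>i. s * x i) = (\<lambda>i. s * amut B k x i)"
    using Cons.prems by (auto simp: amut_def ldot_scale max_mult_distrib_left algebra_simps)
  with Cons show ?case by simp
qed simp

lemma continuous_amut:
  assumes "\<And>i. continuous_on UNIV (\<lambda>t::real. f t i)"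
  shows "continuous_on UNIV (\<lambda>t. amut B k (f t) i)"
  unfolding amut_def ldot_def
  by (cases "i = k") (auto intro!: continuous_intros assms)

lemma continuous_amuts:
  assumes "\<And>i. continuous_on UNIV (\<lambda>t::real. f t i)"
  shows "continuous_on UNIV (\<lambda>t. amuts B ks (f t) i)"
  using assms
proof (induction ks arbitrary: B f)
  case (Cons k ks)
  show ?case unfolding amuts.simps by (rule Cons.IH) (rule continuous_amut[OF Cons.prems])
qed simp

lemma le_of_linear_bound:
  fixes a b c :: real
  assumes "\<And>s. s \<ge> s0 \<Longrightarrow> s * a \<le> c + s * b"
  shows "a \<le> b"
proof (rule ccontr)
  assume "\<not> a \<le> b"
  then have "a - b > 0" by simp
  define s where "s = max s0 ((c + 1) / (a - b))"
  have "(c + 1) / (a - b) \<le> s" by (simp add: s_def)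
  then have "c + 1 \<le> s * (a - b)" using \<open>a - b > 0\<close> by (simp add: pos_divide_le_eq)
  with assms[of s] show False by (simp add: s_def algebra_simps)
qed

section \<open>Max-plus mutation as support function of a Newton polytope\<close>

context
  fixes B :: "'m::finite \<Rightarrow> 'm \<Rightarrow> int" and ks i p
  assumes lev_p: "\<And>z. (\<And>i. z i > 0) \<Longrightarrow> pmuts B ks z i = lev z p"
begin

lemma amuts_growth: "\<exists>C. \<forall>s\<ge>0. \<forall>x. \<bar>ln (lev (\<lambda>i. exp (s * x i)) p) - s * amuts B ks x i\<bar> \<le> C"
proof -
  obtain C where C: "\<forall>z x. (\<forall>i. z i > 0) \<longrightarrow> (\<forall>i. \<bar>ln (z i) - x i\<bar> \<le> 0) \<longrightarrow>
      (\<forall>i. \<bar>ln (pmuts B ks z i) - amuts B ks x i\<bar> \<le> C)"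
    using pmuts_amuts_bound by blast
  have "\<bar>ln (lev (\<lambda>i. exp (s * x i)) p) - s * amuts B ks x i\<bar> \<le> C" if "s \<ge> 0" for s x
    using C[rule_format, of "\<lambda>i. exp (s * x i)" "\<lambda>i. s * x i" i] lev_p[of "\<lambda>i. exp (s * x i)"]
    by (simp add: amuts_scale[OF that])
  then show ?thesis by blast
qed

lemma lev_p_pos: "(\<And>i. z i > 0) \<Longrightarrow> lev z p > 0"
  using lev_p[of z] pmuts_pos[of z B ks i] by simp

lemma laurent_nonzero: "p \<noteq> 0"
  using lev_p_pos[of "\<lambda>_. 1"] by auto

text \<open>A sum of exponentials grows no faster than a constant times the largest of them.
  Together with \<open>key_le_amuts\<close> this identifies \<open>amuts\<close> with the support
  function of the Newton polytope of \<open>p\<close>.\<close>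

lemma amuts_le_key: "\<exists>m\<in>Poly_Mapping.keys p. amuts B ks x i \<le> ldot m x"
proof -
  let ?K = "Poly_Mapping.keys p"
  define M where "M = Max ((\<lambda>m. ldot m x) ` ?K)"
  have ne: "?K \<noteq> {}" using laurent_nonzero by simp
  then have "M \<in> (\<lambda>m. ldot m x) ` ?K" unfolding M_def by (intro Max_in) auto
  then obtain m where m: "m \<in> ?K" "M = ldot m x" by auto
  have le: "ldot m' x \<le> M" if "m' \<in> ?K" for m' using that by (simp add: M_def)
  define A :: real where "A = (\<Sum>m\<in>?K. \<bar>of_rat (Poly_Mapping.lookup p m)\<bar>)"
  have ub: "lev (\<lambda>i. exp (s * x i)) p \<le> A * exp (s * M)" if "s \<ge> 0" for s
  proof -
    have "lev (\<lambda>i. exp (s * x i)) p \<le> (\<Sum>m\<in>?K. \<bar>of_rat (Poly_Mapping.lookup p m)\<bar> * exp (s * M))"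
      unfolding lev_def pw_exp
    proof (intro sum_mono)
      fix m' assume "m' \<in> ?K"
      then have "exp (s * ldot m' x) \<le> exp (s * M)" using le that by (simp add: mult_left_mono)
      then show "of_rat (Poly_Mapping.lookup p m') * exp (s * ldot m' x) \<le> \<bar>of_rat (Poly_Mapping.lookup p m')\<bar> * exp (s * M)"
        by (intro mult_mono abs_ge_self) auto
    qed
    then show ?thesis by (simp add: A_def sum_distrib_right)
  qed
  have Apos: "A > 0"
    using ub[of 0] lev_p_pos[of "\<lambda>i. exp (0 * x i)"] by simp
  obtain C where C: "\<forall>s\<ge>0. \<forall>x. \<bar>ln (lev (\<lambda>i. exp (s * x i)) p) - s * amuts B ks x i\<bar> \<le> C"
    using amuts_growth by blast
  have "s * amuts B ks x i \<le> (C + ln A) + s * M" if "s \<ge> 0" for s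
  proof -
    have "ln (lev (\<lambda>i. exp (s * x i)) p) \<le> ln (A * exp (s * M))"
      using ub[OF that] by (intro ln_mono) (auto intro: lev_p_pos)
    also have "\<dots> = ln A + s * M" using Apos by (simp add: ln_mult)
    finally have "ln (lev (\<lambda>i. exp (s * x i)) p) \<le> ln A + s * M" .
    moreover have "\<bar>ln (lev (\<lambda>i. exp (s * x i)) p) - s * amuts B ks x i\<bar> \<le> C"
      using C that by blast
    ultimately show ?thesis by linarith
  qed
  then have "amuts B ks x i \<le> M" by (rule le_of_linear_bound)
  with m show ?thesis by auto
qed

lemma key_le_amuts_generic:
  assumes "inj_on (\<lambda>m. ldot m x) (Poly_Mapping.keys p)" "m \<in> Poly_Mapping.keys p"
  shows "ldot m x \<le> amuts B ks x i"
proof -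
  obtain m' c where m': "\<And>m'' . m'' \<in> Poly_Mapping.keys p \<Longrightarrow> ldot m'' x \<le> ldot m' x" "c > 0"
    "\<forall>\<^sub>F s in at_top. c * exp (s * ldot m' x) \<le> \<bar>lev (\<lambda>i. exp (s * x i)) p\<bar>"
    using lev_dominant[OF laurent_nonzero assms(1)] by blast
  then obtain s0 where s0: "\<And>s. s \<ge> s0 \<Longrightarrow> c * exp (s * ldot m' x) \<le> \<bar>lev (\<lambda>i. exp (s * x i)) p\<bar>"
    unfolding eventually_at_top_linorder by blast
  obtain C where C: "\<forall>s\<ge>0. \<forall>x. \<bar>ln (lev (\<lambda>i. exp (s * x i)) p) - s * amuts B ks x i\<bar> \<le> C"
    using amuts_growth by blast
  have "s * ldot m' x \<le> (C - ln c) + s * amuts B ks x i" if "s \<ge> max 0 s0" for s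
  proof -
    have "lev (\<lambda>i. exp (s * x i)) p > 0" by (rule lev_p_pos) simp
    then have "c * exp (s * ldot m' x) \<le> lev (\<lambda>i. exp (s * x i)) p" using s0[of s] that by simp
    then have "ln (c * exp (s * ldot m' x)) \<le> ln (lev (\<lambda>i. exp (s * x i)) p)"
      using m'(2) by (intro ln_mono) auto
    moreover have "ln (c * exp (s * ldot m' x)) = ln c + s * ldot m' x"
      using m'(2) by (simp add: ln_mult)
    moreover have "\<bar>ln (lev (\<lambda>i. exp (s * x i)) p) - s * amuts B ks x i\<bar> \<le> C"
      using C that by simp
    ultimately show ?thesis by linarith
  qed
  then have "ldot m' x \<le> amuts B ks x i" by (rule le_of_linear_bound)
  with m'(1)[OF assms(2)] show ?thesis by linarith
qed

lemma ldot_line: "ldot m (\<lambda>i. x i + t * y i) = ldot m x + t * ldot m y"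
  by (simp add: ldot_def sum.distrib sum_distrib_left algebra_simps)

text \<open>At an arbitrary \<open>x\<close> leading terms might cancel. The point is moved by a
  small \<open>t\<close> in a generic direction \<open>\<zeta>\<close>, which separates the
  exponents, and the inequality survives in the limit by continuity of \<open>amuts\<close>.\<close>

lemma key_le_amuts:
  assumes m: "m \<in> Poly_Mapping.keys p"
  shows "ldot m x \<le> amuts B ks x i"
proof -
  let ?K = "Poly_Mapping.keys p"
  obtain \<zeta> where inj: "inj_on (\<lambda>m. ldot m \<zeta>) ?K"
    using exists_ldot_inj_on[OF finite_keys] by blast
  have ne: "\<forall>\<^sub>F t in at_right 0. ldot m1 x + t * ldot m1 \<zeta> \<noteq> ldot m2 x + t * ldot m2 \<zeta>"
    if "m1 \<in> ?K" "m2 \<in> ?K" "m1 \<noteq> m2" for m1 m2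
  proof -
    \<comment> \<open>Two affine functions of \<open>t\<close> with different slopes meet only at
      \<open>r\<close>, which small positive \<open>t\<close> avoid.\<close>
    define r where "r = (ldot m2 x - ldot m1 x) / (ldot m1 \<zeta> - ldot m2 \<zeta>)"
    have dz: "ldot m1 \<zeta> - ldot m2 \<zeta> \<noteq> 0" using inj that by (auto simp: inj_on_def)
    have "\<forall>\<^sub>F t in at_right 0. t \<noteq> r"
    proof (cases "r > 0")
      case True
      then have "\<forall>\<^sub>F t in at_right 0. t \<in> {0<..<r}" by (rule eventually_at_right_real)
      then show ?thesis by eventually_elim auto
    next
      case False
      have "\<forall>\<^sub>F t in at_right 0. t \<in> {0<..<1::real}" by (rule eventually_at_right_real) simp
      then show ?thesis by eventually_elim (use False in auto)
    qed
    then show ?thesis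
    proof eventually_elim
      case (elim t)
      show ?case
      proof
        assume "ldot m1 x + t * ldot m1 \<zeta> = ldot m2 x + t * ldot m2 \<zeta>"
        then have "t * (ldot m1 \<zeta> - ldot m2 \<zeta>) = ldot m2 x - ldot m1 x"
          by (simp add: algebra_simps)
        with dz have "t = r" by (simp add: r_def eq_divide_eq)
        with elim show False by simp
      qed
    qed
  qed
  have "\<forall>\<^sub>F t in at_right 0. \<forall>m1\<in>?K. \<forall>m2\<in>?K. m1 \<noteq> m2 \<longrightarrow> ldot m1 x + t * ldot m1 \<zeta> \<noteq> ldot m2 x + t * ldot m2 \<zeta>"
  proof (intro eventually_ball_finite finite_keys ballI)
    fix m1 m2 assume "m1 \<in> ?K" "m2 \<in> ?K"
    then show "\<forall>\<^sub>F t in at_right 0. m1 \<noteq> m2 \<longrightarrow> ldot m1 x + t * ldot m1 \<zeta> \<noteq> ldot m2 x + t * ldot m2 \<zeta>"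
      using ne[of m1 m2] by (cases "m1 = m2") auto
  qed
  then have ev: "\<forall>\<^sub>F t in at_right 0. ldot m x + t * ldot m \<zeta> \<le> amuts B ks (\<lambda>i. x i + t * \<zeta> i) i"
  proof eventually_elim
    case (elim t)
    then have "inj_on (\<lambda>m. ldot m (\<lambda>i. x i + t * \<zeta> i)) ?K"
      unfolding ldot_line inj_on_def by blast
    from key_le_amuts_generic[OF this m] show ?case by (simp add: ldot_line)
  qed
  have c1: "((\<lambda>t. amuts B ks (\<lambda>i. x i + t * \<zeta> i) i) \<longlongrightarrow> amuts B ks (\<lambda>i. x i + 0 * \<zeta> i) i) (at_right 0)"
  proof -
    have "continuous_on UNIV (\<lambda>t. amuts B ks (\<lambda>i. x i + t * \<zeta> i) i)"
      by (intro continuous_amuts continuous_intros)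
    then have "isCont (\<lambda>t. amuts B ks (\<lambda>i. x i + t * \<zeta> i) i) 0"
      by (simp add: continuous_on_eq_continuous_at)
    then show ?thesis unfolding isCont_def by (rule tendsto_within_subset) auto
  qed
  have c2: "((\<lambda>t. ldot m x + t * ldot m \<zeta>) \<longlongrightarrow> ldot m x + 0 * ldot m \<zeta>) (at_right 0)"
    by (intro tendsto_intros)
  from tendsto_le[OF trivial_limit_at_right_real c1 c2 ev] show ?thesis by simp
qed

end

definition convex_fun :: "(('m \<Rightarrow> real) \<Rightarrow> real) \<Rightarrow> bool" where
  "convex_fun f \<longleftrightarrow> (\<forall>x y t. 0 \<le> t \<longrightarrow> t \<le> 1 \<longrightarrow> f (\<lambda>i. x i + t * (y i - x i)) \<le> (1 - t) * f x + t * f y)"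

text \<open>\<open>amuts\<close> is a maximum of the linear forms \<open>ldot m\<close> over the
  exponents of the Laurent expansion. Its recursion, which mixes maxima and differences, does not
  show convexity.\<close>

lemma amuts_convex:
  assumes "skew_by d B" "cols_indep K B" "set ks \<subseteq> K"
  shows "convex_fun (\<lambda>x. amuts B ks x i)"
  unfolding convex_fun_def
proof (intro allI impI)
  fix x y and t :: real assume t: "0 \<le> t" "t \<le> 1"
  obtain p where p: "\<And>z. (\<And>i. z i > 0) \<Longrightarrow> pmuts B ks z i = lev z p"
    using laurent_phenomenon[OF assms, of i] unfolding laurent_fun_def by blast
  obtain m where m: "m \<in> Poly_Mapping.keys p" "amuts B ks (\<lambda>i. x i + t * (y i - x i)) i \<le> ldot m (\<lambda>i. x i + t * (y i - x i))"
    using amuts_le_key[of B ks i p, OF p] by blast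
  note m(2)
  also have "ldot m (\<lambda>i. x i + t * (y i - x i)) = (1 - t) * ldot m x + t * ldot m y"
    by (simp add: ldot_def sum.distrib sum_distrib_left algebra_simps sum_subtractf)
  also have "\<dots> \<le> (1 - t) * amuts B ks x i + t * amuts B ks y i"
    using t key_le_amuts[of B ks i p, OF p m(1)] by (intro add_mono mult_left_mono) auto
  finally show "amuts B ks (\<lambda>i. x i + t * (y i - x i)) i \<le> (1 - t) * amuts B ks x i + t * amuts B ks y i" .
qed

section \<open>Piecewise linear mutation of g-vectors\<close>

text \<open>The change of a g-vector when the initial seed is mutated at \<open>k\<close>,
  customarily written \<open>g_i + [b_ik]_+ g_k - b_ik min(g_k, 0)\<close>.\<close>

definition gmut :: "('m \<Rightarrow> 'm \<Rightarrow> int) \<Rightarrow> 'm \<Rightarrow> ('m \<Rightarrow> real) \<Rightarrow> 'm \<Rightarrow> real" where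
  "gmut B k v = (\<lambda>i. if i = k then - v k
      else v i + of_int (posp (B i k)) * max (v k) 0 - of_int (posp (- B i k)) * max (- v k) 0)"

primrec gmuts :: "('m \<Rightarrow> 'm \<Rightarrow> int) \<Rightarrow> 'm list \<Rightarrow> ('m \<Rightarrow> real) \<Rightarrow> 'm \<Rightarrow> real" where
  "gmuts B [] v = v"
| "gmuts B (k # ks) v = gmuts (mmut k B) ks (gmut B k v)"

primrec mmuts :: "('m \<Rightarrow> 'm \<Rightarrow> int) \<Rightarrow> 'm list \<Rightarrow> 'm \<Rightarrow> 'm \<Rightarrow> int" where
  "mmuts B [] = B"
| "mmuts B (k # ks) = mmuts (mmut k B) ks"

lemma mmuts_append: "mmuts B (ks @ ls) = mmuts (mmuts B ks) ls"
  by (induction ks arbitrary: B) auto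

lemma gmuts_append: "gmuts B (ks @ ls) v = gmuts (mmuts B ks) ls (gmuts B ks v)"
  by (induction ks arbitrary: B v) auto

lemma amuts_append: "amuts B (ks @ ls) v = amuts (mmuts B ks) ls (amuts B ks v)"
  by (induction ks arbitrary: B v) auto

lemma skew_by_mmuts: "skew_by d B \<Longrightarrow> skew_by d (mmuts B ks)"
  by (induction ks arbitrary: B) (auto intro: skew_by_mmut)

lemma gmut_gmut: "gmut (mmut k B) k (gmut B k v) = v"
  by (rule ext) (auto simp: gmut_def mmut_apply)

lemma mmuts_rev: "skew_by d B \<Longrightarrow> mmuts (mmuts B ks) (rev ks) = B"
  by (induction ks arbitrary: B) (auto simp: mmuts_append skew_by_mmut mmut_mmut)

lemma gmuts_rev: "skew_by d B \<Longrightarrow> gmuts (mmuts B ks) (rev ks) (gmuts B ks v) = v"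
proof (induction ks arbitrary: B v)
  case (Cons k ks)
  have s: "skew_by d (mmut k B)" using Cons.prems by (rule skew_by_mmut)
  show ?case
    using Cons.IH[OF s] by (simp add: gmuts_append mmuts_rev[OF s] gmut_gmut)
qed simp

abbreviation dotp :: "('m::finite \<Rightarrow> real) \<Rightarrow> ('m \<Rightarrow> real) \<Rightarrow> real" where
  "dotp x y \<equiv> (\<Sum>i\<in>UNIV. x i * y i)"

definition yhat :: "('m::finite \<Rightarrow> 'm \<Rightarrow> int) \<Rightarrow> ('m \<Rightarrow> real) \<Rightarrow> 'm \<Rightarrow> real" where
  "yhat B x k = ldot (\<lambda>i. B i k) x"

lemma yhat_posp: "yhat B x k = ldot (\<lambda>i. posp (B i k)) x - ldot (\<lambda>i. posp (- B i k)) x"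
proof -
  have "of_int (B i k) = of_int (posp (B i k)) - (of_int (posp (- B i k)) :: real)" for i
    by (metis posp_diff of_int_diff)
  then show ?thesis
    by (simp add: yhat_def ldot_def left_diff_distrib sum_subtractf)
qed

lemma sum_split_at: "(\<Sum>i\<in>UNIV. f i) = f k + (\<Sum>i\<in>UNIV - {k}. f (i :: 'm::finite) :: real)"
  by (simp add: sum.remove[of UNIV k])

text \<open>The pairing is preserved unless \<open>p k\<close> and \<open>yhat B x k\<close> have
  opposite signs; in that case the defect has the sign of \<open>- p k\<close>.\<close>

lemma dotp_gmut_amut:
  assumes "B k k = 0"
  shows "dotp (gmut B k p) (amut B k x) = dotp p x
    + (if p k \<ge> 0 then - p k * max (- yhat B x k) 0 else - p k * max (yhat B x k) 0)"
proof -
  define Ap where "Ap = ldot (\<lambda>i. posp (B i k)) x"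
  define Am where "Am = ldot (\<lambda>i. posp (- B i k)) x"
  have Ap': "Ap = (\<Sum>i\<in>UNIV - {k}. of_int (posp (B i k)) * x i)"
    and Am': "Am = (\<Sum>i\<in>UNIV - {k}. of_int (posp (- B i k)) * x i)"
    unfolding Ap_def Am_def ldot_def by (subst sum_split_at[of _ k], simp add: assms)+
  have y: "yhat B x k = Ap - Am" by (simp add: yhat_posp Ap_def Am_def)
  have "dotp (gmut B k p) (amut B k x) = - p k * (- x k + max Ap Am)
      + (\<Sum>i\<in>UNIV - {k}. (p i + of_int (posp (B i k)) * max (p k) 0 - of_int (posp (- B i k)) * max (- p k) 0) * x i)"
    by (subst sum_split_at[of _ k]) (simp add: gmut_def amut_def Ap_def Am_def)
  also have "(\<Sum>i\<in>UNIV - {k}. (p i + of_int (posp (B i k)) * max (p k) 0 - of_int (posp (- B i k)) * max (- p k) 0) * x i)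
      = (\<Sum>i\<in>UNIV - {k}. p i * x i) + max (p k) 0 * Ap - max (- p k) 0 * Am"
    unfolding Ap' Am' by (simp add: sum_distrib_left sum.distrib sum_subtractf algebra_simps)
  also have "- p k * (- x k + max Ap Am) + ((\<Sum>i\<in>UNIV - {k}. p i * x i) + max (p k) 0 * Ap - max (- p k) 0 * Am)
      = dotp p x + (if p k \<ge> 0 then - p k * max (- yhat B x k) 0 else - p k * max (yhat B x k) 0)"
    unfolding y sum_split_at[of "\<lambda>i. p i * x i" k] by (auto simp: max_def algebra_simps)
  finally show ?thesis .
qed

text \<open>The coordinates \<open>yhat\<close> follow a map of the same shape as
  \<open>gmut\<close>, with row \<open>k\<close> in place of column \<open>k\<close>. The
  symmetrizer exchanges the two, hence the factor \<open>d j\<close> in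
  \<open>aligned\<close>.\<close>

lemma yhat_mmut:
  assumes "B k k = 0"
  shows "yhat (mmut k B) (amut B k x) j = (if j = k then - yhat B x k
      else yhat B x j + of_int (posp (- B k j)) * max (yhat B x k) 0 - of_int (posp (B k j)) * max (- yhat B x k) 0)"
proof -
  define Ap where "Ap = ldot (\<lambda>i. posp (B i k)) x"
  define Am where "Am = ldot (\<lambda>i. posp (- B i k)) x"
  have Ap': "Ap = (\<Sum>i\<in>UNIV - {k}. of_int (posp (B i k)) * x i)"
    and Am': "Am = (\<Sum>i\<in>UNIV - {k}. of_int (posp (- B i k)) * x i)"
    unfolding Ap_def Am_def ldot_def by (subst sum_split_at[of _ k], simp add: assms)+
  have y: "yhat B x k = Ap - Am" by (simp add: yhat_posp Ap_def Am_def)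
  show ?thesis
  proof (cases "j = k")
    case True
    have "(\<Sum>i\<in>UNIV - {k}. of_int (mmut k B i k) * amut B k x i) = (\<Sum>i\<in>UNIV - {k}. - (of_int (B i k) * x i))"
      by (intro sum.cong) (auto simp: mmut_apply amut_def)
    then show ?thesis
      using True assms unfolding yhat_def ldot_def sum_split_at[of _ k] by (simp add: mmut_apply sum_negf)
  next
    case False
    have b: "of_int (B k j) = of_int (posp (B k j)) - (of_int (posp (- B k j)) :: real)"
      by (metis posp_diff of_int_diff)
    have "yhat (mmut k B) (amut B k x) j = - of_int (B k j) * (- x k + max Ap Am)
      + (\<Sum>i\<in>UNIV - {k}. of_int (B i j + posp (B i k) * posp (B k j) - posp (- B i k) * posp (- B k j)) * x i)"
      unfolding yhat_def ldot_def sum_split_at[of _ k] using False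
      by (simp add: mmut_apply amut_def Ap_def Am_def ldot_def[symmetric])
    also have "(\<Sum>i\<in>UNIV - {k}. of_int (B i j + posp (B i k) * posp (B k j) - posp (- B i k) * posp (- B k j)) * x i)
      = (\<Sum>i\<in>UNIV - {k}. of_int (B i j) * x i) + of_int (posp (B k j)) * Ap - of_int (posp (- B k j)) * Am"
      unfolding Ap' Am' by (simp add: sum_distrib_left sum.distrib sum_subtractf algebra_simps)
    also have "- of_int (B k j) * (- x k + max Ap Am) + ((\<Sum>i\<in>UNIV - {k}. of_int (B i j) * x i)
        + of_int (posp (B k j)) * Ap - of_int (posp (- B k j)) * Am)
      = yhat B x j - of_int (B k j) * max Ap Am + of_int (posp (B k j)) * Ap - of_int (posp (- B k j)) * Am"
      unfolding yhat_def[of B x j] ldot_def sum_split_at[of _ k] by (simp add: algebra_simps)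
    finally have "yhat (mmut k B) (amut B k x) j = yhat B x j - of_int (B k j) * max Ap Am
        + of_int (posp (B k j)) * Ap - of_int (posp (- B k j)) * Am" .
    then show ?thesis
      using False unfolding y b by (auto simp: max_def algebra_simps)
  qed
qed

section \<open>Aligned points and coherent signs\<close>

definition aligned :: "'m set \<Rightarrow> ('m \<Rightarrow> int) \<Rightarrow> ('m::finite \<Rightarrow> 'm \<Rightarrow> int) \<Rightarrow> ('m \<Rightarrow> real) \<Rightarrow> ('m \<Rightarrow> real) \<Rightarrow> bool" where
  "aligned K d B p x \<longleftrightarrow> (\<forall>j\<in>K. yhat B x j = of_int (d j) * p j)"

lemma max_scale: "(c::real) \<ge> 0 \<Longrightarrow> max (c * x) 0 = c * max x 0" and max_scale_neg: "c \<ge> 0 \<Longrightarrow> max (- (c * x)) 0 = c * max (- x) 0"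
  by (auto simp: max_def mult_le_0_iff zero_le_mult_iff)

lemma aligned_mmut:
  assumes "skew_by d B" "aligned K d B p x" "k \<in> K"
  shows "aligned K d (mmut k B) (gmut B k p) (amut B k x)"
  unfolding aligned_def
proof
  fix j assume j: "j \<in> K"
  have d: "of_int (d i) \<ge> (0::real)" for i using skew_by_pos[OF assms(1), of i] by simp
  have y: "yhat B x k = of_int (d k) * p k" "yhat B x j = of_int (d j) * p j"
    using assms j by (auto simp: aligned_def)
  have e: "of_int (posp (- B k j)) * of_int (d k) = (of_int (d j) * of_int (posp (B j k)) :: real)"
    "of_int (posp (B k j)) * of_int (d k) = (of_int (d j) * of_int (posp (- B j k)) :: real)"
    using skew_by_posp[OF assms(1), of j k] skew_by_posp'[OF assms(1), of j k]
    by (simp_all only: of_int_mult[symmetric] mult.commute)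
  have e': "of_int (posp (- B k j)) * (of_int (d k) * z) = of_int (d j) * (of_int (posp (B j k)) * z)"
    "of_int (posp (B k j)) * (of_int (d k) * z) = of_int (d j) * (of_int (posp (- B j k)) * z)" for z :: real
    using e by (simp_all add: mult.assoc[symmetric])
  show "yhat (mmut k B) (amut B k x) j = of_int (d j) * gmut B k p j"
    unfolding yhat_mmut[of B k, OF skew_by_diag[OF assms(1)]] y max_scale[OF d] max_scale_neg[OF d] e'
    by (auto simp: gmut_def algebra_simps)
qed

primrec agree :: "('m::finite \<Rightarrow> 'm \<Rightarrow> int) \<Rightarrow> 'm list \<Rightarrow> ('m \<Rightarrow> real) \<Rightarrow> ('m \<Rightarrow> real) \<Rightarrow> bool" where
  "agree B [] p x \<longleftrightarrow> True"
| "agree B (k # ks) p x \<longleftrightarrow> p k * yhat B x k \<ge> 0 \<and> agree (mmut k B) ks (gmut B k p) (amut B k x)"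

lemma dotp_gmuts_amuts:
  "skew_by d B \<Longrightarrow> agree B ks p x \<Longrightarrow> dotp (gmuts B ks p) (amuts B ks x) = dotp p x"
proof (induction ks arbitrary: B p x)
  case (Cons k ks)
  have "p k * yhat B x k \<ge> 0" using Cons.prems by simp
  then have "(if p k \<ge> 0 then - p k * max (- yhat B x k) 0 else - p k * max (yhat B x k) 0) = 0"
    by (auto simp: max_def zero_le_mult_iff)
  then show ?case
    using Cons skew_by_mmut[OF Cons.prems(1)] dotp_gmut_amut[of B k p x, OF skew_by_diag[OF Cons.prems(1)]]
    by simp
qed simp

text \<open>At every mutated vertex \<open>p\<close> and \<open>q\<close> lie in a common closed
  half-space, so \<open>gmuts B ks\<close> is linear on the cone they span.\<close>

primrec coherent :: "('m \<Rightarrow> 'm \<Rightarrow> int) \<Rightarrow> 'm list \<Rightarrow> ('m \<Rightarrow> real) \<Rightarrow> ('m \<Rightarrow> real) \<Rightarrow> bool" where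
  "coherent B [] p q \<longleftrightarrow> True"
| "coherent B (k # ks) p q \<longleftrightarrow> p k * q k \<ge> 0 \<and> coherent (mmut k B) ks (gmut B k p) (gmut B k q)"

lemma coherent_refl: "coherent B ks p p"
  by (induction ks arbitrary: B p) auto

lemma coherent_sym: "coherent B ks p q \<Longrightarrow> coherent B ks q p"
  by (induction ks arbitrary: B p q) (auto simp: mult.commute)

lemma aligned_coherent_agree:
  assumes "skew_by d B" "aligned K d B p x" "set ks \<subseteq> K" "coherent B ks p q"
  shows "agree B ks q x"
  using assms
proof (induction ks arbitrary: B p q x)
  case (Cons k ks)
  have "yhat B x k = of_int (d k) * p k" using Cons.prems by (simp add: aligned_def)
  moreover have "d k > 0" by (rule skew_by_pos[OF Cons.prems(1)])
  ultimately have "q k * yhat B x k = of_int (d k) * (p k * q k)" by simp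
  also have "\<dots> \<ge> 0" using Cons.prems(4) \<open>d k > 0\<close> by (simp add: zero_le_mult_iff)
  finally show ?case
    using Cons.IH[OF skew_by_mmut[OF Cons.prems(1)] aligned_mmut[OF Cons.prems(1,2)]] Cons.prems by simp
qed simp

text \<open>Where \<open>p k\<close> is nonzero the sign condition is strict at the aligned point
  and persists nearby; where \<open>p k\<close> is zero it holds trivially.\<close>

lemma eventually_agree:
  assumes "skew_by d B" "\<And>i. continuous_on UNIV (\<lambda>t::real. f t i)" "aligned K d B p (f 0)" "set ks \<subseteq> K"
  shows "\<forall>\<^sub>F t in at_right 0. agree B ks p (f t)"
  using assms
proof (induction ks arbitrary: B p f)
  case (Cons k ks)
  have d: "of_int (d k) > (0::real)" using skew_by_pos[OF Cons.prems(1), of k] by simp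
  have "continuous_on UNIV (\<lambda>t. p k * yhat B (f t) k)"
    unfolding yhat_def ldot_def by (intro continuous_intros Cons.prems(2))
  then have "isCont (\<lambda>t. p k * yhat B (f t) k) 0"
    by (simp add: continuous_on_eq_continuous_at)
  then have lim: "((\<lambda>t. p k * yhat B (f t) k) \<longlongrightarrow> p k * yhat B (f 0) k) (at_right 0)"
    unfolding isCont_def by (rule tendsto_within_subset) auto
  have "\<forall>\<^sub>F t in at_right 0. p k * yhat B (f t) k \<ge> 0"
  proof (cases "p k = 0")
    case False
    have "p k * yhat B (f 0) k = of_int (d k) * (p k * p k)"
      using Cons.prems(3,4) by (simp add: aligned_def)
    also have "\<dots> > 0" using d False by (metis mult_pos_pos not_real_square_gt_zero)
    finally have "\<forall>\<^sub>F t in at_right 0. p k * yhat B (f t) k > 0" using lim by (rule order_tendstoD(1)[rotated])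
    then show ?thesis by eventually_elim simp
  qed simp
  moreover have "\<forall>\<^sub>F t in at_right 0. agree (mmut k B) ks (gmut B k p) (amut B k (f t))"
    using Cons.prems by (intro Cons.IH skew_by_mmut continuous_amut aligned_mmut) auto
  ultimately show ?case by eventually_elim simp
qed simp

definition solvable :: "'m set \<Rightarrow> ('m::finite \<Rightarrow> 'm \<Rightarrow> int) \<Rightarrow> bool" where
  "solvable K B \<longleftrightarrow> (\<forall>c. \<exists>x. \<forall>j\<in>K. yhat B x j = c j)"

lemma solvable_mmut:
  assumes "solvable K B" "k \<in> K" "B k k = 0"
  shows "solvable K (mmut k B)"
  unfolding solvable_def
proof
  fix c :: "'a \<Rightarrow> real"
  \<comment> \<open>The preimage of \<open>c\<close> under the transformation in
    \<open>yhat_mmut\<close>.\<close>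
  define c' where "c' = (\<lambda>j. if j = k then - c k else c j + of_int (posp (B k j)) * max (c k) 0 - of_int (posp (- B k j)) * max (- c k) 0)"
  obtain x where x: "\<forall>j\<in>K. yhat B x j = c' j" using assms(1) unfolding solvable_def by blast
  have "\<forall>j\<in>K. yhat (mmut k B) (amut B k x) j = c j"
    using x assms(2) by (auto simp: yhat_mmut[of B k, OF assms(3)] c'_def)
  then show "\<exists>x. \<forall>j\<in>K. yhat (mmut k B) x j = c j" by blast
qed

text \<open>The exchange pattern is rich enough for the tropical arguments if the columns in \<open>K\<close> are
  independent (Laurent phenomenon) and every tropical \<open>y\<close>-point on \<open>K\<close> is attained.\<close>

definition good :: "'m set \<Rightarrow> ('m \<Rightarrow> int) \<Rightarrow> ('m::finite \<Rightarrow> 'm \<Rightarrow> int) \<Rightarrow> bool" where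
  "good K d B \<longleftrightarrow> skew_by d B \<and> cols_indep K B \<and> solvable K B"

lemma good_skew: "good K d B \<Longrightarrow> skew_by d B"
  by (simp add: good_def)

lemma good_mmut: "good K d B \<Longrightarrow> k \<in> K \<Longrightarrow> good K d (mmut k B)"
  unfolding good_def by (auto intro: skew_by_mmut cols_indep_mmut solvable_mmut skew_by_diag)

lemma good_aligned:
  assumes "good K d B"
  obtains x where "aligned K d B p x"
proof -
  have "\<forall>c. \<exists>x. \<forall>j\<in>K. yhat B x j = c j"
    using assms unfolding good_def solvable_def by blast
  from this[rule_format, of "\<lambda>j. of_int (d j) * p j"] show ?thesis
    using that unfolding aligned_def by blast
qed

text \<open>A convex function that is linear near one point lies above that linear function.\<close>

lemma dotp_amuts_ge:
  assumes good: "good K d B" and ks: "set ks \<subseteq> K" and nn: "\<And>i. gmuts B ks p i \<ge> 0"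
  shows "dotp (gmuts B ks p) (amuts B ks x) \<ge> dotp p x"
proof -
  \<comment> \<open>Nonnegativity of \<open>gmuts B ks p\<close> makes \<open>X\<close> convex, as a
    nonnegative combination of the convex functions \<open>amuts\<close>.\<close>
  define X where "X = (\<lambda>x. dotp (gmuts B ks p) (amuts B ks x))"
  have skew: "skew_by d B" and ind: "cols_indep K B" using good by (auto simp: good_def)
  have X: "X (\<lambda>i. x i + t * (y i - x i)) \<le> (1 - t) * X x + t * X y" if "0 \<le> t" "t \<le> 1" for x y t
  proof -
    have "gmuts B ks p i * amuts B ks (\<lambda>i. x i + t * (y i - x i)) i
        \<le> gmuts B ks p i * ((1 - t) * amuts B ks x i + t * amuts B ks y i)" for i
      using amuts_convex[OF skew ind ks, of i] that nn[of i] unfolding convex_fun_def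
      by (intro mult_left_mono) auto
    then have "X (\<lambda>i. x i + t * (y i - x i)) \<le> (\<Sum>i\<in>UNIV. gmuts B ks p i * ((1 - t) * amuts B ks x i + t * amuts B ks y i))"
      unfolding X_def by (rule sum_mono)
    also have "\<dots> = (1 - t) * X x + t * X y"
      unfolding X_def by (simp add: sum_distrib_left sum.distrib algebra_simps sum_subtractf)
    finally show ?thesis .
  qed
  obtain x0 where x0: "aligned K d B p x0" using good_aligned[OF good] by blast
  define f where "f = (\<lambda>t i. x0 i + t * (x i - x0 i))"
  have "aligned K d B p (f 0)" using x0 by (simp add: f_def)
  then have "\<forall>\<^sub>F t in at_right 0. agree B ks p (f t)"
    using skew ks by (intro eventually_agree) (auto simp: f_def intro!: continuous_intros)
  moreover have "\<forall>\<^sub>F t in at_right 0. t \<in> {0<..<1::real}" by (rule eventually_at_right_real) simp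
  ultimately have "\<forall>\<^sub>F t in at_right 0. agree B ks p (f t) \<and> t \<in> {0<..<1::real}" by (rule eventually_conj)
  then obtain t where t: "agree B ks p (f t)" "0 < t" "t < 1"
    using eventually_happens'[OF trivial_limit_at_right_real] by (metis (no_types, lifting) greaterThanLessThan_iff)
  have X0: "X x0 = dotp p x0"
    unfolding X_def using x0 skew ks
    by (intro dotp_gmuts_amuts[of d] aligned_coherent_agree[of d B K p]) (auto intro: coherent_refl)
  have "X (f t) = dotp p (f t)"
    unfolding X_def using t(1) skew by (intro dotp_gmuts_amuts[of d])
  also have "\<dots> = (1 - t) * dotp p x0 + t * dotp p x"
    unfolding f_def by (simp add: sum_distrib_left sum.distrib algebra_simps sum_subtractf)
  finally have "(1 - t) * dotp p x0 + t * dotp p x \<le> (1 - t) * X x0 + t * X x"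
    using X[of t x0 x] t unfolding f_def by simp
  then show ?thesis using t X0 unfolding X_def by simp
qed

text \<open>Suppose \<open>p k < 0 < q k\<close> at the first step and take \<open>x\<close> aligned
  with \<open>p\<close>. Coherence of the remaining steps keeps the pairing with \<open>q\<close>
  constant after the first mutation, while the first mutation strictly lowers it; this contradicts
  \<open>dotp_amuts_ge\<close> for \<open>q\<close>.\<close>

theorem good_coherent:
  assumes "good K d B" "set ks \<subseteq> K" "\<And>i. gmuts B ks p i \<ge> 0" "\<And>i. gmuts B ks q i \<ge> 0"
  shows "coherent B ks p q"
  using assms
proof (induction ks arbitrary: B p q)
  case (Cons k ks)
  note skew = good_skew[OF Cons.prems(1)]
  have k: "k \<in> K" "set ks \<subseteq> K" using Cons.prems by auto
  have IH: "coherent (mmut k B) ks (gmut B k p) (gmut B k q)"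
    using Cons.prems k by (intro Cons.IH good_mmut) auto
  have False if neg: "p k < 0" "q k > 0" and coh: "coherent (mmut k B) ks (gmut B k p) (gmut B k q)"
    and nn: "\<And>i. gmuts B (k # ks) q i \<ge> 0" for p q
  proof -
    obtain x where x: "aligned K d B p x" using good_aligned[OF Cons.prems(1)] by blast
    have "yhat B x k = of_int (d k) * p k" using x k by (simp add: aligned_def)
    then have y: "yhat B x k < 0" using neg skew_by_pos[OF skew, of k] by (simp add: mult_less_0_iff)
    have "agree (mmut k B) ks (gmut B k q) (amut B k x)"
      by (rule aligned_coherent_agree[OF skew_by_mmut[OF skew] aligned_mmut[OF skew x k(1)] k(2) coh])
    then have "dotp (gmuts B (k # ks) q) (amuts B (k # ks) x) = dotp (gmut B k q) (amut B k x)"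
      using dotp_gmuts_amuts[OF skew_by_mmut[OF skew]] by simp
    also have "\<dots> = dotp q x - q k * (- yhat B x k)"
      using neg y by (simp add: dotp_gmut_amut[of B k, OF skew_by_diag[OF skew]] max_def)
    also have "\<dots> < dotp q x" using neg y by (simp add: mult_pos_neg)
    finally show False using dotp_amuts_ge[OF Cons.prems(1,2) nn, of x] by simp
  qed
  from this[of p q] this[of q p] IH coherent_sym[OF IH] Cons.prems(3,4)
  have "\<not> (p k < 0 \<and> q k > 0)" "\<not> (q k < 0 \<and> p k > 0)" by blast+
  then have "p k * q k \<ge> 0" by (auto simp: zero_le_mult_iff not_less) 
  with IH show ?case by simp
qed simp

subsection \<open>Principal extensions\<close>

definition pext :: "int \<Rightarrow> ('n \<Rightarrow> 'n \<Rightarrow> int) \<Rightarrow> 'n + 'n \<Rightarrow> 'n + 'n \<Rightarrow> int" where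
  "pext s B = (\<lambda>r c. case r of Inl i \<Rightarrow> (case c of Inl j \<Rightarrow> B i j | Inr j \<Rightarrow> if i = j then - s else 0)
      | Inr i \<Rightarrow> (case c of Inl j \<Rightarrow> if i = j then s else 0 | Inr j \<Rightarrow> 0))"

lemma pext_simps [simp]: "pext s B (Inl i) (Inl j) = B i j" "pext s B (Inl i) (Inr j) = (if i = j then - s else 0)"
  "pext s B (Inr i) (Inl j) = (if i = j then s else 0)" "pext s B (Inr i) (Inr j) = 0"
  by (simp_all add: pext_def)

lemma sum_sum_type: "(\<Sum>r\<in>(UNIV :: ('a::finite + 'b::finite) set). f r) = (\<Sum>i\<in>UNIV. f (Inl i)) + (\<Sum>i\<in>UNIV. f (Inr i))"
  for f :: "_ \<Rightarrow> 'c :: comm_monoid_add"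
  unfolding UNIV_Plus_UNIV[symmetric] by (subst sum.Plus) auto

lemma skew_by_pext:
  assumes "skew_by d B"
  shows "skew_by (case_sum d d) (pext s B)"
  unfolding skew_by_def
proof (intro conjI allI)
  fix r c :: "'a + 'a"
  show "case_sum d d r * pext s B r c = - (case_sum d d c * pext s B c r)"
    by (cases r; cases c) (auto intro: skew_by_eq[OF assms])
  show "case_sum d d r > 0" using skew_by_pos[OF assms] by (cases r) auto
qed

lemma good_pext:
  fixes B :: "'n::finite \<Rightarrow> 'n \<Rightarrow> int"
  assumes "skew_by d B" "s = 1 \<or> s = -1"
  shows "good (range Inl) (case_sum d d) (pext s B)"
  unfolding good_def
proof (intro conjI skew_by_pext assms(1))
  show "cols_indep (range Inl) (pext s B)"
    unfolding cols_indep_def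
  proof (intro allI impI)
    fix c :: "'n + 'n \<Rightarrow> int" and k
    assume c: "\<forall>k. k \<notin> range Inl \<longrightarrow> c k = 0" "\<forall>i. (\<Sum>k\<in>UNIV. c k * pext s B i k) = 0"
    have "c (Inl j) * s = (\<Sum>k\<in>UNIV. c k * pext s B (Inr j) k)" for j
      by (simp add: sum_sum_type if_distrib cong: if_cong)
    then have "c (Inl j) = 0" for j using c(2) assms(2) by auto
    moreover have "c (Inr j) = 0" for j using c(1) by auto
    ultimately show "c k = 0" by (cases k) auto
  qed
  show "solvable (range Inl) (pext s B)"
    unfolding solvable_def
  proof
    fix c :: "'n + 'n \<Rightarrow> real"
    define x where "x = (\<lambda>r :: 'n + 'n. case r of Inl i \<Rightarrow> 0 | Inr i \<Rightarrow> of_int s * c (Inl i))"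
    have "of_int s * (of_int s * c (Inl j)) = c (Inl j)" for j
      using assms(2) by auto
    then have "yhat (pext s B) x (Inl j) = c (Inl j)" for j
      by (simp add: yhat_def ldot_def sum_sum_type x_def if_distrib[of of_int] if_distribR cong: if_cong)
        (simp add: if_distrib[of "\<lambda>z. z * _"] cong: if_cong)
    then show "\<exists>x. \<forall>j\<in>range Inl. yhat (pext s B) x j = c j" by blast
  qed
qed

lemma mmut_Inl:
  assumes "\<And>i j. E (Inl i) (Inl j) = B i j"
  shows "mmut (Inl k) E (Inl i) (Inl j) = mmut k B i j"
  using assms by (simp add: mmut_apply)

lemma gmut_Inl:
  assumes "\<And>i j. E (Inl i) (Inl j) = B i j"
  shows "gmut E (Inl k) p (Inl i) = gmut B k (\<lambda>i. p (Inl i)) i"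
  using assms by (simp add: gmut_def)

lemma gmuts_Inl:
  assumes "\<And>i j. E (Inl i) (Inl j) = B i j"
  shows "gmuts E (map Inl ks) p (Inl i) = gmuts B ks (\<lambda>i. p (Inl i)) i"
  using assms
proof (induction ks arbitrary: E B p)
  case (Cons k ks)
  have "gmuts (mmut (Inl k) E) (map Inl ks) (gmut E (Inl k) p) (Inl i)
      = gmuts (mmut k B) ks (\<lambda>i. gmut E (Inl k) p (Inl i)) i"
    using mmut_Inl[of E B, OF Cons.prems] by (rule Cons.IH)
  then show ?case by (simp add: gmut_Inl[of E B, OF Cons.prems])
qed simp

lemma gmuts_Inr_shift:
  assumes "\<And>i. q (Inl i) = p (Inl i)" "\<And>j. q (Inr j) = p (Inr j) + c j"
  shows "gmuts E (map Inl ks) q (Inr j) = gmuts E (map Inl ks) p (Inr j) + c j"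
  using assms
proof (induction ks arbitrary: E p q)
  case (Cons k ks)
  show ?case
    unfolding list.map gmuts.simps
    by (rule Cons.IH) (auto simp: gmut_def Cons.prems)
qed simp

lemma coherent_Inl:
  assumes "\<And>i j. E (Inl i) (Inl j) = B i j" "coherent E (map Inl ks) p q"
  shows "coherent B ks (\<lambda>i. p (Inl i)) (\<lambda>i. q (Inl i))"
  using assms
proof (induction ks arbitrary: E B p q)
  case (Cons k ks)
  have "coherent (mmut k B) ks (\<lambda>i. gmut E (Inl k) p (Inl i)) (\<lambda>i. gmut E (Inl k) q (Inl i))"
    using Cons.prems(2) by (intro Cons.IH[of "mmut (Inl k) E"] mmut_Inl Cons.prems(1)) simp
  then show ?case using Cons.prems(2) by (simp add: gmut_Inl[of E B, OF Cons.prems(1)])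
qed simp

text \<open>\<open>B\<close> itself need not be good, so \<open>p\<close> and \<open>q\<close> are
  lifted to the extension. A frozen coordinate is only shifted by amounts depending on the mutable
  ones, so its initial value can be chosen to make the final value 0.\<close>

theorem gmuts_coherent:
  fixes B :: "'n::finite \<Rightarrow> 'n \<Rightarrow> int"
  assumes "skew_by d B" "\<And>i. gmuts B ks p i \<ge> 0" "\<And>i. gmuts B ks q i \<ge> 0"
  shows "coherent B ks p q"
proof -
  let ?E = "pext 1 B"
  have lift: "\<exists>p'. (\<forall>i. p' (Inl i) = p i) \<and> (\<forall>r. gmuts ?E (map Inl ks) p' r \<ge> 0)"
    if nn: "\<And>i. gmuts B ks p i \<ge> 0" for p
  proof -
    define p0 where "p0 = case_sum p (\<lambda>_ :: 'n. 0)"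
    define p' where "p' = case_sum p (\<lambda>j. - gmuts ?E (map Inl ks) p0 (Inr j))"
    have "gmuts ?E (map Inl ks) p' (Inl i) = gmuts B ks p i" for i
      by (subst gmuts_Inl[of ?E B]) (simp_all add: p'_def)
    moreover have "gmuts ?E (map Inl ks) p' (Inr j) = 0" for j
      by (subst gmuts_Inr_shift[of p' p0 "\<lambda>j. - gmuts ?E (map Inl ks) p0 (Inr j)"]) (simp_all add: p'_def p0_def)
    ultimately have "gmuts ?E (map Inl ks) p' r \<ge> 0" for r
      using nn by (cases r) auto
    then show ?thesis by (intro exI[of _ p']) (simp add: p'_def)
  qed
  obtain p' where p': "\<And>i. p' (Inl i) = p i" "\<And>r. gmuts ?E (map Inl ks) p' r \<ge> 0"
    using lift[OF assms(2)] by blast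
  obtain q' where q': "\<And>i. q' (Inl i) = q i" "\<And>r. gmuts ?E (map Inl ks) q' r \<ge> 0"
    using lift[OF assms(3)] by blast
  have "coherent ?E (map Inl ks) p' q'"
    by (rule good_coherent[OF good_pext[OF assms(1)]]) (auto simp: p' q')
  then have "coherent B ks (\<lambda>i. p' (Inl i)) (\<lambda>i. q' (Inl i))"
    by (rule coherent_Inl[rotated]) simp
  then show ?thesis by (simp add: p' q')
qed

text \<open>The sign of coordinate \<open>l\<close> is tested by the first step of the sequence
  \<open>l # ks\<close> started at \<open>mmut l B\<close>, which passes through
  \<open>B\<close>.\<close>

corollary gmuts_sign_coherent:
  fixes B :: "'n::finite \<Rightarrow> 'n \<Rightarrow> int"
  assumes "skew_by d B" "\<And>i. gmuts B ks p i \<ge> 0" "\<And>i. gmuts B ks q i \<ge> 0"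
  shows "p l * q l \<ge> 0"
proof -
  have "coherent (mmut l B) (l # ks) (gmut B l p) (gmut B l q)"
    using assms by (intro gmuts_coherent[OF skew_by_mmut[OF assms(1)]])
      (simp_all add: gmut_gmut mmut_mmut[OF assms(1)])
  then show ?thesis by (simp add: gmut_def)
qed

section \<open>The matrices of c-vectors and g-vectors\<close>

definition gmutZ :: "('m \<Rightarrow> 'm \<Rightarrow> int) \<Rightarrow> 'm \<Rightarrow> ('m \<Rightarrow> int) \<Rightarrow> 'm \<Rightarrow> int" where
  "gmutZ B k p = (\<lambda>i. if i = k then - p k else p i + posp (B i k) * posp (p k) - posp (- B i k) * posp (- p k))"

lemma of_int_posp: "real_of_int (posp a) = max (of_int a) 0"
  by (simp add: posp_def max_def)

lemma gmut_of_int: "gmut B k (\<lambda>i. of_int (p i)) = (\<lambda>i. of_int (gmutZ B k p i))"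
  by (intro ext) (simp add: gmut_def gmutZ_def of_int_posp)

text \<open>\<open>crow B ks y\<close> is what a frozen row \<open>y\<close> attached to \<open>B\<close> becomes under the mutations \<open>ks\<close>.\<close>

primrec crow :: "('m \<Rightarrow> 'm \<Rightarrow> int) \<Rightarrow> 'm list \<Rightarrow> ('m \<Rightarrow> int) \<Rightarrow> 'm \<Rightarrow> int" where
  "crow B [] y = y"
| "crow B (k # ks) y = crow (mmut k B) ks (gmutZ (\<lambda>i j. B j i) k y)"

definition cmat :: "('m \<Rightarrow> 'm \<Rightarrow> int) \<Rightarrow> 'm list \<Rightarrow> 'm \<Rightarrow> 'm \<Rightarrow> int" where
  "cmat B ks j = crow B ks (unitv j)"

lemma crow_append: "crow B (ks @ ls) y = crow (mmuts B ks) ls (crow B ks y)"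
  by (induction ks arbitrary: B y) auto

lemma cmat_Nil: "cmat B [] j = unitv j"
  by (simp add: cmat_def)

lemma cmat_snoc: "cmat B (ks @ [k]) j = gmutZ (\<lambda>i l. mmuts B ks l i) k (cmat B ks j)"
  by (simp add: cmat_def crow_append)

lemma cmat_Cons_other: "j \<noteq> l \<Longrightarrow> cmat B (l # ks) j = cmat (mmut l B) ks j"
proof -
  assume "j \<noteq> l"
  then have "gmutZ (\<lambda>i j. B j i) l (unitv j) = unitv j"
    by (intro ext) (auto simp: gmutZ_def)
  then show ?thesis by (simp add: cmat_def)
qed

text \<open>A frozen row mutates through row \<open>k\<close> of \<open>B\<close>; after rescaling
  by \<open>d\<close> this is the mutation of g-vectors for the negated matrix.\<close>

lemma crow_gmuts:
  assumes "skew_by d B" "\<And>l. of_int (y l) = of_int (d l) * a l"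
  shows "of_int (crow B ks y l) = of_int (d l) * gmuts (\<lambda>i j. - B i j) ks a l"
  using assms
proof (induction ks arbitrary: B y a)
  case (Cons k ks)
  have dk: "of_int (d k) \<ge> (0::real)" using skew_by_pos[OF Cons.prems(1), of k] by simp
  have "of_int (gmutZ (\<lambda>i j. B j i) k y l) = of_int (d l) * gmut (\<lambda>i j. - B i j) k a l" for l
  proof (cases "l = k")
    case False
    have e: "of_int (posp (B k l)) * of_int (d k) = (of_int (d l) * of_int (posp (- B l k)) :: real)"
      "of_int (posp (- B k l)) * of_int (d k) = (of_int (d l) * of_int (posp (B l k)) :: real)"
      using skew_by_posp[OF Cons.prems(1), of k l] skew_by_posp'[OF Cons.prems(1), of k l]
      by (simp_all only: of_int_mult[symmetric] mult.commute)
    have e': "of_int (posp (B k l)) * (of_int (d k) * z) = of_int (d l) * (of_int (posp (- B l k)) * z)"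
      "of_int (posp (- B k l)) * (of_int (d k) * z) = of_int (d l) * (of_int (posp (B l k)) * z)" for z :: real
      using e by (simp_all only: mult.assoc[symmetric])
    have "of_int (gmutZ (\<lambda>i j. B j i) k y l) = of_int (y l) + of_int (posp (B k l)) * max (of_int (y k)) 0
        - of_int (posp (- B k l)) * max (- of_int (y k)) (0::real)"
      using False by (simp add: gmutZ_def of_int_posp)
    also have "\<dots> = of_int (d l) * (a l + of_int (posp (- B l k)) * max (a k) 0 - of_int (posp (B l k)) * max (- a k) 0)"
      unfolding Cons.prems(2) max_scale[OF dk] max_scale_neg[OF dk] e' by (simp add: algebra_simps)
    finally show ?thesis using False by (simp add: gmut_def)
  qed (simp add: gmutZ_def gmut_def Cons.prems(2))
  from Cons.IH[OF skew_by_mmut[OF Cons.prems(1)] this] show ?case by (simp add: mmut_neg)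
qed simp

text \<open>Seen from the final seed, the reversed sequence carries the rescaled rows to nonnegative
  vectors. So for the negated matrix they lie in one cone, and \<open>gmuts_sign_coherent\<close>
  applies to each coordinate.\<close>

lemma cmat_coherent:
  fixes B :: "'m::finite \<Rightarrow> 'm \<Rightarrow> int"
  assumes "skew_by d B"
  shows "cmat B ks i l * cmat B ks j l \<ge> 0"
proof -
  let ?N = "\<lambda>i j. - B i j"
  define a where "a = (\<lambda>j l. if l = j then 1 / of_int (d j) else 0 :: real)"
  have d: "of_int (d j) > (0::real)" for j using skew_by_pos[OF assms, of j] by simp
  have N: "skew_by d ?N" by (rule skew_by_neg[OF assms])
  have c: "of_int (cmat B ks j l) = of_int (d l) * gmuts ?N ks (a j) l" for j l
  proof -
    have "d j \<noteq> 0" for j using d[of j] by auto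
    then show ?thesis unfolding cmat_def by (intro crow_gmuts assms) (simp add: a_def)
  qed
  have "gmuts (mmuts ?N ks) (rev ks) (gmuts ?N ks (a j)) i \<ge> 0" for i j
    using d[of j] by (simp add: gmuts_rev[OF N] a_def)
  then have "gmuts ?N ks (a i) l * gmuts ?N ks (a j) l \<ge> 0"
    by (intro gmuts_sign_coherent[OF skew_by_mmuts[OF N]])
  then have "of_int (d l) * of_int (d l) * (gmuts ?N ks (a i) l * gmuts ?N ks (a j) l) \<ge> 0"
    by (rule mult_nonneg_nonneg[rotated]) (use d[of l] in simp)
  then have "of_int (cmat B ks i l) * of_int (cmat B ks j l) \<ge> (0::real)"
    unfolding c by (simp add: ac_simps)
  then show ?thesis by (simp only: of_int_mult[symmetric] of_int_0_le_iff)
qed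

text \<open>The tropical sign of vertex \<open>k\<close>: green for 1 and red for -1.\<close>

definition csign :: "('m \<Rightarrow> 'm \<Rightarrow> int) \<Rightarrow> 'm list \<Rightarrow> 'm \<Rightarrow> int" where
  "csign B ks k = (if \<forall>j. cmat B ks j k \<ge> 0 then 1 else -1)"

lemma csign_cases: "csign B ks k = 1 \<or> csign B ks k = -1"
  by (simp add: csign_def)

lemma csign_nonneg:
  fixes B :: "'m::finite \<Rightarrow> 'm \<Rightarrow> int"
  assumes "skew_by d B"
  shows "csign B ks k * cmat B ks j k \<ge> 0"
proof (cases "\<forall>j. cmat B ks j k \<ge> 0")
  case False
  then obtain i where "cmat B ks i k < 0" by (auto simp: not_le)
  with cmat_coherent[OF assms, of ks i k j] have "cmat B ks j k \<le> 0"
    by (simp add: zero_le_mult_iff)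
  with False show ?thesis by (auto simp: csign_def)
qed (simp add: csign_def)

lemma csign_eq:
  fixes B :: "'m::finite \<Rightarrow> 'm \<Rightarrow> int"
  assumes "skew_by d B" "cmat B ks j k \<noteq> 0"
  shows "csign B ks k = sgn (cmat B ks j k)"
  using csign_nonneg[OF assms(1), of ks k j] csign_cases[of B ks k] assms(2)
  by (auto simp: sgn_if zero_le_mult_iff)

section \<open>Mutation in terms of the tropical sign, and duality of the two matrices\<close>

definition gcoef :: "('m \<Rightarrow> 'm \<Rightarrow> int) \<Rightarrow> 'm list \<Rightarrow> 'm \<Rightarrow> 'm \<Rightarrow> int" where
  "gcoef B ks k m = posp (- csign B ks k * mmuts B ks m k)"

definition fcoef :: "('m \<Rightarrow> 'm \<Rightarrow> int) \<Rightarrow> 'm list \<Rightarrow> 'm \<Rightarrow> 'm \<Rightarrow> int" where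
  "fcoef B ks k l = posp (csign B ks k * mmuts B ks k l)"

text \<open>The g-vectors are the columns. The recursion is at the last mutation; that the entries
  are degrees of cluster variables is established only in \<open>homog_cluster\<close>.\<close>

function gmat :: "('m::finite \<Rightarrow> 'm \<Rightarrow> int) \<Rightarrow> 'm list \<Rightarrow> 'm \<Rightarrow> 'm \<Rightarrow> int" where
  "gmat B [] = (\<lambda>i m. unitv m i)"
| "gmat B (ks @ [k]) = (\<lambda>i m. if m = k then - gmat B ks i k + (\<Sum>r\<in>UNIV. gcoef B ks k r * gmat B ks i r) else gmat B ks i m)"
  by (auto, metis rev_exhaust)
termination by (relation "inv_image less_than (\<lambda>(B, ks). length ks)") auto

lemma sum_if_right: "(\<Sum>r\<in>(UNIV :: 'm::finite set). h r * (if r = l then x else 0)) = (h l * x :: int)"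
proof -
  have "(\<Sum>r\<in>UNIV. h r * (if r = l then x else 0)) = (\<Sum>r\<in>UNIV. if r = l then h l * x else 0)"
    by (intro sum.cong) auto
  then show ?thesis by simp
qed

lemma gmat_snoc:
  "gmat B (ks @ [k]) i m = (if m = k then - gmat B ks i k + (\<Sum>r\<in>UNIV. gcoef B ks k r * gmat B ks i r) else gmat B ks i m)"
  by simp

context
  fixes d :: "'m::finite \<Rightarrow> int" and B :: "'m \<Rightarrow> 'm \<Rightarrow> int"
  assumes skew: "skew_by d B"
begin

lemma cmat_snoc_fcoef:
  "cmat B (ks @ [k]) j l = (if l = k then - cmat B ks j k else cmat B ks j l + fcoef B ks k l * cmat B ks j k)"
proof -
  have *: "posp (cmat B ks j k) * posp b - posp (- cmat B ks j k) * posp (- b)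
      = posp (csign B ks k * b) * cmat B ks j k" for b
    using csign_nonneg[OF skew, of ks k j] csign_cases[of B ks k]
    by (auto simp: posp_def max_def)
  show ?thesis
    using *[of "mmuts B ks k l"] unfolding cmat_snoc gmutZ_def fcoef_def by (auto simp: mult_ac add_diff_eq[symmetric])
qed

lemma gcoef_self: "gcoef B ks k k = 0"
  by (simp add: gcoef_def skew_by_diag[OF skew_by_mmuts[OF skew]])

lemma gcoef_fcoef: "d l * gcoef B ks k l = d k * fcoef B ks k l"
  using csign_cases[of B ks k] skew_by_posp[OF skew_by_mmuts[OF skew], of l ks k]
    skew_by_posp'[OF skew_by_mmuts[OF skew], of l ks k]
  by (auto simp: gcoef_def fcoef_def)

lemma mmuts_snoc_coef:
  "m \<noteq> k \<Longrightarrow> l \<noteq> k \<Longrightarrow> mmuts B (ks @ [k]) m l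
    = mmuts B ks m l + mmuts B ks m k * fcoef B ks k l + gcoef B ks k m * mmuts B ks k l"
  using csign_cases[of B ks k]
  by (auto simp: mmuts_append mmut_apply gcoef_def fcoef_def posp_def max_def)

text \<open>In matrix form \<open>G^T D C = D\<close>. One mutation multiplies \<open>G\<close> and
  \<open>C\<close> on the right by matrices \<open>E\<close> and \<open>F\<close>, and
  \<open>gcoef_fcoef\<close> yields \<open>E^T D F = D\<close>.\<close>

lemma gmat_cmat_dual: "(\<Sum>i\<in>UNIV. gmat B ks i m * d i * cmat B ks i l) = (if m = l then d l else 0)"
proof (induction ks arbitrary: m l rule: rev_induct)
  case Nil
  have "(\<Sum>i\<in>UNIV. gmat B [] i m * d i * cmat B [] i l) = (\<Sum>i\<in>UNIV. if i = m then (if m = l then d l else 0) else 0)"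
    by (intro sum.cong) (auto simp: cmat_Nil)
  then show ?case by simp
next
  case (snoc k ks)
  define G where "G = gmat B ks"
  define C where "C = cmat B ks"
  define e where "e = gcoef B ks k"
  define f where "f = fcoef B ks k"
  have ef: "d l * e l = d k * f l" and e0: "e k = 0" for l
    by (simp_all add: e_def f_def gcoef_fcoef gcoef_self)
  have IH: "(\<Sum>i\<in>UNIV. G i m * d i * C i l) = (if m = l then d l else 0)" for m l
    using snoc unfolding G_def C_def by blast
  define S where "S = (\<lambda>g c. \<Sum>i\<in>UNIV. g i * d i * c i)"
  have S1: "S (\<lambda>i. - g i + (\<Sum>r\<in>UNIV. e r * G i r)) c = - S g c + (\<Sum>r\<in>UNIV. e r * S (\<lambda>i. G i r) c)" for g c
  proof -
    have "(\<Sum>i\<in>UNIV. (\<Sum>r\<in>UNIV. e r * G i r) * d i * c i) = (\<Sum>r\<in>UNIV. e r * S (\<lambda>i. G i r) c)"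
      unfolding S_def sum_distrib_left sum_distrib_right
      by (subst sum.swap) (simp add: ac_simps)
    then show ?thesis unfolding S_def by (simp add: left_diff_distrib sum_subtractf)
  qed
  have S2: "S g (\<lambda>i. c i + x * c' i) = S g c + x * S g c'" for g c c' x
    unfolding S_def by (simp add: distrib_left sum.distrib sum_distrib_left ac_simps)
  have S3: "S g (\<lambda>i. - c i) = - S g c" for g c
    unfolding S_def by (simp add: sum_negf)
  have I: "S (\<lambda>i. G i m) (\<lambda>i. C i l) = (if m = l then d l else 0)" for m l
    using IH unfolding S_def .
  have sum_e: "(\<Sum>r\<in>UNIV. e r * (if r = l then d l else 0)) = e l * d l" for l
    by (rule sum_if_right)
  have "S (\<lambda>i. gmat B (ks @ [k]) i m) (\<lambda>i. cmat B (ks @ [k]) i l) = (if m = l then d l else 0)"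
  proof (cases "m = k"; cases "l = k")
    assume mk: "m = k" and lk: "l = k"
    have "S (\<lambda>i. gmat B (ks @ [k]) i m) (\<lambda>i. cmat B (ks @ [k]) i l)
       = S (\<lambda>i. - G i k + (\<Sum>r\<in>UNIV. e r * G i r)) (\<lambda>i. - C i k)"
      by (simp add: mk lk cmat_snoc_fcoef G_def C_def e_def)
    also have "\<dots> = d k" unfolding S1 S3 I using sum_e[of k] e0 by (simp add: sum_negf)
    finally show ?thesis by (simp add: mk lk)
  next
    assume mk: "m = k" and lk: "l \<noteq> k"
    have "S (\<lambda>i. gmat B (ks @ [k]) i m) (\<lambda>i. cmat B (ks @ [k]) i l)
       = S (\<lambda>i. - G i k + (\<Sum>r\<in>UNIV. e r * G i r)) (\<lambda>i. C i l + f l * C i k)"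
      using lk by (simp add: mk cmat_snoc_fcoef G_def C_def e_def f_def)
    also have "\<dots> = - (f l * d k) + e l * d l"
    proof -
      have "(\<Sum>r\<in>UNIV. e r * (f l * (if r = k then d k else 0))) = 0"
        using sum_if_right[of "\<lambda>r. e r * f l" k "d k"] e0 by (simp add: mult.assoc)
      then show ?thesis unfolding S1 S2 I distrib_left sum.distrib sum_e using lk by simp
    qed
    also have "\<dots> = 0" using ef[of l] by (simp add: ac_simps)
    finally show ?thesis using mk lk by simp
  next
    assume mk: "m \<noteq> k" and lk: "l = k"
    have "S (\<lambda>i. gmat B (ks @ [k]) i m) (\<lambda>i. cmat B (ks @ [k]) i l) = S (\<lambda>i. G i m) (\<lambda>i. - C i k)"
      using mk by (simp add: lk cmat_snoc_fcoef G_def C_def)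
    then show ?thesis using mk lk by (simp add: S3 I)
  next
    assume mk: "m \<noteq> k" and lk: "l \<noteq> k"
    have "S (\<lambda>i. gmat B (ks @ [k]) i m) (\<lambda>i. cmat B (ks @ [k]) i l) = S (\<lambda>i. G i m) (\<lambda>i. C i l + f l * C i k)"
      using mk lk by (simp add: cmat_snoc_fcoef G_def C_def f_def)
    then show ?thesis using mk by (simp add: S2 I)
  qed
  then show ?case unfolding S_def .
qed

text \<open>In matrix form \<open>G B_t = B C\<close> for the mutated matrix \<open>B_t\<close>.
  With the same \<open>E\<close> and \<open>F\<close>, mutation turns \<open>B_t\<close> into
  \<open>E B_t F\<close>, and \<open>E\<close> is an involution.\<close>

lemma gmat_mult_mmuts: "(\<Sum>m\<in>UNIV. gmat B ks i m * mmuts B ks m l) = (\<Sum>j\<in>UNIV. B i j * cmat B ks j l)"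
proof (induction ks arbitrary: l rule: rev_induct)
  case Nil
  have "(\<Sum>m\<in>UNIV. gmat B [] i m * mmuts B [] m l) = (\<Sum>m\<in>UNIV. if m = i then B i l else 0)"
    by (intro sum.cong) auto
  moreover have "(\<Sum>j\<in>UNIV. B i j * cmat B [] j l) = (\<Sum>j\<in>UNIV. if j = l then B i l else 0)"
    by (intro sum.cong) (auto simp: cmat_Nil)
  ultimately show ?case by simp
next
  case (snoc k ks)
  have split: "(\<Sum>m\<in>UNIV. g m) = g k + (\<Sum>m\<in>UNIV - {k}. g m)" for g :: "'m \<Rightarrow> int"
    by (simp add: sum.remove[of UNIV k])
  have diag: "mmuts B ks k k = 0" by (rule skew_by_diag[OF skew_by_mmuts[OF skew]])
  define e where "e = gcoef B ks k"
  have ek: "e k = 0" by (simp add: e_def gcoef_self)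
  show ?case
  proof (cases "l = k")
    case True
    have "(\<Sum>m\<in>UNIV. gmat B (ks @ [k]) i m * mmuts B (ks @ [k]) m l) = - (\<Sum>m\<in>UNIV. gmat B ks i m * mmuts B ks m k)"
      unfolding split by (simp add: True mmuts_append mmut_apply diag sum_negf)
    then show ?thesis using snoc True by (simp add: cmat_snoc_fcoef sum_negf)
  next
    case False
    define f where "f = fcoef B ks k l"
    define b where "b = mmuts B ks k l"
    have "(\<Sum>m\<in>UNIV. gmat B (ks @ [k]) i m * mmuts B (ks @ [k]) m l)
        = (- gmat B ks i k + (\<Sum>r\<in>UNIV. e r * gmat B ks i r)) * (- b)
        + (\<Sum>m\<in>UNIV - {k}. gmat B ks i m * (mmuts B ks m l + mmuts B ks m k * f + e m * b))"
    proof -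
      have "mmuts B (ks @ [k]) k l = - b" by (simp add: mmuts_append mmut_apply b_def)
      moreover have "(\<Sum>m\<in>UNIV - {k}. gmat B (ks @ [k]) i m * mmuts B (ks @ [k]) m l)
        = (\<Sum>m\<in>UNIV - {k}. gmat B ks i m * (mmuts B ks m l + mmuts B ks m k * f + e m * b))"
        using False by (intro sum.cong) (auto simp: mmuts_snoc_coef e_def f_def b_def)
      ultimately show ?thesis unfolding split[of "\<lambda>m. gmat B (ks @ [k]) i m * mmuts B (ks @ [k]) m l"]
        by (simp add: e_def)
    qed
    also have "\<dots> = (gmat B ks i k * b + (\<Sum>m\<in>UNIV - {k}. gmat B ks i m * mmuts B ks m l))
        + f * (\<Sum>m\<in>UNIV - {k}. gmat B ks i m * mmuts B ks m k)"
      unfolding split[of "\<lambda>r. e r * gmat B ks i r"] ek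
      by (simp add: algebra_simps sum.distrib sum_distrib_left sum_distrib_right sum_negf sum_subtractf)
    also have "\<dots> = (\<Sum>m\<in>UNIV. gmat B ks i m * mmuts B ks m l) + f * (\<Sum>m\<in>UNIV. gmat B ks i m * mmuts B ks m k)"
      unfolding split[of "\<lambda>m. gmat B ks i m * mmuts B ks m l"] split[of "\<lambda>m. gmat B ks i m * mmuts B ks m k"]
      by (simp add: diag b_def)
    also have "\<dots> = (\<Sum>j\<in>UNIV. B i j * cmat B (ks @ [k]) j l)"
      using False unfolding snoc by (simp add: cmat_snoc_fcoef f_def distrib_left sum.distrib sum_distrib_left ac_simps)
    finally show ?thesis .
  qed
qed

text \<open>Mutation is an invertible integral column operation, so the columns keep spanning the
  integer lattice; \<open>z'\<close> holds the coefficients for the new columns.\<close>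

lemma cmat_span: "\<exists>z. \<forall>j. (\<Sum>l\<in>UNIV. z l * cmat B ks j l) = y j"
proof (induction ks rule: rev_induct)
  case Nil
  have "(\<Sum>l\<in>UNIV. y l * cmat B [] j l) = (\<Sum>l\<in>UNIV. if l = j then y l else 0)" for j
    by (intro sum.cong) (auto simp: cmat_Nil)
  then show ?case by (intro exI[of _ y]) simp
next
  case (snoc k ks)
  then obtain z where z: "\<And>j. (\<Sum>l\<in>UNIV. z l * cmat B ks j l) = y j" by blast
  have split: "(\<Sum>m\<in>UNIV. g m) = g k + (\<Sum>m\<in>UNIV - {k}. g m)" for g :: "'m \<Rightarrow> int"
    by (simp add: sum.remove[of UNIV k])
  define z' where "z' = z(k := (\<Sum>l\<in>UNIV - {k}. z l * fcoef B ks k l) - z k)"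
  have "(\<Sum>l\<in>UNIV. z' l * cmat B (ks @ [k]) j l) = y j" for j
  proof -
    have "(\<Sum>l\<in>UNIV. z' l * cmat B (ks @ [k]) j l)
      = ((\<Sum>l\<in>UNIV - {k}. z l * fcoef B ks k l) - z k) * (- cmat B ks j k)
       + (\<Sum>l\<in>UNIV - {k}. z l * (cmat B ks j l + fcoef B ks k l * cmat B ks j k))"
      unfolding split by (simp add: z'_def cmat_snoc_fcoef)
    also have "\<dots> = (\<Sum>l\<in>UNIV. z l * cmat B ks j l)"
      unfolding split by (simp add: algebra_simps sum.distrib sum_distrib_left sum_distrib_right sum_negf sum_subtractf)
    finally show ?thesis by (simp add: z)
  qed
  then show ?case by blast
qed

lemma gmat_span: "\<exists>z. \<forall>i. (\<Sum>m\<in>UNIV. z m * gmat B ks i m) = y i"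
proof (induction ks rule: rev_induct)
  case Nil
  have "(\<Sum>l\<in>UNIV. y l * gmat B [] j l) = (\<Sum>l\<in>UNIV. if l = j then y l else 0)" for j
    by (intro sum.cong) auto
  then show ?case by (intro exI[of _ y]) simp
next
  case (snoc k ks)
  then obtain z where z: "\<And>i. (\<Sum>m\<in>UNIV. z m * gmat B ks i m) = y i" by blast
  have split: "(\<Sum>m\<in>UNIV. g m) = g k + (\<Sum>m\<in>UNIV - {k}. g m)" for g :: "'m \<Rightarrow> int"
    by (simp add: sum.remove[of UNIV k])
  define e where "e = gcoef B ks k"
  have ek: "e k = 0" by (simp add: e_def gcoef_self)
  define z' where "z' = (\<lambda>m. if m = k then - z k else z m + z k * e m)"
  have "(\<Sum>m\<in>UNIV. z' m * gmat B (ks @ [k]) i m) = y i" for i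
  proof -
    have "(\<Sum>m\<in>UNIV. z' m * gmat B (ks @ [k]) i m)
      = - z k * (- gmat B ks i k + (\<Sum>r\<in>UNIV. e r * gmat B ks i r))
       + (\<Sum>m\<in>UNIV - {k}. (z m + z k * e m) * gmat B ks i m)"
      unfolding split[of "\<lambda>m. z' m * gmat B (ks @ [k]) i m"] by (simp add: z'_def e_def)
    also have "\<dots> = (\<Sum>m\<in>UNIV. z m * gmat B ks i m)"
      unfolding split[of "\<lambda>r. e r * gmat B ks i r"] split[of "\<lambda>m. z m * gmat B ks i m"] ek
      by (simp add: algebra_simps sum.distrib sum_distrib_left sum_distrib_right sum_negf sum_subtractf)
    finally show ?thesis by (simp add: z)
  qed
  then show ?case by blast
qed

lemma gmat_row_nonzero: "\<exists>m. gmat B ks l m \<noteq> 0"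
proof (rule ccontr)
  assume a: "\<not> ?thesis"
  obtain z where "\<forall>i. (\<Sum>m\<in>UNIV. z m * gmat B ks i m) = unitv l i" using gmat_span[of ks "unitv l"] by blast
  then have "(\<Sum>m\<in>UNIV. z m * gmat B ks l m) = 1" by simp
  with a show False by simp
qed

text \<open>Write the unit vector of \<open>j\<close> in the columns of \<open>gmat\<close>. Row
  \<open>l\<close> forces the coefficient of column \<open>k\<close> to vanish, and pairing with the
  c-vector of \<open>k\<close> by duality gives the entry.\<close>

lemma gmat_row_single:
  assumes "\<And>m. m \<noteq> k \<Longrightarrow> gmat B ks l m = 0" "j \<noteq> l"
  shows "cmat B ks j k = 0"
proof -
  obtain z where z: "\<And>i. (\<Sum>m\<in>UNIV. z m * gmat B ks i m) = unitv j i" using gmat_span[of ks "unitv j"] by blast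
  have split: "(\<Sum>m\<in>UNIV. g m) = g k + (\<Sum>m\<in>UNIV - {k}. g m)" for g :: "'m \<Rightarrow> int"
    by (simp add: sum.remove[of UNIV k])
  have "gmat B ks l k \<noteq> 0" using gmat_row_nonzero[of ks l] assms(1) by metis
  moreover have "z k * gmat B ks l k = 0"
    using z[of l] assms unfolding split by simp
  ultimately have zk: "z k = 0" by simp
  have "(\<Sum>i\<in>UNIV. unitv j i * d i * cmat B ks i k) = (\<Sum>m\<in>UNIV. z m * (\<Sum>i\<in>UNIV. gmat B ks i m * d i * cmat B ks i k))"
    unfolding z[symmetric] sum_distrib_left sum_distrib_right
    by (subst sum.swap) (simp add: ac_simps)
  also have "\<dots> = z k * d k"
    unfolding gmat_cmat_dual by (rule sum_if_right)
  also have "(\<Sum>i\<in>UNIV. unitv j i * d i * cmat B ks i k) = (\<Sum>i\<in>UNIV. (d i * cmat B ks i k) * unitv j i)"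
    by (simp only: ac_simps)
  finally have "d j * cmat B ks j k = 0"
    by (simp add: zk sum_if_right)
  then show ?thesis using skew_by_pos[OF skew, of j] by simp
qed

text \<open>Duality determines the zeros of row \<open>l\<close> of \<open>gmat\<close>; integrality
  of the two spans makes both remaining entries units, and positivity of \<open>d\<close> gives them
  the same sign.\<close>

lemma cmat_col_single:
  assumes "\<And>j. j \<noteq> l \<Longrightarrow> cmat B ks j k = 0"
  shows "m \<noteq> k \<Longrightarrow> gmat B ks l m = 0" "gmat B ks l k = cmat B ks l k" "\<bar>cmat B ks l k\<bar> = 1"
proof -
  have split: "(\<Sum>m\<in>UNIV. g m) = g r + (\<Sum>m\<in>UNIV - {r}. g m)" for g :: "'m \<Rightarrow> int" and r
    by (simp add: sum.remove[of UNIV r])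
  have p: "gmat B ks l m * d l * cmat B ks l k = (if m = k then d k else 0)" for m
    using gmat_cmat_dual[of ks m k] assms unfolding split[of _ l] by simp
  have dk: "d k > 0" "d l > 0" using skew_by_pos[OF skew] by auto
  have c0: "cmat B ks l k \<noteq> 0" using p[of k] dk by auto
  show z0: "gmat B ks l m = 0" if "m \<noteq> k" for m using p[of m] that c0 dk by simp
  obtain z where z: "\<And>i. (\<Sum>m\<in>UNIV. z m * gmat B ks i m) = unitv l i" using gmat_span[of ks "unitv l"] by blast
  have "z k * gmat B ks l k = 1" using z[of l] z0 unfolding split[of _ k] by simp
  then have "\<bar>gmat B ks l k * z k\<bar> = 1" by (simp add: mult.commute)
  then have g1: "\<bar>gmat B ks l k\<bar> = 1" by (rule abs_zmult_eq_1)
  obtain w where w: "\<And>j. (\<Sum>m\<in>UNIV. w m * cmat B ks j m) = unitv l j" using cmat_span[of ks "unitv l"] by blast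
  have "(\<Sum>i\<in>UNIV. gmat B ks i k * d i * unitv l i) = (\<Sum>m\<in>UNIV. w m * (\<Sum>i\<in>UNIV. gmat B ks i k * d i * cmat B ks i m))"
    unfolding w[symmetric] sum_distrib_left by (subst sum.swap) (simp add: ac_simps)
  also have "\<dots> = w k * d k"
  proof -
    have "(\<Sum>m\<in>UNIV. w m * (if k = m then d m else 0)) = (\<Sum>m\<in>UNIV. w m * (if m = k then d k else 0))"
      by (intro sum.cong) auto
    then show ?thesis unfolding gmat_cmat_dual by (simp only: sum_if_right)
  qed
  finally have "gmat B ks l k * d l = w k * d k" by (simp add: sum_if_right)
  then have "w k * d k * cmat B ks l k = d k" using p[of k] by simp
  then have "d k * (w k * cmat B ks l k) = d k * 1" by (simp add: ac_simps)
  then have "w k * cmat B ks l k = 1" using dk by (simp only: mult_cancel_left) auto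
  then have "\<bar>cmat B ks l k * w k\<bar> = 1" by (simp add: mult.commute)
  then show c1: "\<bar>cmat B ks l k\<bar> = 1" by (rule abs_zmult_eq_1)
  have "(gmat B ks l k * cmat B ks l k) * d l = d k" using p[of k] by (simp add: ac_simps)
  then have "0 < (gmat B ks l k * cmat B ks l k) * d l" using dk by simp
  then have "gmat B ks l k * cmat B ks l k > 0"
    using dk(2) by (simp only: zero_less_mult_pos2)
  then show "gmat B ks l k = cmat B ks l k" using g1 c1 by (auto simp: abs_if zero_less_mult_iff split: if_splits)
qed

end

section \<open>Change of the initial seed\<close>

lemma gmutZ_sign:
  assumes "s = 1 \<or> s = -1" "s * p l \<ge> 0"
  shows "gmutZ B l p i = (if i = l then - p l else p i + posp (s * B i l) * p l)"
  using assms by (auto simp: gmutZ_def posp_def max_def)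

lemma common_sign:
  fixes f :: "'a \<Rightarrow> int"
  assumes "\<And>a b. f a * f b \<ge> 0"
  shows "\<exists>s. (s = 1 \<or> s = -1) \<and> (\<forall>a. s * f a \<ge> 0)"
proof (cases "\<forall>a. f a \<ge> 0")
  case True
  then show ?thesis by (intro exI[of _ 1]) simp
next
  case False
  then obtain b where b: "f b < 0" by (auto simp: not_le)
  have "f a \<le> 0" for a
    using assms[of b a] b by (simp add: zero_le_mult_iff)
  then show ?thesis by (intro exI[of _ "-1"]) simp
qed

text \<open>The two patterns, started at \<open>B\<close> and at \<open>mmut l B\<close>, append the
  mutation \<open>k\<close> by the same rule unless the c-vector of \<open>k\<close> is supported on
  \<open>l\<close> alone. In that case the tropical signs are opposite, and
  \<open>gmat_mult_mmuts\<close> accounts for the discrepancy.\<close>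

lemma gmat_Cons_step:
  fixes B :: "'m::finite \<Rightarrow> 'm \<Rightarrow> int"
  assumes skew: "skew_by d B"
    and IH: "\<And>i m. gmat B (l # ks) i m = gmutZ (mmut l B) l (\<lambda>i. gmat (mmut l B) ks i m) i"
    and coh: "\<And>m m'. gmat (mmut l B) ks l m * gmat (mmut l B) ks l m' \<ge> 0"
    and coh': "\<And>m m'. gmat (mmut l B) (ks @ [k]) l m * gmat (mmut l B) (ks @ [k]) l m' \<ge> 0"
  shows "gmat B (l # ks @ [k]) i m = gmutZ (mmut l B) l (\<lambda>i. gmat (mmut l B) (ks @ [k]) i m) i"
proof (cases "m = k")
  case False
  have "gmat B (l # ks @ [k]) i m = gmat B (l # ks) i m"
    using False gmat_snoc[of B "l # ks" k] by simp
  moreover have "gmat (mmut l B) (ks @ [k]) i m = gmat (mmut l B) ks i m" for i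
    using False by simp
  ultimately show ?thesis by (simp only: IH)
next
  case mk: True
  define B1 where "B1 = mmut l B"
  define G1 where "G1 = gmat B1 ks"
  define G0 where "G0 = gmat B (l # ks)"
  have skew1: "skew_by d B1" unfolding B1_def by (rule skew_by_mmut[OF skew])
  have Bt: "mmuts B (l # ks) = mmuts B1 ks" by (simp add: B1_def)
  have G01: "G0 i m = gmutZ B1 l (\<lambda>i. G1 i m) i" for i m
    unfolding G0_def G1_def B1_def by (rule IH)
  have Crow: "cmat B (l # ks) j = cmat B1 ks j" if "j \<noteq> l" for j
    unfolding B1_def using that by (rule cmat_Cons_other)
  have G0k: "gmat B (l # ks @ [k]) i k = - G0 i k + (\<Sum>r\<in>UNIV. gcoef B (l # ks) k r * G0 i r)" for i
    using gmat_snoc[of B "l # ks" k i k] by (simp add: G0_def)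
  have G1k: "gmat B1 (ks @ [k]) i k = - G1 i k + (\<Sum>r\<in>UNIV. gcoef B1 ks k r * G1 i r)" for i
    by (simp add: G1_def)
  have "gmat B (l # ks @ [k]) i k = gmutZ B1 l (\<lambda>i. gmat B1 (ks @ [k]) i k) i"
  proof (cases "\<exists>j. j \<noteq> l \<and> cmat B1 ks j k \<noteq> 0")
    case True
    then obtain j where j: "j \<noteq> l" "cmat B1 ks j k \<noteq> 0" by blast
    have "csign B (l # ks) k = csign B1 ks k"
      using csign_eq[OF skew, of "l # ks" j k] csign_eq[OF skew1, of ks j k] j Crow by simp
    then have e: "gcoef B (l # ks) k = gcoef B1 ks k" by (intro ext) (simp add: gcoef_def Bt B1_def)
    have "\<exists>s. (s = 1 \<or> s = -1) \<and> (\<forall>m. s * G1 l m \<ge> 0)"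
      by (rule common_sign) (simp add: coh G1_def B1_def)
    then obtain s where s: "s = 1 \<or> s = -1" "\<And>m. s * G1 l m \<ge> 0" by blast
    have "\<exists>s. (s = 1 \<or> s = -1) \<and> (\<forall>m. s * gmat B1 (ks @ [k]) l m \<ge> 0)"
      unfolding B1_def by (rule common_sign, rule coh')
    then obtain s' where s': "s' = 1 \<or> s' = -1" "\<And>m. s' * gmat B1 (ks @ [k]) l m \<ge> 0" by blast
    \<comment> \<open>A nonzero entry of row \<open>l\<close> outside column \<open>k\<close> is the
      same before and after the mutation, so the row has the sign \<open>s\<close> both times and
      \<open>gmutZ\<close> acts on all columns by one linear map.\<close>
    have "\<exists>m0. m0 \<noteq> k \<and> G1 l m0 \<noteq> 0"
    proof (rule ccontr)
      assume "\<not> ?thesis"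
      then have "cmat B1 ks j k = 0"
        by (intro gmat_row_single[OF skew1 _ j(1)]) (auto simp: G1_def)
      with j show False by simp
    qed
    then obtain m0 where m0: "m0 \<noteq> k" "G1 l m0 \<noteq> 0" by blast
    then have "s' * G1 l m0 \<ge> 0" using s'(2)[of m0] by (simp add: G1_def)
    then have "s' = s" using s(1) s'(1) s(2)[of m0] m0(2) by auto
    with s'(2)[of k] have sk: "s * gmat B1 (ks @ [k]) l k \<ge> 0" by (simp only:)
    have N: "gmutZ B1 l (\<lambda>i. G1 i m) i = (if i = l then - G1 l m else G1 i m + posp (s * B1 i l) * G1 l m)" for i m
      using gmutZ_sign[OF s(1), of "\<lambda>i. G1 i m"] s(2) by simp
    have N': "gmutZ B1 l (\<lambda>i. gmat B1 (ks @ [k]) i k) i = (if i = l then - gmat B1 (ks @ [k]) l k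
        else gmat B1 (ks @ [k]) i k + posp (s * B1 i l) * gmat B1 (ks @ [k]) l k)"
      by (rule gmutZ_sign[OF s(1)]) (rule sk)
    show ?thesis
      unfolding N' unfolding G0k G1k G01 N e
      by (simp add: algebra_simps sum.distrib sum_distrib_left sum_negf)
  next
    case False
    then have c0: "cmat B1 ks j k = 0" if "j \<noteq> l" for j using that by blast
    \<comment> \<open>The c-vector of \<open>k\<close> is now \<open>c\<close> times a unit vector,
      with \<open>c\<close> equal to 1 or -1; the tropical sign is \<open>c\<close> in one pattern
      and \<open>- c\<close> in the other.\<close>
    define c where "c = cmat B1 ks l k"
    have g0: "G1 l m = 0" if "m \<noteq> k" for m
      using cmat_col_single(1)[OF skew1 c0 that] by (simp add: G1_def)
    have gc: "G1 l k = c" and c1: "\<bar>c\<bar> = 1"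
      using cmat_col_single(2,3)[OF skew1 c0] by (simp_all add: G1_def c_def)
    have e1: "csign B1 ks k = c"
      using csign_eq[OF skew1, of ks l k] c1 by (auto simp: c_def sgn_if abs_if split: if_splits)
    have c0': "cmat B (l # ks) j k = 0" if "j \<noteq> l" for j using that c0 by (simp add: Crow)
    have "gmat B (l # ks) l k = cmat B (l # ks) l k" "\<bar>cmat B (l # ks) l k\<bar> = 1"
      using cmat_col_single(2,3)[OF skew c0'] by simp_all
    moreover have "gmat B (l # ks) l k = - c"
      using G01[of l k] gc by (simp add: G0_def gmutZ_def)
    ultimately have e0: "csign B (l # ks) k = - c"
      using csign_eq[OF skew, of "l # ks" l k] c1 by (auto simp: sgn_if abs_if split: if_splits)
    define b where "b = (\<lambda>r. mmuts B1 ks r k)"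
    have bk: "b k = 0" unfolding b_def by (rule skew_by_diag[OF skew_by_mmuts[OF skew1]])
    have sum_l: "(\<Sum>r\<in>UNIV. posp (x * b r) * G1 l r) = 0" for x
      using g0 bk by (intro sum.neutral) (metis mult_zero_left mult_zero_right posp_zero)
    have G0r: "G0 i r = G1 i r" if "r \<noteq> k" "i \<noteq> l" for i r
      using g0[OF that(1)] that(2) by (simp add: G01 gmutZ_def)
    have G0l: "G0 l r = - G1 l r" for r by (simp add: G01 gmutZ_def)
    have b': "mmuts B1 ks r k = b r" for r by (simp add: b_def)
    have L0: "gmat B (l # ks @ [k]) i k = - G0 i k + (\<Sum>r\<in>UNIV. posp (c * b r) * G0 i r)" for i
      unfolding G0k gcoef_def e0 Bt b' by simp
    have R0: "gmat B1 (ks @ [k]) i k = - G1 i k + (\<Sum>r\<in>UNIV. posp (- c * b r) * G1 i r)" for i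
      unfolding G1k gcoef_def e1 b' ..
    show ?thesis
    proof (cases "i = l")
      case True
      have "(\<Sum>r\<in>UNIV. posp (x * b r) * G0 l r) = 0" for x
        unfolding G0l using sum_l[of x] by (simp add: sum_negf)
      then have "gmat B (l # ks @ [k]) l k = G1 l k" unfolding L0 by (simp add: G0l)
      moreover have "gmat B1 (ks @ [k]) l k = - G1 l k" unfolding R0 sum_l by simp
      ultimately show ?thesis unfolding True gmutZ_def by (simp only: minus_minus if_True simp_thms)
    next
      case il: False
      have "(\<Sum>r\<in>UNIV. posp (c * b r) * G0 i r) = (\<Sum>r\<in>UNIV. posp (c * b r) * G1 i r)"
      proof (intro sum.cong refl)
        fix r show "posp (c * b r) * G0 i r = posp (c * b r) * G1 i r"
          using G0r[of r i] il bk by (cases "r = k") auto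
      qed
      then have L: "gmat B (l # ks @ [k]) i k = - G0 i k + (\<Sum>r\<in>UNIV. posp (c * b r) * G1 i r)"
        unfolding L0 by simp
      have R: "gmat B1 (ks @ [k]) i k = - G1 i k + (\<Sum>r\<in>UNIV. posp (- c * b r) * G1 i r)"
        "gmat B1 (ks @ [k]) l k = - c"
        unfolding R0 using sum_l[of "- c"] by (simp_all add: gc)
      \<comment> \<open>From this the two choices of coefficients are seen to differ by exactly
        \<open>B1 i l\<close>, the difference of the two linear pieces of
        \<open>gmutZ\<close>.\<close>
      have GB: "(\<Sum>r\<in>UNIV. G1 i r * b r) = B1 i l * c"
      proof -
        have "(\<Sum>r\<in>UNIV. G1 i r * b r) = (\<Sum>j\<in>UNIV. B1 i j * cmat B1 ks j k)"
          unfolding G1_def b_def by (rule gmat_mult_mmuts[OF skew1])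
        also have "\<dots> = (\<Sum>j\<in>UNIV. B1 i j * (if j = l then c else 0))"
          by (intro sum.cong refl) (use c0 in \<open>auto simp: c_def\<close>)
        finally show ?thesis by (simp only: sum_if_right)
      qed
      have "(\<Sum>r\<in>UNIV. posp (c * b r) * G1 i r) - (\<Sum>r\<in>UNIV. posp (- c * b r) * G1 i r)
          = (\<Sum>r\<in>UNIV. (c * b r) * G1 i r)"
        unfolding sum_subtractf[symmetric] left_diff_distrib[symmetric]
        by (intro sum.cong refl) (simp add: posp_diff)
      also have "\<dots> = c * (B1 i l * c)"
        unfolding GB[symmetric] by (simp add: sum_distrib_left ac_simps)
      also have "\<dots> = B1 i l" using c1 by (auto simp: abs_if split: if_splits)
      finally have D: "(\<Sum>r\<in>UNIV. posp (c * b r) * G1 i r) = (\<Sum>r\<in>UNIV. posp (- c * b r) * G1 i r) + B1 i l"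
        by simp
      have "G0 i k = G1 i k + posp (B1 i l) * posp c - posp (- B1 i l) * posp (- c)"
        using il gc by (simp add: G01 gmutZ_def)
      moreover have "gmutZ B1 l (\<lambda>i. gmat B1 (ks @ [k]) i k) i = gmat B1 (ks @ [k]) i k
          + posp (B1 i l) * posp (- c) - posp (- B1 i l) * posp c"
        unfolding gmutZ_def R(2) using il by (simp only: if_False minus_minus)
      ultimately show ?thesis
        unfolding L D using R(1) c1 posp_diff[of "B1 i l"]
        by (auto simp: abs_if posp_def split: if_splits)
    qed
  qed
  then show ?thesis by (simp add: mk B1_def)
qed

text \<open>In the induction on the length, the statement for shorter sequences yields
  sign-coherence of the rows of \<open>gmat\<close>, as \<open>gmat_Cons_step\<close> requires. That
  lemma peels off the first mutation and leaves the same statement for the tail.\<close>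

theorem gmuts_gmat_col:
  fixes B :: "'m::finite \<Rightarrow> 'm \<Rightarrow> int"
  assumes "skew_by d B"
  shows "gmuts B ks (\<lambda>i. of_int (gmat B ks i m)) = (\<lambda>i. of_int (unitv m i))"
  using assms
proof (induction "length ks" arbitrary: B ks m rule: less_induct)
  case less
  show ?case
  proof (cases ks)
    case (Cons l ks')
    define B1 where "B1 = mmut l B"
    have skew1: "skew_by d B1" unfolding B1_def by (rule skew_by_mmut[OF less.prems])
    have coh: "gmat B1 ls l m * gmat B1 ls l m' \<ge> 0" if "length ls \<le> length ks'" for ls m m'
    proof -
      have "gmuts B1 ls (\<lambda>i. of_int (gmat B1 ls i m)) = (\<lambda>i. of_int (unitv m i))" for m
        using that Cons skew1 by (intro less.hyps) auto
      then have "real_of_int (gmat B1 ls l m) * of_int (gmat B1 ls l m') \<ge> 0"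
        by (intro gmuts_sign_coherent[OF skew1, of ls]) auto
      then show ?thesis by (simp only: of_int_mult[symmetric] of_int_0_le_iff)
    qed
    have ich: "gmat B (l # ls) i m = gmutZ B1 l (\<lambda>i. gmat B1 ls i m) i" if "length ls \<le> length ks'" for ls i m
      using that
    proof (induction ls arbitrary: i m rule: rev_induct)
      case Nil
      have c: "csign B [] l = 1" by (simp add: csign_def cmat_Nil)
      have dl: "B l l = 0" by (rule skew_by_diag[OF less.prems])
      have "(\<Sum>r\<in>UNIV. gcoef B [] l r * gmat B [] i r) = posp (- B i l)"
      proof -
        have "(\<Sum>r\<in>UNIV. gcoef B [] l r * gmat B [] i r) = (\<Sum>r\<in>UNIV. gcoef B [] l r * (if r = i then 1 else 0))"
          by (intro sum.cong) auto
        then show ?thesis by (simp add: sum_if_right gcoef_def c)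
      qed
      then show ?case
        using gmat_snoc[of B "[]" l i m] dl
        by (auto simp: gmutZ_def B1_def mmut_apply posp_def)
    next
      case (snoc k ls)
      have ls: "length ls \<le> length ks'" using snoc.prems by simp
      show ?case
        unfolding B1_def
        by (rule gmat_Cons_step[OF less.prems snoc.IH[OF ls, unfolded B1_def]
          coh[OF ls, unfolded B1_def] coh[OF snoc.prems, unfolded B1_def]])
    qed
    have "gmut B l (\<lambda>i. of_int (gmat B (l # ks') i m)) = (\<lambda>i. of_int (gmat B1 ks' i m))"
    proof -
      have "(\<lambda>i. real_of_int (gmat B (l # ks') i m)) = gmut B1 l (\<lambda>i. of_int (gmat B1 ks' i m))"
        unfolding gmut_of_int by (simp add: ich)
      then show ?thesis
        using gmut_gmut[of l B1] mmut_mmut[OF less.prems, of l] by (simp add: B1_def)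
    qed
    moreover have "gmuts B1 ks' (\<lambda>i. of_int (gmat B1 ks' i m)) = (\<lambda>i. of_int (unitv m i))"
      using Cons skew1 by (intro less.hyps) auto
    ultimately show ?thesis by (simp add: Cons B1_def)
  qed simp
qed

section \<open>Linearity on the cones of the fan\<close>

lemma gmuts_add:
  assumes "coherent B ks p q"
  shows "gmuts B ks (\<lambda>i. p i + q i) = (\<lambda>i. gmuts B ks p i + gmuts B ks q i)"
  using assms
proof (induction ks arbitrary: B p q)
  case (Cons k ks)
  have "gmut B k (\<lambda>i. p i + q i) = (\<lambda>i. gmut B k p i + gmut B k q i)"
    using Cons.prems by (intro ext) (auto simp: gmut_def max_def zero_le_mult_iff algebra_simps)
  with Cons show ?case by simp
qed simp

lemma gmuts_scale: "c \<ge> 0 \<Longrightarrow> gmuts B ks (\<lambda>i. c * p i) = (\<lambda>i. c * gmuts B ks p i)"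
proof (induction ks arbitrary: B p)
  case (Cons k ks)
  have "gmut B k (\<lambda>i. c * p i) = (\<lambda>i. c * gmut B k p i)"
    by (intro ext) (simp add: gmut_def max_scale[OF Cons.prems] max_scale_neg[OF Cons.prems]
      distrib_left right_diff_distrib mult.left_commute)
  with Cons show ?case by simp
qed simp

text \<open>Vectors with nonnegative images are coherent, so \<open>gmuts\<close> is additive on
  them and the sum can be built term by term. With \<open>gmat_of_gmuts\<close>, the columns of
  \<open>gmat\<close> span exactly the cone mapped to the nonnegative orthant.\<close>

theorem gmuts_gmat:
  fixes B :: "'m::finite \<Rightarrow> 'm \<Rightarrow> int"
  assumes skew: "skew_by d B" and v: "\<And>m. v m \<ge> 0"
  shows "gmuts B ks (\<lambda>i. \<Sum>m\<in>UNIV. v m * of_int (gmat B ks i m)) = v"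
proof -
  have "gmuts B ks (\<lambda>i. \<Sum>m\<in>A. v m * of_int (gmat B ks i m)) = (\<lambda>i. \<Sum>m\<in>A. v m * of_int (unitv m i))" for A
  proof (induction A rule: infinite_finite_induct)
    case (insert a A)
    let ?p = "\<lambda>i. v a * of_int (gmat B ks i a)" and ?q = "\<lambda>i. \<Sum>m\<in>A. v m * of_int (gmat B ks i m)"
    have p: "gmuts B ks ?p = (\<lambda>i. v a * of_int (unitv a i))"
      unfolding gmuts_scale[OF v] gmuts_gmat_col[OF skew] ..
    have "coherent B ks ?p ?q"
      by (rule gmuts_coherent[OF skew]) (unfold p insert.IH, auto intro!: sum_nonneg v)
    from gmuts_add[OF this] show ?case
      unfolding p insert.IH using insert.hyps by simp
  qed (use gmuts_scale[of 0 B ks "\<lambda>_. 0"] in simp_all)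
  moreover have "(\<Sum>m\<in>UNIV. v m * of_int (unitv m i)) = v i" for i
  proof -
    have "(\<Sum>m\<in>UNIV. v m * of_int (unitv m i)) = (\<Sum>m\<in>UNIV. if m = i then v m else 0)"
      by (intro sum.cong) auto
    then show ?thesis by simp
  qed
  ultimately show ?thesis by simp
qed

lemma gmuts_inj:
  assumes "skew_by d B" "gmuts B ks p = gmuts B ks q"
  shows "p = q"
proof -
  have "p = gmuts (mmuts B ks) (rev ks) (gmuts B ks p)" by (rule gmuts_rev[OF assms(1), symmetric])
  also have "\<dots> = q" unfolding assms(2) by (rule gmuts_rev[OF assms(1)])
  finally show ?thesis .
qed

lemma gmat_of_gmuts:
  fixes B :: "'m::finite \<Rightarrow> 'm \<Rightarrow> int"
  assumes "skew_by d B" "\<And>i. gmuts B ks p i \<ge> 0"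
  shows "p i = (\<Sum>m\<in>UNIV. gmuts B ks p m * of_int (gmat B ks i m))"
  by (rule fun_cong[OF gmuts_inj[OF assms(1) gmuts_gmat[OF assms(1) assms(2), symmetric]]])

subsection \<open>Frozen rows\<close>

lemma gmutZ_row:
  "gmutZ (\<lambda>i j. mmuts B ks j i) k (crow B ks y) = crow B (ks @ [k]) y"
  by (simp add: crow_append)

text \<open>By sign-coherence all unit rows follow the same linear rule at every step, and so does a
  nonnegative combination of them.\<close>

lemma crow_linear:
  fixes B :: "'m::finite \<Rightarrow> 'm \<Rightarrow> int"
  assumes skew: "skew_by d B" and y: "\<And>m. y m \<ge> 0"
  shows "crow B ks y l = (\<Sum>m\<in>UNIV. y m * cmat B ks m l)"
proof (induction ks arbitrary: l rule: rev_induct)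
  case Nil
  have "(\<Sum>m\<in>UNIV. y m * cmat B [] m l) = (\<Sum>m\<in>UNIV. if m = l then y m else 0)"
    by (intro sum.cong) (auto simp: cmat_Nil)
  then show ?case by simp
next
  case (snoc k ks)
  let ?s = "csign B ks k"
  have "?s * crow B ks y k = (\<Sum>m\<in>UNIV. y m * (?s * cmat B ks m k))"
    unfolding snoc by (simp add: sum_distrib_left ac_simps)
  also have "\<dots> \<ge> 0" by (intro sum_nonneg mult_nonneg_nonneg y csign_nonneg[OF skew])
  finally have "crow B (ks @ [k]) y l = (if l = k then - crow B ks y k else crow B ks y l + fcoef B ks k l * crow B ks y k)"
    unfolding gmutZ_row[symmetric] using gmutZ_sign[OF csign_cases, of B ks k "crow B ks y" k]
    by (simp add: fcoef_def)
  then show ?case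
    unfolding snoc by (auto simp: cmat_snoc_fcoef[OF skew] sum_negf distrib_left sum.distrib sum_distrib_left ac_simps)
qed

lemma mmuts_frozen_row: "k \<notin> set ks \<Longrightarrow> mmuts B ks k = crow B ks (B k)"
proof (induction ks arbitrary: B)
  case (Cons l ks)
  have "mmut l B k = gmutZ (\<lambda>i j. B j i) l (B k)"
    using Cons.prems by (intro ext) (auto simp: mmut_apply gmutZ_def mult.commute)
  with Cons show ?case by simp
qed simp

text \<open>While \<open>k\<close> is not mutated, its row is a nonnegative combination of the rows
  of \<open>cmat\<close>, so its entries carry the tropical sign and the coefficients
  \<open>gcoef\<close> at \<open>k\<close> vanish. This later allows a sink to be isolated.\<close>

lemma gmat_row_of_nonneg_row:
  fixes B :: "'m::finite \<Rightarrow> 'm \<Rightarrow> int"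
  assumes skew: "skew_by d B" and row: "\<And>j. B k j \<ge> 0" and "k \<notin> set ks"
  shows "gmat B ks k m = unitv m k"
  using assms(3)
proof (induction ks arbitrary: m rule: rev_induct)
  case (snoc l ks)
  have "mmuts B ks k l = (\<Sum>j\<in>UNIV. B k j * cmat B ks j l)"
    using snoc.prems by (simp add: mmuts_frozen_row crow_linear[OF skew row])
  then have "csign B ks l * mmuts B ks k l = (\<Sum>j\<in>UNIV. B k j * (csign B ks l * cmat B ks j l))"
    by (simp add: sum_distrib_left ac_simps)
  also have "\<dots> \<ge> 0" by (intro sum_nonneg mult_nonneg_nonneg row csign_nonneg[OF skew])
  finally have e: "gcoef B ks l k = 0" by (simp add: gcoef_def posp_of_nonpos)
  have "(\<Sum>r\<in>UNIV. gcoef B ks l r * gmat B ks k r) = (\<Sum>r\<in>UNIV. gcoef B ks l r * (if r = k then 1 else 0))"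
    using snoc by (intro sum.cong) auto
  then show ?case using snoc by (auto simp: sum_if_right e)
qed simp

lemma crow_Inl:
  assumes "\<And>i j. E (Inl i) (Inl j) = B i j" "\<And>i. y' (Inl i) = y i"
  shows "crow E (map Inl ks) y' (Inl i) = crow B ks y i"
  using assms
proof (induction ks arbitrary: E B y' y)
  case (Cons k ks)
  show ?case
    unfolding list.map crow.simps
    by (rule Cons.IH) (auto simp: Cons.prems gmutZ_def mmut_Inl[of E B, OF Cons.prems(1)])
qed simp

lemma crow_zero: "crow B ks (\<lambda>_. 0) = (\<lambda>_. 0)"
proof (induction ks arbitrary: B)
  case (Cons k ks)
  have "gmutZ (\<lambda>i j. B j i) k (\<lambda>_. 0) = (\<lambda>_. 0)" by (auto simp: gmutZ_def)
  with Cons show ?case by simp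
qed simp

lemma mmuts_Inl:
  assumes "\<And>i j. E (Inl i) (Inl j) = B i j"
  shows "mmuts E (map Inl ks) (Inl i) (Inl j) = mmuts B ks i j"
  using assms
proof (induction ks arbitrary: E B)
  case (Cons k ks)
  show ?case unfolding list.map mmuts.simps by (rule Cons.IH) (simp add: mmut_Inl[of E B, OF Cons.prems])
qed simp

lemma gmat_pext:
  fixes B :: "'n::finite \<Rightarrow> 'n \<Rightarrow> int"
  assumes skew: "skew_by d B"
  defines "E \<equiv> pext 1 B"
  shows "gmat E (map Inl ks) (Inl i) (Inl m) = gmat B ks i m \<and> gmat E (map Inl ks) (Inr j) (Inl m) = 0
    \<and> gmat E (map Inl ks) r (Inr j) = unitv (Inr j) r"
proof (induction ks arbitrary: i j m r rule: rev_induct)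
  case (snoc k ks)
  have EB: "E (Inl i) (Inl j) = B i j" for i j by (simp add: E_def)
  have c1: "cmat E (map Inl ks) (Inl j) (Inl k) = cmat B ks j k" for j
    unfolding cmat_def by (rule crow_Inl) (auto simp: EB)
  have c2: "cmat E (map Inl ks) (Inr j) (Inl k) = 0" for j
    unfolding cmat_def by (subst crow_Inl[of E B _ "\<lambda>_. 0"]) (auto simp: EB crow_zero)
  have cs: "csign E (map Inl ks) (Inl k) = csign B ks k"
  proof -
    have "(\<forall>r. cmat E (map Inl ks) r (Inl k) \<ge> 0) \<longleftrightarrow> (\<forall>j. cmat B ks j k \<ge> 0)"
      by (metis c1 c2 sumE order_refl)
    then show ?thesis by (simp add: csign_def)
  qed
  have row: "mmuts E (map Inl ks) (Inr j) (Inl k) = cmat B ks j k" for j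
  proof -
    have "mmuts E (map Inl ks) (Inr j) = crow E (map Inl ks) (E (Inr j))"
      by (rule mmuts_frozen_row) auto
    moreover have "crow E (map Inl ks) (E (Inr j)) (Inl k) = crow B ks (unitv j) k"
      by (rule crow_Inl) (auto simp: E_def)
    ultimately show ?thesis by (simp only: cmat_def)
  qed
  have e1: "gcoef E (map Inl ks) (Inl k) (Inl r) = gcoef B ks k r" for r
    by (simp add: gcoef_def cs mmuts_Inl[of E B, OF EB])
  have e2: "gcoef E (map Inl ks) (Inl k) (Inr j) = 0" for j
    using csign_nonneg[OF skew, of ks k j] by (simp add: gcoef_def cs row posp_of_nonpos)
  show ?case
    unfolding map_append list.map gmat_snoc sum_sum_type using snoc by (auto simp: e1 e2)
qed simp

lemma gmuts_pext:
  fixes B :: "'n::finite \<Rightarrow> 'n \<Rightarrow> int"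
  assumes skew: "skew_by d B" and nn: "\<And>i. gmuts B ks p i \<ge> 0"
  shows "gmuts (pext 1 B) (map Inl ks) (case_sum p (\<lambda>_. 0)) = case_sum (gmuts B ks p) (\<lambda>_. 0)"
proof -
  let ?v = "case_sum (gmuts B ks p) (\<lambda>_::'n. 0)"
  have "?v r \<ge> 0" for r using nn by (cases r) auto
  from gmuts_gmat[OF skew_by_pext[OF skew], of ?v 1 "map Inl ks", OF this]
  have "gmuts (pext 1 B) (map Inl ks) (\<lambda>i. \<Sum>m\<in>UNIV. ?v m * of_int (gmat (pext 1 B) (map Inl ks) i m)) = ?v" .
  moreover have "(\<lambda>r. \<Sum>m\<in>UNIV. ?v m * of_int (gmat (pext 1 B) (map Inl ks) r m)) = case_sum p (\<lambda>_. 0)"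
  proof
    fix r :: "'n + 'n"
    show "(\<Sum>m\<in>UNIV. ?v m * of_int (gmat (pext 1 B) (map Inl ks) r m)) = case_sum p (\<lambda>_. 0) r"
      using gmat_pext[OF skew, of ks] gmat_of_gmuts[OF skew nn]
      by (cases r) (simp_all add: sum_sum_type)
  qed
  ultimately show ?thesis by simp
qed

section \<open>Cluster variables are homogeneous Laurent polynomials\<close>

lemma mmuts_pext_Inr:
  fixes B :: "'n \<Rightarrow> 'n \<Rightarrow> int"
  shows "mmuts (pext 1 B) (map Inl ks) (Inr j) (Inl k) = cmat B ks j k"
proof -
  have "mmuts (pext 1 B) (map Inl ks) (Inr j) = crow (pext 1 B) (map Inl ks) (pext 1 B (Inr j))"
    by (rule mmuts_frozen_row) auto
  moreover have "crow (pext 1 B) (map Inl ks) (pext 1 B (Inr j)) (Inl k) = crow B ks (unitv j) k"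
    by (rule crow_Inl) auto
  ultimately show ?thesis by (simp only: cmat_def)
qed

lemma mmuts_pext_Inl:
  fixes B :: "'n \<Rightarrow> 'n \<Rightarrow> int"
  shows "mmuts (pext 1 B) (map Inl ks) (Inl i) (Inl k) = mmuts B ks i k"
  by (rule mmuts_Inl) simp

lemma ldot_sum_type: "ldot m x = ldot (\<lambda>i. m (Inl i)) (\<lambda>i. x (Inl i)) + ldot (\<lambda>i. m (Inr i)) (\<lambda>i. x (Inr i))"
  by (simp add: ldot_def sum_sum_type)

lemma amut_other: "i \<noteq> k \<Longrightarrow> amut B k x i = x i"
  by (simp add: amut_def)

text \<open>The constant terms of the F-polynomials do not vanish.\<close>

lemma amuts_pext_nonpos:
  fixes B :: "'n::finite \<Rightarrow> 'n \<Rightarrow> int"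
  assumes skew: "skew_by d B" and "\<And>j. \<eta> j \<le> 0"
  shows "amuts (pext 1 B) (map Inl ks) (case_sum (\<lambda>_. 0) \<eta>) = case_sum (\<lambda>_. 0) \<eta>"
proof (induction ks rule: rev_induct)
  case (snoc k ks)
  define x where "x = case_sum (\<lambda>_::'n. 0) \<eta>"
  let ?M = "mmuts (pext 1 B) (map Inl ks)"
  have le: "ldot (\<lambda>j. posp (s * cmat B ks j k)) \<eta> \<le> 0" for s
    unfolding ldot_def using assms(2) by (intro sum_nonpos mult_nonneg_nonpos) auto
  \<comment> \<open>The exchange monomial of sign opposite to the tropical one contains no frozen
    variable; its value 0 is the maximum.\<close>
  have "ldot (\<lambda>j. posp (- csign B ks k * cmat B ks j k)) \<eta> = 0"
    unfolding ldot_def using csign_nonneg[OF skew, of ks k]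
    by (intro sum.neutral) (simp add: posp_of_nonpos)
  then have "max (ldot (\<lambda>j. posp (cmat B ks j k)) \<eta>) (ldot (\<lambda>j. posp (- cmat B ks j k)) \<eta>) = 0"
    using csign_cases[of B ks k] le[of 1] le[of "-1"] by auto
  moreover have "ldot (\<lambda>i. 0) (\<lambda>i. 0) = 0" "ldot m (\<lambda>i. 0) = 0" for m :: "'n \<Rightarrow> int"
    by (simp_all add: ldot_def)
  ultimately have "amut ?M (Inl k) x (Inl k) = 0"
    unfolding amut_def by (simp add: ldot_sum_type mmuts_pext_Inr x_def)
  then have "amut ?M (Inl k) x r = x r" for r
    by (cases "r = Inl k") (auto simp: amut_other x_def)
  then have "amut ?M (Inl k) x = x" by (rule ext)
  then show ?case using snoc by (simp add: amuts_append x_def)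
qed simp

text \<open>The point \<open>u []\<close> is the \<open>a\<close>-th component of the grading, and
  translation along it corresponds to rescaling each variable by its degree. This is the tropical
  form of homogeneity, with degrees \<open>gmat\<close>.\<close>

lemma amuts_pext_grading:
  fixes B :: "'n::finite \<Rightarrow> 'n \<Rightarrow> int" and a :: 'n
  assumes skew: "skew_by d B"
  defines "u \<equiv> (\<lambda>ks. case_sum (\<lambda>i. of_int (gmat B ks a i)) (\<lambda>j. - of_int (B a j)) :: 'n + 'n \<Rightarrow> real)"
  shows "amuts (pext 1 B) (map Inl ks) (\<lambda>r. x r + s * u [] r) = (\<lambda>r. amuts (pext 1 B) (map Inl ks) x r + s * u ks r)"
proof (induction ks rule: rev_induct)
  case (snoc k ks)
  define M where "M = mmuts (pext 1 B) (map Inl ks)"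
  define y where "y = amuts (pext 1 B) (map Inl ks) x"
  have lin: "ldot m (\<lambda>r. y r + s * u ks r) = ldot m y + s * ldot m (u ks)" for m
    by (simp add: ldot_def sum.distrib sum_distrib_left algebra_simps)
  define D where "D = (\<lambda>\<epsilon>. (\<Sum>i\<in>UNIV. posp (\<epsilon> * mmuts B ks i k) * gmat B ks a i) - (\<Sum>j\<in>UNIV. B a j * posp (\<epsilon> * cmat B ks j k)))"
  have dm: "ldot (\<lambda>r. posp (\<epsilon> * M r (Inl k))) (u ks) = of_int (D \<epsilon>)" for \<epsilon>
    unfolding ldot_sum_type
    by (simp add: ldot_def M_def mmuts_pext_Inr mmuts_pext_Inl u_def D_def sum_negf mult.commute)
  \<comment> \<open>The two monomials of the exchange relation have equal degree, by
    \<open>gmat_mult_mmuts\<close>, so the maximum is shifted by a common constant.\<close>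
  have "D 1 - D (-1) = (\<Sum>i\<in>UNIV. mmuts B ks i k * gmat B ks a i) - (\<Sum>j\<in>UNIV. B a j * cmat B ks j k)"
  proof -
    have "D 1 - D (-1) = (\<Sum>i\<in>UNIV. (posp (mmuts B ks i k) - posp (- mmuts B ks i k)) * gmat B ks a i)
       - (\<Sum>j\<in>UNIV. B a j * (posp (cmat B ks j k) - posp (- cmat B ks j k)))"
      unfolding D_def by (simp add: left_diff_distrib right_diff_distrib sum_subtractf)
    then show ?thesis unfolding posp_diff .
  qed
  also have "\<dots> = 0"
    using gmat_mult_mmuts[OF skew, of ks a k] by (simp add: mult.commute)
  finally have DD: "D 1 = D (-1)" by simp
  have "D (- csign B ks k) = (\<Sum>i\<in>UNIV. gcoef B ks k i * gmat B ks a i)"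
    unfolding D_def gcoef_def using csign_nonneg[OF skew, of ks k] by (simp add: posp_of_nonpos)
  then have Dg: "D 1 = (\<Sum>i\<in>UNIV. gcoef B ks k i * gmat B ks a i)"
    using csign_cases[of B ks k] DD by auto
  have e1: "ldot (\<lambda>r. posp (M r (Inl k))) (u ks) = of_int (D 1)"
    and e2: "ldot (\<lambda>r. posp (- M r (Inl k))) (u ks) = of_int (D 1)"
    using dm[of 1] dm[of "-1"] DD by simp_all
  have mx: "max (p + c) (q + c) = max p q + c" for p q c :: real by (simp add: max_def)
  have "amut M (Inl k) (\<lambda>r. y r + s * u ks r) = (\<lambda>r. amut M (Inl k) y r + s * u (ks @ [k]) r)"
  proof
    fix r
    show "amut M (Inl k) (\<lambda>r. y r + s * u ks r) r = amut M (Inl k) y r + s * u (ks @ [k]) r"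
    proof (cases "r = Inl k")
      case True
      have e3: "of_int (D 1) = u ks (Inl k) + u (ks @ [k]) (Inl k)" by (simp add: u_def Dg)
      show ?thesis
        unfolding True amut_def lin e1 e2 mx e3 by (simp add: algebra_simps)
    next
      case False
      then have "u (ks @ [k]) r = u ks r" by (cases r) (auto simp: u_def)
      then show ?thesis using False by (simp add: amut_other)
    qed
  qed
  then show ?case using snoc by (simp add: amuts_append M_def y_def)
qed simp

text \<open>\<open>amuts\<close> bounds every exponent in every direction. The negated frozen unit
  vectors give nonnegative exponents of the \<open>y\<close> variables; along \<open>u []\<close>
  the bound is affine for all real \<open>s\<close>, which fixes the degree of each
  monomial.\<close>

lemma cluster_laurent:
  fixes B :: "'n::finite \<Rightarrow> 'n \<Rightarrow> int"
  assumes skew: "skew_by d B"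
  shows "\<exists>p. (\<forall>z. (\<forall>r. z r > 0) \<longrightarrow> pmuts (pext 1 B) (map Inl ks) z (Inl i) = lev z p) \<and> p \<noteq> 0
    \<and> (\<forall>m\<in>Poly_Mapping.keys p. \<forall>j. m (Inr j) \<ge> 0)
    \<and> (\<forall>m\<in>Poly_Mapping.keys p. \<forall>a. m (Inl a) - (\<Sum>j\<in>UNIV. B a j * m (Inr j)) = gmat B ks a i)"
proof -
  let ?E = "pext 1 B"
  have good: "good (range Inl) (case_sum d d) ?E" by (rule good_pext[OF skew]) simp
  have "laurent_fun (\<lambda>z. pmuts ?E (map Inl ks) z (Inl i))"
    using good by (intro laurent_phenomenon[of "case_sum d d" _ "range Inl"]) (auto simp: good_def)
  then obtain p where p: "\<And>z. (\<And>r. z r > 0) \<Longrightarrow> pmuts ?E (map Inl ks) z (Inl i) = lev z p"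
    unfolding laurent_fun_def by blast
  have le: "ldot m x \<le> amuts ?E (map Inl ks) x (Inl i)" if "m \<in> Poly_Mapping.keys p" for m x
    using key_le_amuts[of ?E "map Inl ks" "Inl i" p, OF p that] .
  show ?thesis
  proof (intro exI[of _ p] conjI allI impI ballI)
    fix z :: "'n + 'n \<Rightarrow> real" assume "\<forall>r. z r > 0"
    then show "pmuts ?E (map Inl ks) z (Inl i) = lev z p" using p by blast
  next
    fix m j assume m: "m \<in> Poly_Mapping.keys p"
    define \<eta> where "\<eta> = (\<lambda>j' :: 'n. if j' = j then -1 else 0 :: real)"
    have "ldot m (case_sum (\<lambda>_. 0) \<eta>) = (\<Sum>j'\<in>UNIV. if j' = j then - of_int (m (Inr j)) else 0)"
      unfolding ldot_def sum_sum_type \<eta>_def by (simp add: if_distrib cong: if_cong)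
    then have "- of_int (m (Inr j)) = ldot m (case_sum (\<lambda>_. 0) \<eta>)" by simp
    also have "\<dots> \<le> amuts ?E (map Inl ks) (case_sum (\<lambda>_. 0) \<eta>) (Inl i)" by (rule le[OF m])
    also have "\<dots> = 0"
      using amuts_pext_nonpos[OF skew, of \<eta> ks] by (simp add: \<eta>_def)
    finally show "m (Inr j) \<ge> 0" by simp
  next
    fix m a assume m: "m \<in> Poly_Mapping.keys p"
    define u where "u = (\<lambda>ks. case_sum (\<lambda>i. of_int (gmat B ks a i)) (\<lambda>j. - of_int (B a j)) :: 'n + 'n \<Rightarrow> real)"
    have bound: "s * ldot m (u []) \<le> amuts ?E (map Inl ks) (\<lambda>_. 0) (Inl i) + s * of_int (gmat B ks a i)" for s
    proof -
      have "s * ldot m (u []) = ldot m (\<lambda>r. (\<lambda>_. 0) r + s * u [] r)"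
        by (simp add: ldot_scale)
      also have "\<dots> \<le> amuts ?E (map Inl ks) (\<lambda>r. (\<lambda>_. 0) r + s * u [] r) (Inl i)"
        by (rule le[OF m])
      also have "\<dots> = amuts ?E (map Inl ks) (\<lambda>_. 0) (Inl i) + s * of_int (gmat B ks a i)"
        unfolding u_def amuts_pext_grading[OF skew] by simp
      finally show ?thesis .
    qed
    have "ldot m (u []) \<le> of_int (gmat B ks a i)"
      by (rule le_of_linear_bound[of 0]) (rule bound)
    moreover have "- ldot m (u []) \<le> - of_int (gmat B ks a i)"
      by (rule le_of_linear_bound[of 0 _ "amuts ?E (map Inl ks) (\<lambda>_. 0) (Inl i)"])
        (use bound[of "- s" for s] in \<open>simp\<close>)
    moreover have "ldot m (u []) = of_int (m (Inl a) - (\<Sum>j\<in>UNIV. B a j * m (Inr j)))"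
    proof -
      have "(\<Sum>i\<in>UNIV. of_int (m (Inl i)) * u [] (Inl i)) = (\<Sum>i\<in>UNIV. if i = a then of_int (m (Inl i)) else 0)"
        by (intro sum.cong) (auto simp: u_def)
      then show ?thesis unfolding ldot_def sum_sum_type by (simp add: u_def sum_negf mult.commute)
    qed
    ultimately show "m (Inl a) - (\<Sum>j\<in>UNIV. B a j * m (Inr j)) = gmat B ks a i" by linarith
  next
    show "p \<noteq> 0" by (rule laurent_nonzero[of ?E "map Inl ks" "Inl i" p, OF p])
  qed
qed

subsection \<open>Evaluation in the field of rational functions\<close>

definition rcst :: "rat \<Rightarrow> ratfun" where
  "rcst c = Fract (Poly_Mapping.single 0 c) 1"

definition rmon :: "('n::finite + 'n \<Rightarrow> int) \<Rightarrow> ratfun" where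
  "rmon m = (\<Prod>r\<in>UNIV. xvar r powi m r)"

definition rlev :: "('n::finite + 'n) laurent \<Rightarrow> ratfun" where
  "rlev p = (\<Sum>m\<in>Poly_Mapping.keys p. rcst (Poly_Mapping.lookup p m) * rmon m)"

lemma Fract_1_eq_iff: "Fract p 1 = Fract q 1 \<longleftrightarrow> p = (q :: 'a :: idom)"
  by (simp add: eq_fract)

lemma rcst_add: "rcst (a + b) = rcst a + rcst b"
  by (simp add: rcst_def single_add)

lemma rcst_mult: "rcst (a * b) = rcst a * rcst b"
  by (simp add: rcst_def mult_single)

lemma rcst_0 [simp]: "rcst 0 = 0"
  by (simp add: rcst_def Zero_fract_def)

lemma rcst_1 [simp]: "rcst 1 = 1"
  by (simp add: rcst_def One_fract_def)

lemma xvar_nonzero: "xvar r \<noteq> 0"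
proof -
  have "Poly_Mapping.single (Poly_Mapping.single (to_nat r) (1::nat)) (1::rat) \<noteq> 0"
    by (metis lookup_single_eq lookup_zero one_neq_zero)
  then show ?thesis unfolding xvar_def Zero_fract_def Fract_1_eq_iff .
qed

lemma rmon_add: "rmon (m + n) = rmon m * rmon n"
  unfolding rmon_def prod.distrib[symmetric]
  by (intro prod.cong) (auto simp: power_int_add xvar_nonzero)

lemma rmon_unitv: "rmon (unitv r) = xvar r"
proof -
  have "(\<Prod>i\<in>UNIV. xvar i powi unitv r i) = (\<Prod>i\<in>UNIV. if i = r then xvar i else 1)"
    by (intro prod.cong) auto
  then show ?thesis by (simp add: rmon_def)
qed

lemma rlev_superset:
  assumes "finite A" "Poly_Mapping.keys p \<subseteq> A"
  shows "rlev p = (\<Sum>m\<in>A. rcst (Poly_Mapping.lookup p m) * rmon m)"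
  unfolding rlev_def using assms by (intro sum.mono_neutral_left) (auto simp: in_keys_iff)

lemma rlev_add: "rlev (p + q) = rlev p + rlev q"
proof -
  let ?A = "Poly_Mapping.keys p \<union> Poly_Mapping.keys q"
  have "rlev (p + q) = (\<Sum>m\<in>?A. rcst (Poly_Mapping.lookup (p + q) m) * rmon m)"
    by (rule rlev_superset) (auto simp: Poly_Mapping.keys_add)
  also have "\<dots> = (\<Sum>m\<in>?A. rcst (Poly_Mapping.lookup p m) * rmon m) + (\<Sum>m\<in>?A. rcst (Poly_Mapping.lookup q m) * rmon m)"
    by (simp add: lookup_add rcst_add distrib_right sum.distrib)
  also have "\<dots> = rlev p + rlev q"
    by (simp add: rlev_superset[of ?A p] rlev_superset[of ?A q])
  finally show ?thesis .
qed

lemma rlev_zero [simp]: "rlev 0 = 0"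
  unfolding rlev_def by simp

lemma rlev_single: "rlev (Poly_Mapping.single m c) = rcst c * rmon m"
  unfolding rlev_def by simp

lemma rlev_one: "rlev 1 = 1"
  unfolding single_one[symmetric] rlev_single by (simp add: rmon_def)

lemma rlev_sum: "rlev (sum f A) = (\<Sum>a\<in>A. rlev (f a))"
  by (induction A rule: infinite_finite_induct) (auto simp: rlev_add)

lemma rlev_mult: "rlev (p * q) = rlev p * rlev q"
proof -
  have "p * q = (\<Sum>m\<in>Poly_Mapping.keys p. \<Sum>n\<in>Poly_Mapping.keys q.
     Poly_Mapping.single (m + n) (Poly_Mapping.lookup p m * Poly_Mapping.lookup q n))"
    unfolding mult_single[symmetric] sum_product[symmetric] poly_mapping_sum_singles[symmetric] ..
  then have "rlev (p * q) = (\<Sum>m\<in>Poly_Mapping.keys p. \<Sum>n\<in>Poly_Mapping.keys q.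
     rcst (Poly_Mapping.lookup p m * Poly_Mapping.lookup q n) * rmon (m + n))"
    by (simp add: rlev_sum rlev_single)
  also have "\<dots> = rlev p * rlev q"
    unfolding rlev_def sum_product
    by (intro sum.cong refl) (simp add: rmon_add rcst_mult)
  finally show ?thesis .
qed

lemma rlev_power: "rlev (p ^ n) = rlev p ^ n"
  by (induction n) (auto simp: rlev_one rlev_mult)

lemma rlev_prod: "rlev (prod f A) = (\<Prod>a\<in>A. rlev (f a))"
  by (induction A rule: infinite_finite_induct) (auto simp: rlev_one rlev_mult)

definition xden :: "('n::finite \<Rightarrow> nat) \<Rightarrow> nat \<Rightarrow>\<^sub>0 nat" where
  "xden a = (\<Sum>i\<in>UNIV. Poly_Mapping.single (to_nat (Inl i :: 'n + 'n)) (a i))"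

definition expo :: "('n::finite \<Rightarrow> nat) \<Rightarrow> ('n + 'n \<Rightarrow> int) \<Rightarrow> nat \<Rightarrow>\<^sub>0 nat" where
  "expo a m = (\<Sum>r\<in>UNIV. Poly_Mapping.single (to_nat r) (nat (m r + case_sum (\<lambda>i. int (a i)) (\<lambda>_. 0) r)))"

lemma lookup_expo: "Poly_Mapping.lookup (expo a m) (to_nat r) = nat (m r + case_sum (\<lambda>i. int (a i)) (\<lambda>_. 0) r)"
proof -
  have "Poly_Mapping.lookup (expo a m) (to_nat r)
    = (\<Sum>r'\<in>UNIV. if r' = r then nat (m r' + case_sum (\<lambda>i. int (a i)) (\<lambda>_. 0) r') else 0)"
    unfolding expo_def lookup_sum by (intro sum.cong) (auto simp: lookup_single when_def)
  then show ?thesis by simp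
qed

lemma keys_expo: "Poly_Mapping.keys (expo (a :: 'n::finite \<Rightarrow> nat) m) \<subseteq> range (to_nat :: 'n + 'n \<Rightarrow> nat)"
  unfolding expo_def by (rule order_trans[OF keys_sum]) auto

lemma lookup_xden_Inl: "Poly_Mapping.lookup (xden a) (to_nat (Inl i :: 'n::finite + 'n)) = a i"
proof -
  have "Poly_Mapping.lookup (xden a) (to_nat (Inl i :: 'n + 'n)) = (\<Sum>i'\<in>UNIV. if i' = i then a i' else 0)"
    unfolding xden_def lookup_sum by (intro sum.cong) (auto simp: lookup_single when_def)
  then show ?thesis by simp
qed

lemma lookup_xden_Inr: "Poly_Mapping.lookup (xden (a :: 'n \<Rightarrow> nat)) (to_nat (Inr i :: 'n::finite + 'n)) = 0"
  unfolding xden_def lookup_sum by (intro sum.neutral) (auto simp: lookup_single when_def)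

lemma xvar_power: "xvar r ^ n = Fract (Poly_Mapping.single (Poly_Mapping.single (to_nat r) n) 1) 1"
proof (induction n)
  case 0
  then show ?case by (simp add: One_fract_def)
next
  case (Suc n)
  then show ?case by (simp add: xvar_def mult_single single_add[symmetric])
qed

lemma Fract_single_prod:
  "(\<Prod>a\<in>A. Fract (Poly_Mapping.single (f a) 1) 1) = Fract (Poly_Mapping.single (\<Sum>a\<in>A. f a :: nat \<Rightarrow>\<^sub>0 nat) (1::rat)) 1"
  by (induction A rule: infinite_finite_induct) (auto simp: One_fract_def mult_single)

lemma rmon_expo:
  fixes a :: "'n::finite \<Rightarrow> nat"
  assumes "\<And>r. m r + case_sum (\<lambda>i. int (a i)) (\<lambda>_. 0) r \<ge> 0"
  shows "rmon m * Fract (Poly_Mapping.single (xden a) 1) 1 = Fract (Poly_Mapping.single (expo a m) 1) 1"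
proof -
  define c where "c = case_sum a (\<lambda>_::'n. 0::nat)"
  have c: "case_sum (\<lambda>i. int (a i)) (\<lambda>_. 0) r = int (c r)" for r
    by (cases r) (auto simp: c_def)
  have "xden a = (\<Sum>r\<in>UNIV. Poly_Mapping.single (to_nat r) (c r))"
    unfolding xden_def sum_sum_type by (simp add: c_def)
  then have D: "Fract (Poly_Mapping.single (xden a) 1) 1 = (\<Prod>r\<in>UNIV. xvar r ^ c r)"
    unfolding xvar_power Fract_single_prod by simp
  have "rmon m * (\<Prod>r\<in>UNIV. xvar r ^ c r) = (\<Prod>r\<in>UNIV. xvar r ^ nat (m r + int (c r)))"
    unfolding rmon_def prod.distrib[symmetric]
  proof (intro prod.cong refl)
    fix r :: "'n + 'n"
    have "xvar r powi m r * xvar r ^ c r = xvar r powi (m r + int (c r))"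
      by (simp add: power_int_add xvar_nonzero)
    also have "\<dots> = xvar r ^ nat (m r + int (c r))"
      using assms[of r] by (simp add: power_int_def c)
    finally show "xvar r powi m r * xvar r ^ c r = xvar r ^ nat (m r + int (c r))" .
  qed
  then show ?thesis
    unfolding D xvar_power Fract_single_prod expo_def c .
qed

lemma single_one_nonzero: "Poly_Mapping.single e (1::rat) \<noteq> 0"
  by (metis lookup_single_eq lookup_zero one_neq_zero)

text \<open>The denominator in the \<open>x\<close> variables is large enough for all monomials;
  \<open>expo a\<close> is injective on the exponents of \<open>p\<close>, so no coefficients merge
  and the numerator is nonzero.\<close>

lemma homog_rlev:
  fixes B :: "'n::finite \<Rightarrow> 'n \<Rightarrow> int"
  assumes y: "\<And>m j. m \<in> Poly_Mapping.keys p \<Longrightarrow> m (Inr j) \<ge> 0"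
    and g: "\<And>m a. m \<in> Poly_Mapping.keys p \<Longrightarrow> m (Inl a) - (\<Sum>j\<in>UNIV. B a j * m (Inr j)) = g a"
    and p0: "p \<noteq> 0"
  shows "homog B (rlev p) g"
proof -
  let ?K = "Poly_Mapping.keys p"
  define a where "a = (\<lambda>i. \<Sum>m\<in>?K. nat \<bar>m (Inl i)\<bar>)"
  have nn: "m r + case_sum (\<lambda>i. int (a i)) (\<lambda>_. 0) r \<ge> 0" if "m \<in> ?K" for m r
  proof (cases r)
    case (Inl i)
    have "nat \<bar>m (Inl i)\<bar> \<le> a i" unfolding a_def using that by (intro member_le_sum) auto
    then show ?thesis by (simp add: Inl)
  qed (use y[OF that] in auto)
  define q :: qpoly where "q = (\<Sum>m\<in>?K. Poly_Mapping.single (expo a m) (Poly_Mapping.lookup p m))"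
  have inj: "m = m'" if "m \<in> ?K" "m' \<in> ?K" "expo a m = expo a m'" for m m'
  proof
    fix r
    show "m r = m' r"
      using arg_cong[OF that(3), of "\<lambda>e. Poly_Mapping.lookup e (to_nat r)"] nn[OF that(1), of r] nn[OF that(2), of r]
      by (simp add: lookup_expo)
  qed
  have lq: "Poly_Mapping.lookup q (expo a m) = Poly_Mapping.lookup p m" if "m \<in> ?K" for m
  proof -
    have "Poly_Mapping.lookup q (expo a m) = (\<Sum>m'\<in>?K. if m' = m then Poly_Mapping.lookup p m' else 0)"
      unfolding q_def lookup_sum using inj that
      by (intro sum.cong) (auto simp: lookup_single when_def)
    then show ?thesis using that by simp
  qed
  obtain m0 where m0: "m0 \<in> ?K" using p0 by fastforce
  then have "Poly_Mapping.lookup q (expo a m0) \<noteq> 0" using lq by (simp add: in_keys_iff)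
  then have q0: "q \<noteq> 0" by auto
  have "rlev p * Fract (Poly_Mapping.single (xden a) 1) 1 = Fract q 1"
  proof -
    have "rlev p * Fract (Poly_Mapping.single (xden a) 1) 1
        = (\<Sum>m\<in>?K. rcst (Poly_Mapping.lookup p m) * Fract (Poly_Mapping.single (expo a m) 1) 1)"
      unfolding rlev_def sum_distrib_right using nn by (intro sum.cong) (auto simp: mult.assoc rmon_expo)
    also have "\<dots> = (\<Sum>m\<in>?K. Fract (Poly_Mapping.single (expo a m) (Poly_Mapping.lookup p m)) 1)"
      by (simp add: rcst_def mult_single)
    also have "\<dots> = Fract q 1"
    proof -
      have "(\<Sum>m\<in>A. Fract (f m) 1) = Fract (sum f A :: qpoly) 1" for f and A :: "('n + 'n \<Rightarrow> int) set"
        by (induction A rule: infinite_finite_induct) (auto simp: Zero_fract_def)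
      then show ?thesis unfolding q_def by simp
    qed
    finally show ?thesis .
  qed
  moreover have "Fract q (Poly_Mapping.single (xden a) 1) * Fract (Poly_Mapping.single (xden a) 1) 1 = Fract q 1"
    by (simp add: eq_fract single_one_nonzero)
  moreover have "Fract (Poly_Mapping.single (xden a) (1::rat)) 1 \<noteq> 0"
    unfolding Zero_fract_def Fract_1_eq_iff by (rule single_one_nonzero)
  ultimately have eq: "rlev p = Fract q (Poly_Mapping.single (xden a) 1)"
    by (metis mult_right_cancel)
  have keys: "\<exists>m'\<in>?K. e = expo a m'" if "e \<in> Poly_Mapping.keys q" for e
  proof -
    have "Poly_Mapping.keys q \<subseteq> (\<Union>m\<in>?K. Poly_Mapping.keys (Poly_Mapping.single (expo a m) (Poly_Mapping.lookup p m)))"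
      unfolding q_def by (rule keys_sum)
    then show ?thesis using that by (force split: if_splits)
  qed
  have deg: "Poly_Mapping.keys e \<subseteq> range (to_nat :: 'n + 'n \<Rightarrow> nat)
        \<and> (\<forall>i. int (Poly_Mapping.lookup e (to_nat (Inl i :: 'n + 'n)))
               - (\<Sum>j\<in>UNIV. B i j * int (Poly_Mapping.lookup e (to_nat (Inr j :: 'n + 'n))))
               - int (a i) = g i)" if "e \<in> Poly_Mapping.keys q" for e
  proof -
    obtain m where m: "m \<in> ?K" "e = expo a m" using keys \<open>e \<in> Poly_Mapping.keys q\<close> by blast
    have "int (Poly_Mapping.lookup e (to_nat (Inl i :: 'n + 'n))) = m (Inl i) + int (a i)"
      "int (Poly_Mapping.lookup e (to_nat (Inr i :: 'n + 'n))) = m (Inr i)" for i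
      using nn[OF m(1), of "Inl i"] nn[OF m(1), of "Inr i"] by (simp_all add: m(2) lookup_expo)
    then show ?thesis using g[OF m(1)] keys_expo[of a m] by (simp add: m(2))
  qed
  show ?thesis
    unfolding homog_def
    by (rule exI[of _ q], rule exI[of _ a]) (use q0 eq deg in \<open>simp add: xden_def\<close>)
qed

lemma keys_times_single:
  fixes p :: qpoly
  shows "Poly_Mapping.keys (p * Poly_Mapping.single e 1) = (\<lambda>k. k + e) ` Poly_Mapping.keys p"
proof -
  have "p * Poly_Mapping.single e 1 = (\<Sum>k\<in>Poly_Mapping.keys p. Poly_Mapping.single (k + e) (Poly_Mapping.lookup p k))"
    by (subst (1) poly_mapping_sum_singles) (simp add: sum_distrib_right mult_single)
  then have l: "Poly_Mapping.lookup (p * Poly_Mapping.single e 1) (k0 + e) = Poly_Mapping.lookup p k0" for k0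
    by (simp add: lookup_sum lookup_single when_def in_keys_iff)
  show ?thesis
  proof
    show "Poly_Mapping.keys (p * Poly_Mapping.single e 1) \<subseteq> (\<lambda>k. k + e) ` Poly_Mapping.keys p"
      using Poly_Mapping.keys_mult[of p "Poly_Mapping.single e 1"] by auto
    show "(\<lambda>k. k + e) ` Poly_Mapping.keys p \<subseteq> Poly_Mapping.keys (p * Poly_Mapping.single e 1)"
      by (auto simp: in_keys_iff l)
  qed
qed

text \<open>\<open>gfan_support\<close> quantifies over all degrees, so uniqueness is needed to
  identify them. After cross multiplication each monomial of one numerator matches one of the other,
  and comparing the two gives the degree.\<close>

lemma homog_unique:
  fixes B :: "'n::finite \<Rightarrow> 'n \<Rightarrow> int"
  assumes "homog B f g" "homog B f g'"
  shows "g = g'"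
proof
  fix i
  obtain p a where p: "p \<noteq> 0" "f = Fract p (Poly_Mapping.single (xden a) 1)"
    "\<And>m i. m \<in> Poly_Mapping.keys p \<Longrightarrow> int (Poly_Mapping.lookup m (to_nat (Inl i :: 'n + 'n)))
       - (\<Sum>j\<in>UNIV. B i j * int (Poly_Mapping.lookup m (to_nat (Inr j :: 'n + 'n)))) - int (a i) = g i"
    using assms(1) unfolding homog_def xden_def by blast
  obtain p' a' where p': "p' \<noteq> 0" "f = Fract p' (Poly_Mapping.single (xden a') 1)"
    "\<And>m i. m \<in> Poly_Mapping.keys p' \<Longrightarrow> int (Poly_Mapping.lookup m (to_nat (Inl i :: 'n + 'n)))
       - (\<Sum>j\<in>UNIV. B i j * int (Poly_Mapping.lookup m (to_nat (Inr j :: 'n + 'n)))) - int (a' i) = g' i"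
    using assms(2) unfolding homog_def xden_def by blast
  have eq: "p * Poly_Mapping.single (xden a') 1 = p' * Poly_Mapping.single (xden a) 1"
    using p(2) p'(2) by (simp add: eq_fract single_one_nonzero)
  obtain k where k: "k \<in> Poly_Mapping.keys p" using p(1) by fastforce
  then have "k + xden a' \<in> Poly_Mapping.keys (p' * Poly_Mapping.single (xden a) 1)"
    unfolding eq[symmetric] keys_times_single by blast
  then obtain k' where k': "k' \<in> Poly_Mapping.keys p'" "k + xden a' = k' + xden a"
    unfolding keys_times_single by auto
  have l: "Poly_Mapping.lookup k x + Poly_Mapping.lookup (xden a') x = Poly_Mapping.lookup k' x + Poly_Mapping.lookup (xden a) x" for x
    using arg_cong[OF k'(2), of "\<lambda>e. Poly_Mapping.lookup e x"] by (simp add: lookup_add)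
  have "Poly_Mapping.lookup k (to_nat (Inr j :: 'n + 'n)) = Poly_Mapping.lookup k' (to_nat (Inr j :: 'n + 'n))" for j
    using l[of "to_nat (Inr j :: 'n + 'n)"] by (simp add: lookup_xden_Inr)
  then show "g i = g' i"
    using p(3)[OF k, of i] p'(3)[OF k'(1), of i] l[of "to_nat (Inl i :: 'n + 'n)"]
    by (simp add: lookup_xden_Inl)
qed

lemma seed_matrix:
  "snd (foldl (\<lambda>s k. seed_mut k s) (init_seed B) ks) = (\<lambda>r k. mmuts (pext 1 B) (map Inl ks) r (Inl k))"
proof (induction ks rule: rev_induct)
  case Nil
  show ?case by (intro ext) (simp add: init_seed_def principal_ext_def pext_def split: sum.split)
next
  case (snoc k ks)
  let ?s = "foldl (\<lambda>s k. seed_mut k s) (init_seed B) ks"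
  have "snd (seed_mut k ?s) = mat_mut Inl k (snd ?s)" by (simp add: seed_mut_def)
  also have "\<dots> = (\<lambda>r j. mmut (Inl k) (mmuts (pext 1 B) (map Inl ks)) r (Inl j))"
    unfolding snoc by (intro ext) (simp add: mat_mut_def)
  finally show ?case by (simp add: mmuts_append)
qed

text \<open>The exchange relation is checked at positive reals, becomes an identity of Laurent
  polynomials by \<open>lev_inject\<close>, and is transported to the ambient field by the ring
  homomorphism \<open>rlev\<close>.\<close>

theorem homog_cluster:
  fixes B :: "'n::finite \<Rightarrow> 'n \<Rightarrow> int"
  assumes skew: "skew_by d B"
  shows "homog B (cluster B ks i) (\<lambda>a. gmat B ks a i)"
proof -
  let ?E = "pext 1 B"
  have pos: "\<And>r. pmuts ?E ks z r > 0" if "\<And>r. z r > 0" for ks and z :: "'n + 'n \<Rightarrow> real"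
    using that by (rule pmuts_pos)
  have frozen: "pmuts ?E (map Inl ks) z (Inr j) = z (Inr j)" for ks z j
  proof -
    have "pmuts F (map Inl ks) z (Inr j) = z (Inr j)" for F :: "'n + 'n \<Rightarrow> 'n + 'n \<Rightarrow> int"
      by (induction ks arbitrary: F z) (auto simp: pmut_def)
    then show ?thesis .
  qed
  have pmuts_append: "pmuts F (ks @ ls) z = pmuts (mmuts F ks) ls (pmuts F ks z)" for F :: "'n + 'n \<Rightarrow> 'n + 'n \<Rightarrow> int" and ks ls z
    by (induction ks arbitrary: F z) auto
  have "\<exists>p. (\<forall>z. (\<forall>r. z r > 0) \<longrightarrow> pmuts ?E (map Inl ks) z (Inl i) = lev z p)
      \<and> p \<noteq> 0 \<and> homog B (rlev p) (\<lambda>a. gmat B ks a i)" for ks i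
  proof -
    obtain p where p: "\<forall>z. (\<forall>r. z r > 0) \<longrightarrow> pmuts ?E (map Inl ks) z (Inl i) = lev z p" "p \<noteq> 0"
      "\<forall>m\<in>Poly_Mapping.keys p. \<forall>j. m (Inr j) \<ge> 0"
      "\<forall>m\<in>Poly_Mapping.keys p. \<forall>a. m (Inl a) - (\<Sum>j\<in>UNIV. B a j * m (Inr j)) = gmat B ks a i"
      using cluster_laurent[OF skew, of ks i] by (elim exE conjE)
    have "homog B (rlev p) (\<lambda>a. gmat B ks a i)"
      by (rule homog_rlev) (use p in auto)
    with p show ?thesis by (intro exI[of _ p] conjI)
  qed
  note ex = this
  define lp where "lp = (\<lambda>ks i. SOME p. (\<forall>z. (\<forall>r. z r > 0) \<longrightarrow> pmuts ?E (map Inl ks) z (Inl i) = lev z p)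
      \<and> p \<noteq> 0 \<and> homog B (rlev p) (\<lambda>a. gmat B ks a i))"
  have l': "(\<forall>z. (\<forall>r. z r > 0) \<longrightarrow> pmuts ?E (map Inl ks) z (Inl i) = lev z (lp ks i))
      \<and> lp ks i \<noteq> 0 \<and> homog B (rlev (lp ks i)) (\<lambda>a. gmat B ks a i)" for ks i
    unfolding lp_def using ex[of ks i] by (rule someI_ex)
  then have l: "\<And>ks i z. (\<And>r. z r > 0) \<Longrightarrow> pmuts ?E (map Inl ks) z (Inl i) = lev z (lp ks i)"
    and lh: "\<And>ks i. homog B (rlev (lp ks i)) (\<lambda>a. gmat B ks a i)" by (simp_all only: simp_thms)
  have rl0: "rlev (lp ks i) \<noteq> 0" for ks i
  proof -
    obtain q e where "q \<noteq> 0" "rlev (lp ks i) = Fract q (Poly_Mapping.single e (1::rat))"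
      using lh[of ks i] unfolding homog_def by blast
    then show ?thesis by (simp add: Zero_fract_def eq_fract single_one_nonzero)
  qed
  define L where "L = (\<lambda>ks. case_sum (lp ks) (\<lambda>j. lmon (unitv (Inr j))))"
  have L: "pmuts ?E (map Inl ks) z r = lev z (L ks r)" if "\<And>r. z r > 0" for ks z r
    by (cases r) (auto simp: L_def l that frozen pw_unitv)
  have "cluster B ks i = rlev (lp ks i)"
  proof (induction ks arbitrary: i rule: rev_induct)
    case Nil
    have "lp [] i = lmon (unitv (Inl i))"
    proof (rule lev_inject)
      fix z :: "'n + 'n \<Rightarrow> real" assume "\<And>r. z r > 0"
      then show "lev z (lp [] i) = lev z (lmon (unitv (Inl i)))"
        using l[of z "[]" i] by (simp add: pw_unitv)
    qed
    then show ?case by (simp add: cluster_def init_seed_def rlev_single rmon_unitv)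
  next
    case (snoc k ks)
    let ?M = "mmuts ?E (map Inl ks)"
    define s where "s = foldl (\<lambda>s k. seed_mut k s) (init_seed B) ks"
    have fs: "fst s i = rlev (lp ks i)" for i using snoc unfolding cluster_def s_def by simp
    have sv: "seed_var s r = rlev (L ks r)" for r
      by (cases r) (auto simp: seed_var_def fs L_def rlev_single rmon_unitv)
    have ss: "snd s r k = ?M r (Inl k)" for r unfolding s_def seed_matrix by simp
    have cs: "cluster B (ks @ [k]) i = fst (seed_mut k s) i" by (simp add: cluster_def s_def)
    show ?case
    proof (cases "i = k")
      case False
      have "lp (ks @ [k]) i = lp ks i"
      proof (rule lev_inject)
        fix z :: "'n + 'n \<Rightarrow> real" assume z: "\<And>r. z r > 0"
        have "pmuts ?E (map Inl (ks @ [k])) z (Inl i) = pmuts ?E (map Inl ks) z (Inl i)"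
          using False by (simp add: pmuts_append pmut_def)
        then show "lev z (lp (ks @ [k]) i) = lev z (lp ks i)"
          using l[of z "ks @ [k]" i] l[of z ks i] z by simp
      qed
      then show ?thesis using False fs unfolding cs by (simp add: seed_mut_def)
    next
      case True
      define Pp where "Pp = (\<lambda>s. \<Prod>r\<in>UNIV. L ks r ^ nat (posp (s * ?M r (Inl k))))"
      have "lp (ks @ [k]) k * lp ks k = Pp 1 + Pp (-1)"
      proof (rule lev_inject)
        fix z :: "'n + 'n \<Rightarrow> real" assume z: "\<And>r. z r > 0"
        define w where "w = pmuts ?E (map Inl ks) z"
        have w: "w r = lev z (L ks r)" "w r > 0" for r unfolding w_def using L[of z ks r, OF z] pos[of z "map Inl ks" r, OF z] by simp_all
        have pwP: "pw w (\<lambda>r. posp (s * ?M r (Inl k))) = lev z (Pp s)" for s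
          unfolding pw_def Pp_def lev_prod[of z, OF z] lev_power[of z, OF z] w(1)[symmetric]
          by (simp add: power_int_def)
        have "lev z (lp (ks @ [k]) k) = pmut ?M (Inl k) w (Inl k)"
          using l[of z "ks @ [k]" k] z by (simp add: pmuts_append w_def)
        also have "\<dots> = (lev z (Pp 1) + lev z (Pp (-1))) / lev z (lp ks k)"
          using pwP[of 1] pwP[of "-1"] w(1)[of "Inl k"] by (simp add: pmut_def L_def)
        finally show "lev z (lp (ks @ [k]) k * lp ks k) = lev z (Pp 1 + Pp (-1))"
          using w[of "Inl k"] by (simp add: lev_mult[of z, OF z] lev_add L_def)
      qed
      from arg_cong[OF this, of rlev]
      have "rlev (lp (ks @ [k]) k) * rlev (lp ks k) = rlev (Pp 1) + rlev (Pp (-1))"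
        by (simp add: rlev_mult rlev_add)
      then have "rlev (lp (ks @ [k]) k) = (rlev (Pp 1) + rlev (Pp (-1))) / rlev (lp ks k)"
        using rl0[of ks k] by (simp add: eq_divide_eq)
      moreover have "rlev (Pp \<sigma>) = (\<Prod>r\<in>UNIV. seed_var s r ^ nat (posp (\<sigma> * ?M r (Inl k))))" for \<sigma>
        unfolding Pp_def rlev_prod rlev_power sv[symmetric] ..
      ultimately show ?thesis
        using True fs ss unfolding cs by (simp add: seed_mut_def)
    qed
  qed
  then show ?thesis using lh by simp
qed

theorem gfan_support_eq:
  fixes B :: "'n::finite \<Rightarrow> 'n \<Rightarrow> int"
  assumes skew: "skew_by d B"
  shows "gfan_support B = {v. \<exists>ks. \<forall>i. gmuts B ks (\<lambda>i. v $ i) i \<ge> 0}"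
proof (intro set_eqI iffI; clarsimp)
  fix v assume "v \<in> gfan_support B"
  then obtain ks g c where g: "\<And>i. homog B (cluster B ks i) (g i)" and c: "\<And>i. c i \<ge> 0"
    and v: "v = (\<Sum>i\<in>UNIV. c i *\<^sub>R (\<chi> j. real_of_int (g i j)))"
    unfolding gfan_support_def by blast
  have "g i = (\<lambda>a. gmat B ks a i)" for i
    using homog_unique[OF g homog_cluster[OF skew]] .
  then have "(\<lambda>i. v $ i) = (\<lambda>i. \<Sum>m\<in>UNIV. c m * of_int (gmat B ks i m))"
    by (simp add: v)
  then have "gmuts B ks (\<lambda>i. v $ i) = c" using gmuts_gmat[OF skew, of c ks] c by simp
  then show "\<exists>ks. \<forall>i. 0 \<le> gmuts B ks (($) v) i" using c by metis
next
  fix v :: "real ^ 'n" and ks assume nn: "\<forall>i. 0 \<le> gmuts B ks (($) v) i"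
  have "v = (\<Sum>m\<in>UNIV. gmuts B ks (($) v) m *\<^sub>R (\<chi> j. real_of_int (gmat B ks j m)))"
    unfolding vec_eq_iff using gmat_of_gmuts[OF skew, of ks "($) v"] nn by simp
  then show "v \<in> gfan_support B"
    unfolding gfan_support_def using homog_cluster[OF skew] nn
    by (intro CollectI exI[of _ ks] exI[of _ "\<lambda>i a. gmat B ks a i"] exI[of _ "gmuts B ks (($) v)"]) blast
qed

section \<open>Sink sequences and the twist\<close>

definition flip :: "'m set \<Rightarrow> ('m \<Rightarrow> 'm \<Rightarrow> int) \<Rightarrow> 'm \<Rightarrow> 'm \<Rightarrow> int" where
  "flip K M = (\<lambda>i j. if (i \<in> K) \<noteq> (j \<in> K) then - M i j else M i j)"

text \<open>Every vertex of \<open>ks\<close> is a sink at its turn: arrows among the listed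
  vertices run from later to earlier ones, and none leads out of the list.\<close>

definition sink_seq :: "('m \<Rightarrow> 'm \<Rightarrow> int) \<Rightarrow> 'm list \<Rightarrow> bool" where
  "sink_seq M ks \<longleftrightarrow> distinct ks \<and> sorted_wrt (\<lambda>i j. M i j \<ge> 0) ks \<and> (\<forall>k\<in>set ks. \<forall>i. i \<notin> set ks \<longrightarrow> M i k \<le> 0)"

lemma skew_by_nonneg_iff: "skew_by d M \<Longrightarrow> M i j \<ge> 0 \<longleftrightarrow> M j i \<le> 0"
  using skew_by_pos_iff[of d M i j] skew_by_zero_iff[of d M i j] by (auto simp: le_less not_less)

lemma sink_seq_col:
  assumes "skew_by d M" "sink_seq M (k # ks)"
  shows "M i k \<le> 0"
proof (cases "i = k")
  case True then show ?thesis using skew_by_diag[OF assms(1), of k] by simp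
next
  case False
  then show ?thesis
    using assms(2) skew_by_nonneg_iff[OF assms(1), of k i] by (auto simp: sink_seq_def)
qed

lemma sink_mmut:
  assumes "skew_by d M" "\<And>i. M i k \<le> 0"
  shows "mmut k M = flip {k} M"
proof (intro ext)
  fix i j
  have "M k j \<ge> 0" "M k k = 0" using assms(2)[of j] skew_by_nonneg_iff[OF assms(1), of k j] skew_by_diag[OF assms(1)] by auto
  then show "mmut k M i j = flip {k} M i j"
    using assms(2)[of i] by (auto simp: mat_mut_def flip_def posp_def)
qed

lemma sink_seq_flip:
  assumes "skew_by d M" "sink_seq M (k # ks)"
  shows "sink_seq (flip {k} M) ks"
proof -
  have 1: "k \<notin> set ks" "distinct ks" "\<And>k'. k' \<in> set ks \<Longrightarrow> M k k' \<ge> 0" "sorted_wrt (\<lambda>i j. M i j \<ge> 0) ks"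
    "\<And>k' i. k' \<in> set ks \<Longrightarrow> i \<noteq> k \<Longrightarrow> i \<notin> set ks \<Longrightarrow> M i k' \<le> 0"
    using assms(2) by (auto simp: sink_seq_def)
  have "sorted_wrt (\<lambda>i j. flip {k} M i j \<ge> 0) ks"
    by (rule sorted_wrt_mono_rel[OF _ 1(4)]) (use 1(1) in \<open>auto simp: flip_def\<close>)
  then show ?thesis unfolding sink_seq_def using 1 by (auto simp: flip_def)
qed

lemma sink_mmuts:
  "skew_by d M \<Longrightarrow> sink_seq M ks \<Longrightarrow> mmuts M ks = flip (set ks) M"
proof (induction ks arbitrary: M)
  case Nil then show ?case by (simp add: flip_def)
next
  case (Cons k ks)
  have e: "mmut k M = flip {k} M" by (rule sink_mmut[OF Cons.prems(1)]) (rule sink_seq_col[OF Cons.prems])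
  have "k \<notin> set ks" using Cons.prems by (auto simp: sink_seq_def)
  have "mmuts M (k # ks) = flip (set ks) (flip {k} M)"
    using Cons.IH[of "flip {k} M"] sink_seq_flip[OF Cons.prems] skew_by_mmut[OF Cons.prems(1), of k] e by simp
  also have "\<dots> = flip (set (k # ks)) M"
    using \<open>k \<notin> set ks\<close> by (intro ext) (auto simp: flip_def)
  finally show ?case .
qed

lemma sink_gmuts:
  fixes M :: "'m::finite \<Rightarrow> 'm \<Rightarrow> int"
  assumes "skew_by d M" "sink_seq M ks" "\<And>i. i \<in> set ks \<Longrightarrow> v i \<ge> 0"
  shows "gmuts M ks v = (\<lambda>i. if i \<in> set ks then - v i else v i)"
  using assms
proof (induction ks arbitrary: M v)
  case (Cons k ks)
  have col: "\<And>i. M i k \<le> 0" by (rule sink_seq_col[OF Cons.prems(1,2)])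
  have e: "mmut k M = flip {k} M" by (rule sink_mmut[OF Cons.prems(1) col])
  have g: "gmut M k v = v(k := - v k)"
    using col Cons.prems(3)[of k] by (auto simp: gmut_def posp_def fun_eq_iff)
  have k: "k \<notin> set ks" using Cons.prems by (auto simp: sink_seq_def)
  have "gmuts (flip {k} M) ks (v(k := - v k)) = (\<lambda>i. if i \<in> set ks then - (v(k := - v k)) i else (v(k := - v k)) i)"
    using sink_seq_flip[OF Cons.prems(1,2)] skew_by_mmut[OF Cons.prems(1), of k] e Cons.prems(3) k
    by (intro Cons.IH) auto
  then show ?case using k by (auto simp: e g fun_eq_iff)
qed simp

text \<open>By the last two hypotheses \<open>x k\<close> equals the maximum in the exchange at the
  sink \<open>k\<close>, so the new coordinate is 0.\<close>

lemma sink_amuts: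
  fixes M :: "'m::finite \<Rightarrow> 'm \<Rightarrow> int"
  assumes "skew_by d M" "sink_seq M ks" "\<And>k. k \<in> set ks \<Longrightarrow> x k \<ge> 0"
    "\<And>k. k \<in> set ks \<Longrightarrow> x k = (\<Sum>i\<in>UNIV. of_int (posp (- M i k)) * x i)"
  shows "amuts M ks x = (\<lambda>i. if i \<in> set ks then 0 else x i)"
  using assms
proof (induction ks arbitrary: M x)
  case (Cons k ks)
  have col: "\<And>i. M i k \<le> 0" by (rule sink_seq_col[OF Cons.prems(1,2)])
  have e: "mmut k M = flip {k} M" by (rule sink_mmut[OF Cons.prems(1) col])
  have "posp (M i k) = 0" for i using col[of i] by (simp add: posp_def)
  then have g: "amut M k x = x(k := 0)"
    using Cons.prems(4)[of k] Cons.prems(3)[of k] unfolding amut_def by (simp add: ldot_def max_def)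
  have k: "k \<notin> set ks" using Cons.prems by (auto simp: sink_seq_def)
  have "amuts (flip {k} M) ks (x(k := 0)) = (\<lambda>i. if i \<in> set ks then 0 else (x(k := 0)) i)"
  proof (rule Cons.IH)
    show "skew_by d (flip {k} M)" using skew_by_mmut[OF Cons.prems(1), of k] e by simp
    show "sink_seq (flip {k} M) ks" by (rule sink_seq_flip[OF Cons.prems(1,2)])
    fix k' assume k': "k' \<in> set ks"
    then have "k' \<noteq> k" using k by auto
    show "(x(k := 0)) k' \<ge> 0" using Cons.prems(3)[of k'] k' by simp
    \<comment> \<open>Before the reversal of its arrows vertex \<open>k\<close> contributed nothing
      because of this sign; afterwards its coordinate is 0.\<close>
    have "M k k' \<ge> 0" using Cons.prems(2) k' by (auto simp: sink_seq_def)
    then have "of_int (posp (- flip {k} M i k')) * (x(k := 0)) i = of_int (posp (- M i k')) * x i" for i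
      using \<open>k' \<noteq> k\<close> by (auto simp: flip_def posp_def)
    then show "(x(k := 0)) k' = (\<Sum>i\<in>UNIV. of_int (posp (- flip {k} M i k')) * (x(k := 0)) i)"
      using Cons.prems(4)[of k'] k' \<open>k' \<noteq> k\<close> by simp
  qed
  then show ?case using k by (auto simp: e g fun_eq_iff)
qed simp

text \<open>Equivalently, the G-matrix of \<open>\<sigma>\<close> is minus the identity. Conjugating such a sequence by mutations
  preserves this, because the last mutation takes place at a red vertex.\<close>

definition reddening :: "('m \<Rightarrow> 'm \<Rightarrow> int) \<Rightarrow> 'm list \<Rightarrow> bool" where
  "reddening B \<sigma> \<longleftrightarrow> mmuts B \<sigma> = B \<and> (\<forall>v. (\<forall>i. v i \<ge> 0) \<longrightarrow> gmuts B \<sigma> (\<lambda>i. - v i) = v)"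

lemma reddening_conj:
  fixes B :: "'m::finite \<Rightarrow> 'm \<Rightarrow> int"
  assumes skew: "skew_by d B" and red: "reddening B \<sigma>"
  shows "reddening (mmut k B) (k # \<sigma> @ [k])"
proof -
  have mm: "mmuts B \<sigma> = B" and gm: "\<And>v. (\<And>i. v i \<ge> 0) \<Longrightarrow> gmuts B \<sigma> (\<lambda>i. - v i) = v"
    using red by (auto simp: reddening_def)
  have inv: "mmut k (mmut k B) = B" by (rule mmut_mmut[OF skew])
  have gI: "gmat B \<sigma> i m = - unitv m i" for i m
  proof -
    have "gmuts B \<sigma> (\<lambda>i. of_int (gmat B \<sigma> i m)) = gmuts B \<sigma> (\<lambda>i. - of_int (unitv m i))"
      unfolding gmuts_gmat_col[OF skew] by (subst gm) auto
    then have "(\<lambda>i. of_int (gmat B \<sigma> i m)) = (\<lambda>i. - real_of_int (unitv m i))" by (rule gmuts_inj[OF skew])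
    then have "real_of_int (gmat B \<sigma> i m) = of_int (- unitv m i)" by (simp add: fun_eq_iff)
    then show ?thesis by (simp only: of_int_eq_iff)
  qed
  have cI: "cmat B \<sigma> m l = - unitv m l" for m l
  proof -
    have "(\<Sum>i\<in>UNIV. gmat B \<sigma> i m * d i * cmat B \<sigma> i l) = (\<Sum>i\<in>UNIV. if i = m then - d m * cmat B \<sigma> m l else 0)"
      unfolding gI by (intro sum.cong) auto
    then have "- d m * cmat B \<sigma> m l = (if m = l then d l else 0)"
      using gmat_cmat_dual[OF skew, of \<sigma> m l] by simp
    then have "d m * (cmat B \<sigma> m l + unitv m l) = 0" by (auto simp: algebra_simps)
    then show ?thesis using skew_by_pos[OF skew, of m] by auto
  qed
  \<comment> \<open>Vertex \<open>k\<close> is red after \<open>\<sigma>\<close>, so the final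
    mutation uses the coefficients \<open>posp (B i k)\<close>, the same ones that the initial
    mutation uses on a nonpositive vector.\<close>
  have cs: "csign B \<sigma> k = -1" unfolding csign_def using cI[of k k] by (auto intro!: exI[of _ k])
  have g2: "gmat B (\<sigma> @ [k]) i m = (if m = k then unitv k i - posp (B i k) else - unitv m i)" for i m
  proof -
    have "(\<Sum>r\<in>UNIV. gcoef B \<sigma> k r * gmat B \<sigma> i r) = (\<Sum>r\<in>UNIV. if r = i then - posp (B i k) else 0)"
      unfolding gcoef_def gI cs mm by (intro sum.cong) auto
    then show ?thesis unfolding gmat_snoc gI by simp
  qed
  have B0: "B k k = 0" by (rule skew_by_diag[OF skew])
  have "gmuts (mmut k B) (k # \<sigma> @ [k]) (\<lambda>i. - v i) = v" if v: "\<And>i. v i \<ge> 0" for v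
  proof -
    have "gmut (mmut k B) k (\<lambda>i. - v i) i = (\<Sum>m\<in>UNIV. v m * of_int (gmat B (\<sigma> @ [k]) i m))" for i
    proof -
      have g2k: "gmat B (\<sigma> @ [k]) i k = unitv k i - posp (B i k)"
        unfolding g2 by (simp only: if_True simp_thms)
      have "(\<Sum>m\<in>UNIV. v m * of_int (gmat B (\<sigma> @ [k]) i m))
        = v k * of_int (gmat B (\<sigma> @ [k]) i k) + (\<Sum>m\<in>UNIV - {k}. v m * of_int (gmat B (\<sigma> @ [k]) i m))"
        by (rule sum_split_at)
      also have "(\<Sum>m\<in>UNIV - {k}. v m * of_int (gmat B (\<sigma> @ [k]) i m)) = (\<Sum>m\<in>UNIV - {k}. if m = i then - v i else 0)"
        unfolding g2 by (intro sum.cong) auto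
      also have "\<dots> = (if i = k then 0 else - v i)" by simp
      finally have S: "(\<Sum>m\<in>UNIV. v m * of_int (gmat B (\<sigma> @ [k]) i m))
          = v k * of_int (unitv k i - posp (B i k)) + (if i = k then 0 else - v i)"
        unfolding g2k .
      show ?thesis
        using v[of k] B0 unfolding S gmut_def by (auto simp: mat_mut_def algebra_simps posp_def max_def)
    qed
    then have "gmut (mmut k B) k (\<lambda>i. - v i) = (\<lambda>i. \<Sum>m\<in>UNIV. v m * of_int (gmat B (\<sigma> @ [k]) i m))" by (rule ext)
    then show ?thesis using gmuts_gmat[OF skew, of v "\<sigma> @ [k]"] v unfolding gmuts.simps inv by simp
  qed
  moreover have "mmuts (mmut k B) (k # \<sigma> @ [k]) = mmut k B"
    unfolding mmuts.simps inv mmuts_append mm ..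
  ultimately show ?thesis by (simp add: reddening_def)
qed

lemma reddening_mmuts:
  fixes B :: "'m::finite \<Rightarrow> 'm \<Rightarrow> int"
  assumes "skew_by d B" "reddening B \<sigma>"
  shows "reddening (mmuts B ks) (rev ks @ \<sigma> @ ks)"
  using assms
proof (induction ks arbitrary: B \<sigma>)
  case (Cons k ks)
  have "reddening (mmuts (mmut k B) ks) (rev ks @ (k # \<sigma> @ [k]) @ ks)"
    using skew_by_mmut[OF Cons.prems(1)] reddening_conj[OF Cons.prems] by (rule Cons.IH)
  then show ?case by simp
qed simp

lemma gmut_neg: "gmut (\<lambda>i j. - B i j) k (\<lambda>i. - p i) = (\<lambda>i. - gmut B k p i)"
  by (auto simp: gmut_def fun_eq_iff)

lemma gmuts_neg: "gmuts (\<lambda>i j. - B i j) ks (\<lambda>i. - p i) = (\<lambda>i. - gmuts B ks p i)"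
proof (induction ks arbitrary: B p)
  case (Cons k ks)
  have "mmut k (\<lambda>i j. - B i j) = (\<lambda>i j. - mmut k B i j)" by (simp add: mmut_neg)
  then show ?case using Cons by (simp add: gmut_neg)
qed simp

section \<open>The indefinite case\<close>

text \<open>The midpoint of \<open>\<eta>\<close> and \<open>y\<close>, its negated absolute value,
  is nonpositive. A convex function that vanishes at the midpoint and at one endpoint is nonnegative
  at the other.\<close>

lemma amuts_pext_nonneg:
  fixes B :: "'n::finite \<Rightarrow> 'n \<Rightarrow> int"
  assumes skew: "skew_by d B"
  shows "amuts (pext 1 B) (map Inl ks) (case_sum (\<lambda>_. 0) \<eta>) (Inl i) \<ge> 0"
proof -
  have good: "good (range Inl) (case_sum d d) (pext 1 B)" by (rule good_pext[OF skew]) simp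
  define f where "f = (\<lambda>x. amuts (pext 1 B) (map Inl ks) x (Inl i))"
  have c: "convex_fun f" unfolding f_def
    by (rule amuts_convex[of "case_sum d d" _ "range Inl"]) (use good in \<open>auto simp: good_def\<close>)
  define y where "y = (\<lambda>j. - \<bar>\<eta> j\<bar>)"
  have "f (\<lambda>r. case_sum (\<lambda>_. 0) \<eta> r + 1/2 * (case_sum (\<lambda>_. 0) y r - case_sum (\<lambda>_. 0) \<eta> r))
      \<le> (1 - 1/2) * f (case_sum (\<lambda>_. 0) \<eta>) + 1/2 * f (case_sum (\<lambda>_. 0) y)"
    using c[unfolded convex_fun_def, THEN spec, of "case_sum (\<lambda>_. 0) \<eta>", THEN spec, of "case_sum (\<lambda>_. 0) y", THEN spec, of "1/2"] by simp
  moreover have e: "(\<lambda>r. case_sum (\<lambda>_. 0) \<eta> r + 1/2 * (case_sum (\<lambda>_. 0) y r - case_sum (\<lambda>_. 0) \<eta> r))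
     = case_sum (\<lambda>_. 0) (\<lambda>j. \<eta> j + 1/2 * (y j - \<eta> j))" by (auto simp: fun_eq_iff split: sum.split)
  moreover have "f (case_sum (\<lambda>_. 0) (\<lambda>j. \<eta> j + 1/2 * (y j - \<eta> j))) = 0" unfolding f_def
    by (subst amuts_pext_nonpos[OF skew]) (auto simp: y_def field_simps)
  moreover have "f (case_sum (\<lambda>_. 0) y) = 0" unfolding f_def
    by (subst amuts_pext_nonpos[OF skew]) (auto simp: y_def)
  ultimately have "f (case_sum (\<lambda>_. 0) \<eta>) \<ge> 0" unfolding e by simp
  then show ?thesis unfolding f_def .
qed

lemma acyclic_sink_seq:
  fixes B :: "'n::finite \<Rightarrow> 'n \<Rightarrow> int"
  assumes skew: "skew_by d B" and "acyclic_mat B"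
  shows "\<exists>ks. set ks = UNIV \<and> sink_seq B ks"
proof -
  define R where "R = {(i, j). B i j > 0}"
  have "R = (diagram_arrows B)\<inverse>" by (auto simp: R_def diagram_arrows_def)
  then have wfR: "wf R" using assms(2) finite_acyclic_wf[of R] by (simp add: acyclic_mat_def)
  have "\<exists>ks. set ks = S \<and> distinct ks \<and> sorted_wrt (\<lambda>i j. B i j \<ge> 0) ks" for S :: "'n set"
  proof (induction "card S" arbitrary: S)
    case 0
    then show ?case by (intro exI[of _ "[]"]) simp
  next
    case (Suc n)
    then have "S \<noteq> {}" by auto
    then obtain k where k: "k \<in> S" "\<And>y. (y, k) \<in> R \<Longrightarrow> y \<notin> S" using wfE_min'[OF wfR] by metis
    have nk: "n = card (S - {k})" using Suc.hyps(2) k(1) by simp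
    obtain ks where ks: "set ks = S - {k}" "distinct ks" "sorted_wrt (\<lambda>i j. B i j \<ge> 0) ks"
      using Suc.hyps(1)[OF nk] by (elim exE conjE)
    have "B k j \<ge> 0" if j: "j \<in> set ks" for j
    proof -
      have "j \<in> S" using j ks(1) by (metis DiffD1)
      then have "(j, k) \<notin> R" using k(2) by (metis)
      then have "\<not> B j k > 0" unfolding R_def mem_Collect_eq prod.case .
      then show ?thesis using skew_by_nonneg_iff[OF skew, of k j] by linarith
    qed
    then have "set (k # ks) = S \<and> distinct (k # ks) \<and> sorted_wrt (\<lambda>i j. B i j \<ge> 0) (k # ks)"
      using ks k(1) by (simp add: insert_absorb)
    then show ?case by (rule exI)
  qed
  from this[of UNIV] show ?thesis by (auto simp: sink_seq_def)
qed

lemma pext_uminus: "pext s (\<lambda>i j. - B i j) = (\<lambda>r c. - pext (- s) B r c)"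
  by (intro ext) (auto simp: pext_def split: sum.split)

text \<open>If \<open>n\<close> is read as a dimension vector, then \<open>g\<close> is the g-vector of its minimal presentation and
  \<open>- dotp g n\<close> is half the value of the Tits form: a direction in the fan has nonnegative Tits form.\<close>

theorem gmuts_nonneg_dotp:
  fixes B :: "'n::finite \<Rightarrow> 'n \<Rightarrow> int"
  assumes skew: "skew_by d B" and ac: "acyclic_mat B"
    and n: "\<And>i. n i \<ge> 0"
    and g: "\<And>j. of_int (d j) * g j = (\<Sum>i\<in>UNIV. of_int (posp (B i j)) * n i) - n j"
    and nn: "\<And>i. gmuts B ks g i \<ge> 0"
  shows "dotp g n \<le> 0"
proof -
  obtain \<tau> where \<tau>: "set \<tau> = UNIV" "sink_seq B \<tau>" using acyclic_sink_seq[OF skew ac] by blast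
  \<comment> \<open>Each arrow is reversed twice, once at either end.\<close>
  have mm: "mmuts B \<tau> = B" using sink_mmuts[OF skew \<tau>(2)] by (simp add: \<tau>(1) flip_def)
  have mmr: "mmuts B (rev \<tau>) = B" using mmuts_rev[OF skew, of \<tau>] mm by simp
  have "gmuts B (rev \<tau>) (\<lambda>i. - v i) = v" if "\<forall>i. v i \<ge> 0" for v
    using gmuts_rev[OF skew, of \<tau> v] sink_gmuts[OF skew \<tau>(2), of v] that by (simp add: \<tau>(1) mm)
  then have "reddening B (rev \<tau>)" using mmr by (simp add: reddening_def)
  then have red: "reddening (mmuts B ks) (rev ks @ rev \<tau> @ ks)" by (rule reddening_mmuts[OF skew])
  define v where "v = gmuts B ks g"
  define h where "h = gmuts (mmuts B ks) (rev ks) (\<lambda>i. - v i)"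
  have revks: "mmuts (mmuts B ks) (rev ks) = B" by (rule mmuts_rev[OF skew])
  have hks: "gmuts B ks h = (\<lambda>i. - v i)"
    using gmuts_rev[OF skew_by_mmuts[OF skew], of ks "rev ks" "\<lambda>i. - v i"] by (simp add: h_def revks)
  have "gmuts (mmuts B ks) (rev ks @ rev \<tau> @ ks) (\<lambda>i. - v i) = v"
    using red nn unfolding reddening_def v_def by blast
  then have "gmuts B ks (gmuts B (rev \<tau>) h) = gmuts B ks g"
    unfolding gmuts_append revks mmr h_def[symmetric] v_def[symmetric] .
  then have "gmuts B (rev \<tau>) h = g" by (rule gmuts_inj[OF skew])
  then have "gmuts B \<tau> g = h"
    using gmuts_rev[OF skew, of "rev \<tau>" h] by (simp add: mmr)
  then have tw: "gmuts B (\<tau> @ ks) g = (\<lambda>i. - v i)" by (simp add: gmuts_append mm hks)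

  \<comment> \<open>Mutation along \<open>\<tau>\<close> turns the extension with
    \<open>s = -1\<close> into the one with \<open>s = 1\<close>, to which
    \<open>amuts_pext_nonneg\<close> applies.\<close>
  let ?E = "pext (-1) B" and ?N = "\<lambda>i j. - B i j" and ?z = "\<lambda>_ :: 'n. 0 :: real"
  have skN: "skew_by d ?N" by (rule skew_by_neg[OF skew])
  have "gmuts (pext 1 ?N) (map Inl (\<tau> @ ks)) (case_sum (\<lambda>i. - g i) ?z) = case_sum (gmuts ?N (\<tau> @ ks) (\<lambda>i. - g i)) ?z"
    by (rule gmuts_pext[OF skN]) (use nn in \<open>simp add: gmuts_neg tw v_def\<close>)
  then have 1: "gmuts (\<lambda>r c. - ?E r c) (map Inl (\<tau> @ ks)) (case_sum (\<lambda>i. - g i) ?z) = case_sum v ?z"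
    by (simp add: gmuts_neg tw pext_uminus)
  have "(\<lambda>r. - case_sum g ?z r) = case_sum (\<lambda>i. - g i) ?z" by (auto simp: fun_eq_iff split: sum.split)
  then have 3: "- gmuts ?E (map Inl (\<tau> @ ks)) (case_sum g ?z) r = case_sum v ?z r" for r
    using fun_cong[OF gmuts_neg[of ?E "map Inl (\<tau> @ ks)" "case_sum g ?z"], of r] fun_cong[OF 1, of r]
    by (simp only:)
  have 2: "gmuts ?E (map Inl (\<tau> @ ks)) (case_sum g ?z) = case_sum (\<lambda>i. - v i) ?z"
  proof
    fix r show "gmuts ?E (map Inl (\<tau> @ ks)) (case_sum g ?z) r = case_sum (\<lambda>i. - v i) ?z r"
      using 3[of r] by (cases r) simp_all
  qed

  define \<eta> where "\<eta> = (\<lambda>j. n j - (\<Sum>i\<in>UNIV. of_int (posp (- B i j)) * n i))"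
  define x where "x = case_sum n \<eta>"
  have skE: "skew_by (case_sum d d) ?E" by (rule skew_by_pext[OF skew])
  have ssE: "sink_seq ?E (map Inl \<tau>)"
  proof -
    have "sorted_wrt (\<lambda>i j. ?E i j \<ge> 0) (map Inl \<tau>)" using \<tau>(2) by (simp add: sink_seq_def sorted_wrt_map)
    moreover have "?E i k \<le> 0" if "k \<in> range Inl" "i \<notin> range Inl" for i k
      using that by (cases i) auto
    ultimately show ?thesis using \<tau> by (auto simp: sink_seq_def distinct_map)
  qed
  have mmE: "mmuts ?E (map Inl \<tau>) = pext 1 B"
    using sink_mmuts[OF skE ssE] \<tau>(1) by (auto simp: flip_def pext_def fun_eq_iff split: sum.split)
  have amE: "amuts ?E (map Inl \<tau>) x = case_sum ?z \<eta>"
  proof -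
    have sumE: "(\<Sum>i\<in>UNIV. of_int (posp (- ?E i (Inl k))) * x i) = n k" for k
    proof -
      have "(\<Sum>i\<in>UNIV. of_int (posp (- ?E (Inr i) (Inl k))) * \<eta> i) = (\<Sum>i\<in>UNIV. if i = k then \<eta> k else 0)"
        by (intro sum.cong) (auto simp: posp_def)
      then show ?thesis unfolding sum_sum_type x_def by (simp add: \<eta>_def)
    qed
    have "amuts ?E (map Inl \<tau>) x = (\<lambda>i. if i \<in> set (map Inl \<tau>) then 0 else x i)"
      by (rule sink_amuts[OF skE ssE]) (use n sumE in \<open>auto simp: x_def\<close>)
    then show ?thesis using \<tau>(1) by (auto simp: fun_eq_iff x_def split: sum.split)
  qed
  have am: "amuts ?E (map Inl (\<tau> @ ks)) x = amuts (pext 1 B) (map Inl ks) (case_sum ?z \<eta>)"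
    by (simp add: amuts_append mmE amE)
  have al: "aligned (range Inl) (case_sum d d) ?E (case_sum g ?z) x"
  proof -
    have "yhat ?E x (Inl j) = of_int (d j) * g j" for j
    proof -
      have s: "(\<Sum>i\<in>UNIV. of_int (?E (Inr i) (Inl j)) * \<eta> i) = (\<Sum>i\<in>UNIV. if i = j then - \<eta> j else 0)"
        by (intro sum.cong) auto
      have "(\<Sum>i\<in>UNIV. of_int (B i j) * n i) = (\<Sum>i\<in>UNIV. of_int (posp (B i j)) * n i) - (\<Sum>i\<in>UNIV. of_int (posp (- B i j)) * n i)"
        unfolding sum_subtractf[symmetric] left_diff_distrib[symmetric] by (intro sum.cong) (auto simp: posp_def max_def)
      then show ?thesis
        unfolding yhat_def ldot_def sum_sum_type g x_def sum.case s by (simp add: \<eta>_def)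
    qed
    then show ?thesis by (auto simp: aligned_def)
  qed
  have "agree ?E (map Inl (\<tau> @ ks)) (case_sum g ?z) x"
    by (rule aligned_coherent_agree[OF skE al _ coherent_refl]) auto
  from dotp_gmuts_amuts[OF skE this]
  have "(\<Sum>i\<in>UNIV. - v i * amuts (pext 1 B) (map Inl ks) (case_sum ?z \<eta>) (Inl i)) = dotp g n"
    unfolding 2 am by (simp add: sum_sum_type x_def)
  moreover have "(\<Sum>i\<in>UNIV. - v i * amuts (pext 1 B) (map Inl ks) (case_sum ?z \<eta>) (Inl i)) \<le> 0"
    using nn amuts_pext_nonneg[OF skew] by (intro sum_nonpos) (auto simp: v_def)
  ultimately show ?thesis by simp
qed

section \<open>The Cartan companion\<close>

definition cab :: "('n \<Rightarrow> 'n \<Rightarrow> int) \<Rightarrow> 'n \<Rightarrow> 'n \<Rightarrow> real" where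
  "cab B i j = (if i = j then 2 else - \<bar>of_int (B i j)\<bar>)"

lemma cartan_companion_mult: "(cartan_companion B *v u) $ i = (\<Sum>j\<in>UNIV. cab B i j * u $ j)"
  by (simp add: matrix_vector_mult_def cartan_companion_def cab_def)

lemma cab_symm:
  assumes "skew_by d B"
  shows "of_int (d i) * cab B i j = of_int (d j) * cab B j i"
proof (cases "i = j")
  case False
  have "\<bar>d i * B i j\<bar> = \<bar>d j * B j i\<bar>" using skew_by_eq[OF assms, of i j] by simp
  then have "\<bar>real_of_int (d i) * of_int (B i j)\<bar> = \<bar>of_int (d j) * of_int (B j i)\<bar>"
    by (metis of_int_abs of_int_mult)
  then show ?thesis using False skew_by_pos[OF assms, of i] skew_by_pos[OF assms, of j]
    by (simp add: cab_def abs_mult)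
qed simp

text \<open>\<open>L\<close> sends a dimension vector to its g-vector and is bijective because the
  diagram is acyclic. The positive vectors with negative Tits form are an open set \<open>U\<close>,
  nonempty by the hypothesis on \<open>u\<close>, and by \<open>gmuts_nonneg_dotp\<close> its open
  image misses the fan.\<close>

theorem indefinite_not_dense:
  fixes B :: "'n::finite \<Rightarrow> 'n \<Rightarrow> int"
  assumes skew: "skew_by d B" and ac: "acyclic_mat B"
    and u: "\<And>i. u i > 0" and neg: "\<And>i. (\<Sum>j\<in>UNIV. cab B i j * u j) < 0"
  shows "\<not> gfan_dense B"
proof
  assume dense: "gfan_dense B"
  define L :: "real^'n \<Rightarrow> real^'n" where
    "L = (\<lambda>n. \<chi> j. ((\<Sum>i\<in>UNIV. of_int (posp (B i j)) * n $ i) - n $ j) / of_int (d j))"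
  have dpos: "real_of_int (d j) > 0" for j using skew_by_pos[OF skew, of j] by simp
  have lin: "linear L"
    by (rule linearI) (simp_all add: L_def vec_eq_iff sum.distrib algebra_simps add_divide_distrib diff_divide_distrib sum_distrib_left)
  have "n = 0" if "L n = 0" for n
  proof -
    define R where "R = {(i, j). B i j > 0}"
    have "R = (diagram_arrows B)\<inverse>" by (auto simp: R_def diagram_arrows_def)
    then have wfR: "wf R" using ac finite_acyclic_wf[of R] by (simp add: acyclic_mat_def)
    have e: "n $ j = (\<Sum>i\<in>UNIV. of_int (posp (B i j)) * n $ i)" for j
      using that dpos[of j] by (simp add: L_def vec_eq_iff) (metis less_irrefl)
    have "n $ j = 0" for j
      using wfR
    proof (induction j rule: wf_induct_rule)
      case (less j)
      have "of_int (posp (B i j)) * n $ i = 0" for i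
        using less[of i] by (cases "B i j > 0") (auto simp: R_def posp_def max_def)
      then have "(\<Sum>i\<in>UNIV. of_int (posp (B i j)) * n $ i) = 0" by (intro sum.neutral ballI)
      then show ?case using e[of j] by (rule trans[rotated])
    qed
    then show ?thesis by (simp add: vec_eq_iff)
  qed
  then have inj: "inj L" using linear_injective_0[OF lin] by blast
  define U where "U = {n :: real^'n. (\<forall>i. n $ i > 0) \<and> L n \<bullet> n > 0}"
  have "U = (\<Inter>i. {n. n $ i > 0}) \<inter> {n. L n \<bullet> n > 0}" by (auto simp: U_def)
  moreover have "open {n :: real^'n. n $ i > 0}" for i
    by (intro open_Collect_less continuous_intros)
  moreover have "open {n. L n \<bullet> n > 0}"
    using linear_continuous_on[OF linear_conv_bounded_linear[THEN iffD1, OF lin]] by (intro open_Collect_less continuous_intros) auto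
  ultimately have "open U" by (auto intro!: open_INT)
  then have "open (L ` U)" using open_surjective_linear_image[OF _ lin] linear_injective_imp_surjective[OF lin inj] by blast
  moreover have "(\<chi> i. of_int (d i) * u i) \<in> U"
  proof -
    define n :: "real^'n" where "n = (\<chi> i. of_int (d i) * u i)"
    \<comment> \<open>\<open>P 1\<close> and \<open>P (-1)\<close> are the contributions of the two
      signs of the entries to the off-diagonal part of the form; skew-symmetry makes them
      equal.\<close>
    define P where "P = (\<lambda>s. \<Sum>j\<in>UNIV. \<Sum>i\<in>UNIV. u j * (of_int (posp (s * B i j)) * (of_int (d i) * u i)))"
    have pp: "real_of_int (posp (B i j)) * of_int (d i) = of_int (posp (- B j i)) * of_int (d j)" for i j
    proof -
      have "posp (B i j) * d i = posp (- B j i) * d j"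
        using skew_by_posp[OF skew, of i j] by (simp add: mult.commute)
      then show ?thesis by (metis of_int_mult)
    qed
    have "P 1 = P (-1)"
    proof -
      have "P 1 = (\<Sum>j\<in>UNIV. \<Sum>i\<in>UNIV. u i * (of_int (posp (- B j i)) * (of_int (d j) * u j)))"
        unfolding P_def using pp by (simp add: mult_ac)
      also have "\<dots> = P (-1)" unfolding P_def by (subst sum.swap) simp
      finally show ?thesis .
    qed
    have "L n \<bullet> n = (\<Sum>j\<in>UNIV. u j * (\<Sum>i\<in>UNIV. of_int (posp (B i j)) * (of_int (d i) * u i)) - u j * (of_int (d j) * u j))"
    proof -
      have "L n \<bullet> n = (\<Sum>j\<in>UNIV. ((\<Sum>i\<in>UNIV. of_int (posp (B i j)) * (of_int (d i) * u i)) - of_int (d j) * u j) / of_int (d j) * (of_int (d j) * u j))"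
        by (simp add: inner_vec_def L_def n_def)
      also have "\<dots> = (\<Sum>j\<in>UNIV. u j * (\<Sum>i\<in>UNIV. of_int (posp (B i j)) * (of_int (d i) * u i)) - u j * (of_int (d j) * u j))"
        using dpos by (intro sum.cong) (auto simp: field_simps less_imp_neq[symmetric])
      finally show ?thesis .
    qed
    also have "\<dots> = P 1 - (\<Sum>j\<in>UNIV. of_int (d j) * u j * u j)"
      by (simp add: P_def sum_subtractf sum_distrib_left mult_ac)
    also have "\<dots> = (P 1 + P (-1) - (\<Sum>j\<in>UNIV. 2 * (of_int (d j) * u j * u j))) / 2"
      using \<open>P 1 = P (-1)\<close> by (simp add: sum_distrib_left[symmetric])
    also have "P 1 + P (-1) = (\<Sum>j\<in>UNIV. \<Sum>i\<in>UNIV. u j * (\<bar>of_int (B i j)\<bar> * (of_int (d i) * u i)))"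
    proof -
      have "real_of_int (posp b) + of_int (posp (- b)) = \<bar>of_int b\<bar>" for b by (auto simp: posp_def)
      then show ?thesis
        unfolding P_def sum.distrib[symmetric] by (simp add: distrib_left[symmetric] distrib_right[symmetric])
    qed
    also have "\<dots> = (\<Sum>i\<in>UNIV. of_int (d i) * u i * (\<Sum>j\<in>UNIV. \<bar>of_int (B i j)\<bar> * u j))"
      by (subst sum.swap) (simp add: sum_distrib_left mult_ac)
    also have "\<dots> - (\<Sum>j\<in>UNIV. 2 * (of_int (d j) * u j * u j)) = - (\<Sum>i\<in>UNIV. of_int (d i) * u i * (\<Sum>j\<in>UNIV. cab B i j * u j))"
    proof -
      have c: "(\<Sum>j\<in>UNIV. cab B i j * u j) = 2 * u i - (\<Sum>j\<in>UNIV. \<bar>of_int (B i j)\<bar> * u j)" for i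
      proof -
        have "(\<Sum>j\<in>UNIV. cab B i j * u j) = (\<Sum>j\<in>UNIV. (if j = i then 2 * u i else 0) - \<bar>of_int (B i j)\<bar> * u j)"
          using skew_by_diag[OF skew] by (intro sum.cong) (auto simp: cab_def)
        then show ?thesis by (simp add: sum_subtractf)
      qed
      show ?thesis unfolding c by (simp add: sum_subtractf[symmetric] sum_negf[symmetric] algebra_simps)
    qed
    finally have "L n \<bullet> n = - (\<Sum>i\<in>UNIV. of_int (d i) * u i * (\<Sum>j\<in>UNIV. cab B i j * u j)) / 2" .
    moreover have "(\<Sum>i\<in>UNIV. of_int (d i) * u i * (\<Sum>j\<in>UNIV. cab B i j * u j)) < (\<Sum>i\<in>(UNIV :: 'n set). 0)"
      using dpos u neg by (intro sum_strict_mono) (auto intro!: mult_pos_neg mult_pos_pos)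
    ultimately show ?thesis using dpos u by (simp add: U_def n_def)
  qed
  ultimately have "L ` U \<inter> gfan_support B \<noteq> {}"
    using dense open_Int_closure_eq_empty[of "L ` U" "gfan_support B"] unfolding gfan_dense_def by auto
  then obtain n where n: "n \<in> U" "L n \<in> gfan_support B" by blast
  then obtain ks where ks: "\<And>i. gmuts B ks (\<lambda>i. L n $ i) i \<ge> 0" unfolding gfan_support_eq[OF skew] by blast
  have "dotp (\<lambda>i. L n $ i) (\<lambda>i. n $ i) \<le> 0"
  proof (rule gmuts_nonneg_dotp[OF skew ac _ _ ks])
    show "n $ i \<ge> 0" for i using n(1) by (simp add: U_def less_imp_le)
    show "of_int (d j) * L n $ j = (\<Sum>i\<in>UNIV. of_int (posp (B i j)) * n $ i) - n $ j" for j
      using dpos[of j] by (simp add: L_def)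
  qed
  then show False using n(1) by (simp add: U_def inner_vec_def)
qed

section \<open>Mutation invariance\<close>

text \<open>The continuous surjection \<open>gmut B k\<close> maps the support of one fan into that
  of the other.\<close>

lemma gfan_dense_mmut:
  fixes B :: "'n::finite \<Rightarrow> 'n \<Rightarrow> int"
  assumes skew: "skew_by d B" and dense: "gfan_dense B"
  shows "gfan_dense (mmut k B)"
proof -
  have skew': "skew_by d (mmut k B)" by (rule skew_by_mmut[OF skew])
  define H :: "real^'n \<Rightarrow> real^'n" where "H = (\<lambda>v. \<chi> i. gmut B k (\<lambda>i. v $ i) i)"
  have "continuous_on UNIV (\<lambda>v :: real^'n. gmut B k (\<lambda>i. v $ i) i)" for i
    by (cases "i = k") (auto simp: gmut_def intro!: continuous_intros)
  then have cont: "continuous_on UNIV H" unfolding H_def by (intro continuous_on_vec_lambda)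
  have vl: "($) (vec_lambda f) = f" for f :: "'n \<Rightarrow> real" by (simp add: fun_eq_iff)
  have surj: "H (\<chi> i. gmut (mmut k B) k (\<lambda>i. w $ i) i) = w" for w
    using gmut_gmut[of k "mmut k B" "\<lambda>i. w $ i"] by (simp add: H_def mmut_mmut[OF skew] vl)
  have sub: "H ` gfan_support B \<subseteq> gfan_support (mmut k B)"
  proof safe
    fix v assume "v \<in> gfan_support B"
    then obtain ks where ks: "\<And>i. gmuts B ks (\<lambda>i. v $ i) i \<ge> 0" unfolding gfan_support_eq[OF skew] by blast
    have "gmuts (mmut k B) (k # ks) (\<lambda>i. H v $ i) = gmuts B ks (\<lambda>i. v $ i)"
      using gmut_gmut[of k B "\<lambda>i. v $ i"] by (simp add: H_def mmut_mmut[OF skew] vl)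
    then show "H v \<in> gfan_support (mmut k B)"
      unfolding gfan_support_eq[OF skew'] using ks by (intro CollectI exI[of _ "k # ks"]) (simp only: simp_thms)
  qed
  have "H ` closure (gfan_support B) \<subseteq> closure (gfan_support (mmut k B))"
    by (rule image_closure_subset) (use cont sub closure_subset in \<open>auto intro: continuous_on_subset\<close>)
  then have "H v \<in> closure (gfan_support (mmut k B))" for v using dense by (auto simp: gfan_dense_def)
  then show ?thesis unfolding gfan_dense_def using surj by (metis UNIV_eq_I)
qed

lemma gfan_dense_mmuts:
  fixes B :: "'n::finite \<Rightarrow> 'n \<Rightarrow> int"
  assumes skew: "skew_by d B"
  shows "gfan_dense (mmuts B ks) \<longleftrightarrow> gfan_dense B"
proof -
  have imp: "gfan_dense B \<Longrightarrow> gfan_dense (mmuts B ks)" if "skew_by d B" for B and ks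
    using that by (induction ks arbitrary: B) (auto intro: gfan_dense_mmut skew_by_mmut)
  show ?thesis using imp[OF skew] imp[OF skew_by_mmuts[OF skew], of ks "rev ks"] mmuts_rev[OF skew, of ks] by auto
qed

lemma foldl_mmuts: "foldl (\<lambda>M k. mmut k M) B ks = mmuts B ks"
  by (induction ks arbitrary: B) auto

definition linked :: "('n \<Rightarrow> 'n \<Rightarrow> int) \<Rightarrow> bool" where
  "linked B \<longleftrightarrow> (\<forall>i j. (i, j) \<in> {(i, j). B i j \<noteq> 0}\<^sup>*)"

lemma connected_mat_linked:
  assumes "skew_by d B"
  shows "connected_mat B \<longleftrightarrow> linked B"
proof -
  have "diagram_arrows B \<union> (diagram_arrows B)\<inverse> = {(i, j). B i j \<noteq> 0}"
    using skew_by_pos_iff[OF assms] by (force simp: diagram_arrows_def)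
  then show ?thesis by (simp add: connected_mat_def linked_def)
qed

text \<open>An entry can only be cancelled by a path through \<open>k\<close>, and the two edges of
  this path survive the mutation.\<close>

lemma linked_mmut:
  assumes skew: "skew_by d B" and "linked B"
  shows "linked (mmut k B)"
proof -
  have "(i, j) \<in> {(i, j). mmut k B i j \<noteq> 0}\<^sup>*" if "B i j \<noteq> 0" for i j
  proof (cases "mmut k B i j = 0")
    case True
    then have ne: "i \<noteq> k" "j \<noteq> k" and "B i k \<noteq> 0" "B k j \<noteq> 0"
      using that by (auto simp: mat_mut_def posp_def split: if_splits)
    then have "mmut k B i k \<noteq> 0" "mmut k B k j \<noteq> 0" by (auto simp: mat_mut_def)
    then show ?thesis by (auto intro: rtrancl_into_rtrancl[of i k])
  qed auto
  then have "{(i, j). B i j \<noteq> 0} \<subseteq> {(i, j). mmut k B i j \<noteq> 0}\<^sup>*" by auto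
  then have "{(i, j). B i j \<noteq> 0}\<^sup>* \<subseteq> {(i, j). mmut k B i j \<noteq> 0}\<^sup>*" by (rule rtrancl_subset_rtrancl)
  then show ?thesis using assms(2) unfolding linked_def by blast
qed

lemma linked_mmuts: "skew_by d B \<Longrightarrow> linked B \<Longrightarrow> linked (mmuts B ks)"
  by (induction ks arbitrary: B) (auto intro: linked_mmut skew_by_mmut)

section \<open>The finite and affine cases\<close>

definition insupp :: "('n \<Rightarrow> 'n \<Rightarrow> int) \<Rightarrow> ('n \<Rightarrow> real) \<Rightarrow> bool" where
  "insupp B p \<longleftrightarrow> (\<exists>ks. \<forall>i. gmuts B ks p i \<ge> 0)"

lemma insupp_gmut: "insupp (mmut k B) (gmut B k p) \<Longrightarrow> insupp B p"
proof -
  assume "insupp (mmut k B) (gmut B k p)"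
  then obtain ks where "\<forall>i. gmuts B (k # ks) p i \<ge> 0" unfolding insupp_def by auto
  then show ?thesis unfolding insupp_def by (rule exI)
qed

definition unlink :: "'n \<Rightarrow> ('n \<Rightarrow> 'n \<Rightarrow> int) \<Rightarrow> 'n \<Rightarrow> 'n \<Rightarrow> int" where
  "unlink k B = (\<lambda>i j. if i = k \<or> j = k then 0 else B i j)"

lemma gmuts_unlink:
  assumes "\<And>i. Z k i = 0" "\<And>i. Z i k = 0" "\<And>i j. i \<noteq> k \<Longrightarrow> j \<noteq> k \<Longrightarrow> Z i j = B i j"
    "\<And>i. i \<noteq> k \<Longrightarrow> p i = q i" "i \<noteq> k"
  shows "gmuts Z ls p i = gmuts B (filter (\<lambda>l. l \<noteq> k) ls) q i"
  using assms(1-4)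
proof (induction ls arbitrary: Z B p q)
  case Nil then show ?case using assms(5) by simp
next
  case (Cons l ls)
  show ?case
  proof (cases "l = k")
    case True
    have "mmut k Z = Z" using Cons.prems(1,2) by (intro ext) (auto simp: mat_mut_def posp_def)
    moreover have "gmuts Z ls (gmut Z k p) i = gmuts B (filter (\<lambda>l. l \<noteq> k) ls) q i"
      by (rule Cons.IH) (use Cons.prems in \<open>auto simp: gmut_def posp_def\<close>)
    ultimately show ?thesis using True by simp
  next
    case False
    have "gmuts (mmut l Z) ls (gmut Z l p) i = gmuts (mmut l B) (filter (\<lambda>l. l \<noteq> k) ls) (gmut B l q) i"
      by (rule Cons.IH) (use Cons.prems False in \<open>auto simp: gmut_def mat_mut_def posp_def\<close>)
    then show ?thesis using False by simp
  qed
qed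

lemma gmuts_frozen_shift:
  "k \<notin> set ks \<Longrightarrow> gmuts B ks (p(k := p k + c)) = (gmuts B ks p)(k := gmuts B ks p k + c)"
proof (induction ks arbitrary: B p)
  case (Cons l ks)
  have "gmut B l (p(k := p k + c)) = (gmut B l p)(k := gmut B l p k + c)"
    using Cons.prems by (auto simp: gmut_def fun_eq_iff)
  moreover have "gmuts (mmut l B) ks ((gmut B l p)(k := gmut B l p k + c))
      = (gmuts (mmut l B) ks (gmut B l p))(k := gmuts (mmut l B) ks (gmut B l p) k + c)"
    by (rule Cons.IH) (use Cons.prems in auto)
  ultimately show ?case by (simp only: gmuts.simps)
qed simp

text \<open>A sequence for the unlinked matrix serves for \<open>B\<close> once the mutations at
  \<open>k\<close> are dropped. Only coordinate \<open>k\<close> is in question; row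
  \<open>k\<close> of the G-matrix is a unit vector, so this coordinate ends with its initial
  value.\<close>

lemma insupp_unlink:
  fixes B :: "'n::finite \<Rightarrow> 'n \<Rightarrow> int"
  assumes skew: "skew_by d B" and row: "\<And>j. B k j \<ge> 0" and pk: "p k \<ge> 0" and sup: "insupp (unlink k B) p"
  shows "insupp B p"
proof -
  obtain ls where ls: "\<And>i. gmuts (unlink k B) ls p i \<ge> 0" using sup unfolding insupp_def by blast
  define ks where "ks = filter (\<lambda>l. l \<noteq> k) ls"
  have k: "k \<notin> set ks" by (simp add: ks_def)
  define w where "w = gmuts B ks p"
  have w: "w i \<ge> 0" if "i \<noteq> k" for i
  proof -
    have "gmuts (unlink k B) ls p i = gmuts B (filter (\<lambda>l. l \<noteq> k) ls) p i"
      using that by (intro gmuts_unlink) (auto simp: unlink_def)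
    then show ?thesis using ls[of i] by (simp add: w_def ks_def)
  qed
  \<comment> \<open>The shift makes all coordinates nonnegative, so that
    \<open>gmat_of_gmuts\<close> can be applied.\<close>
  define c where "c = \<bar>w k\<bar>"
  have sh: "gmuts B ks (p(k := p k + c)) = w(k := w k + c)"
    unfolding w_def by (rule gmuts_frozen_shift[OF k])
  have nn: "gmuts B ks (p(k := p k + c)) i \<ge> 0" for i unfolding sh using w by (auto simp: c_def)
  have "(p(k := p k + c)) k = (\<Sum>m\<in>UNIV. gmuts B ks (p(k := p k + c)) m * of_int (gmat B ks k m))"
    by (rule gmat_of_gmuts[OF skew nn])
  also have "\<dots> = (\<Sum>m\<in>UNIV. if m = k then w k + c else 0)"
    unfolding gmat_row_of_nonneg_row[OF skew row k] sh by (intro sum.cong) auto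
  finally have "w k = p k" by simp
  then have "\<forall>i. gmuts B ks p i \<ge> 0" using w pk unfolding w_def[symmetric] by metis
  then show ?thesis unfolding insupp_def by (rule exI)
qed

lemma insupp_zero:
  fixes p :: "'n::finite \<Rightarrow> real"
  shows "insupp (\<lambda>_ _. 0) p"
proof -
  let ?Z = "\<lambda>_ _ :: 'n. 0 :: int"
  obtain ks where ks: "set ks = {i. p i < 0}" "distinct ks" using finite_distinct_list[of "{i. p i < 0}"] by auto
  have "sink_seq ?Z ks" using ks(2) by (simp add: sink_seq_def sorted_wrt_true)
  moreover have "skew_by (\<lambda>_. 1) ?Z" by (simp add: skew_by_def)
  ultimately have "gmuts ?Z ks (\<lambda>i. - p i) = (\<lambda>i. if i \<in> set ks then - (- p i) else - p i)"
    by (intro sink_gmuts) (auto simp: ks)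
  then have "gmuts ?Z ks p i = (if p i < 0 then - p i else p i)" for i
    using fun_cong[OF gmuts_neg[of ?Z ks p], of i] by (auto simp: ks split: if_splits)
  then have "\<forall>i. gmuts ?Z ks p i \<ge> 0" by simp
  then show ?thesis unfolding insupp_def by (rule exI)
qed

section \<open>The quadratic form of the Cartan companion and reflections\<close>

definition qform :: "('n::finite \<Rightarrow> int) \<Rightarrow> ('n \<Rightarrow> 'n \<Rightarrow> int) \<Rightarrow> ('n \<Rightarrow> real) \<Rightarrow> real" where
  "qform d B x = (\<Sum>i\<in>UNIV. x i * (of_int (d i) * (\<Sum>j\<in>UNIV. cab B i j * x j)))"

lemma sum_add_unit:
  "(\<Sum>j\<in>UNIV. c j * (x j + t * (if j = k then 1 else 0))) = (\<Sum>j\<in>UNIV. c j * x j) + t * (c (k :: 'n::finite) :: real)"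
proof -
  have "(\<Sum>j\<in>UNIV. c j * (x j + t * (if j = k then 1 else 0))) = (\<Sum>j\<in>UNIV. c j * x j + (if j = k then t * c k else 0))"
    by (intro sum.cong) (auto simp: algebra_simps)
  then show ?thesis by (simp add: sum.distrib)
qed

lemma qform_add_unit:
  fixes B :: "'n::finite \<Rightarrow> 'n \<Rightarrow> int"
  assumes "skew_by d B"
  shows "qform d B (\<lambda>j. x j + t * (if j = k then 1 else 0))
    = qform d B x + 2 * t * (of_int (d k) * (\<Sum>j\<in>UNIV. cab B k j * x j)) + 2 * of_int (d k) * t\<^sup>2"
proof -
  let ?S = "\<lambda>i. of_int (d i) * (\<Sum>j\<in>UNIV. cab B i j * x j)"
  have "qform d B (\<lambda>j. x j + t * (if j = k then 1 else 0))
      = (\<Sum>i\<in>UNIV. (x i + t * (if i = k then 1 else 0)) * (of_int (d i) * ((\<Sum>j\<in>UNIV. cab B i j * x j) + t * cab B i k)))"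
    by (simp only: qform_def sum_add_unit)
  also have "\<dots> = (\<Sum>i\<in>UNIV. (?S i + t * (of_int (d i) * cab B i k)) * (x i + t * (if i = k then 1 else 0)))"
    by (intro sum.cong) (auto simp: algebra_simps)
  also have "\<dots> = (\<Sum>i\<in>UNIV. (?S i + t * (of_int (d i) * cab B i k)) * x i) + t * (?S k + t * (of_int (d k) * cab B k k))"
    by (rule sum_add_unit)
  also have "(\<Sum>i\<in>UNIV. (?S i + t * (of_int (d i) * cab B i k)) * x i) = qform d B x + t * (\<Sum>i\<in>UNIV. of_int (d i) * cab B i k * x i)"
    by (simp add: qform_def sum.distrib sum_distrib_left algebra_simps)
  also have "(\<Sum>i\<in>UNIV. of_int (d i) * cab B i k * x i) = ?S k"
    unfolding cab_symm[OF assms, of _ k] by (simp add: sum_distrib_left mult_ac)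
  finally show ?thesis by (simp add: cab_def power2_eq_square algebra_simps)
qed

definition acyc :: "('n \<Rightarrow> 'n \<Rightarrow> int) \<Rightarrow> bool" where
  "acyc B \<longleftrightarrow> acyclic {(i, j). B i j > 0}"

lemma acyclic_mat_acyc: "acyclic_mat B \<longleftrightarrow> acyc B"
proof -
  have "{(i, j). B i j > 0} = (diagram_arrows B)\<inverse>" by (auto simp: diagram_arrows_def)
  then show ?thesis by (simp add: acyclic_mat_def acyc_def)
qed

lemma acyc_neg:
  assumes "skew_by d B"
  shows "acyc (\<lambda>i j. - B i j) \<longleftrightarrow> acyc B"
proof -
  have "{(i, j). - B i j > 0} = {(i, j). B i j > 0}\<inverse>"
    using skew_by_pos_iff[OF assms] by auto
  then show ?thesis by (simp add: acyc_def)
qed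

lemma acyc_sink:
  fixes B :: "'n::finite \<Rightarrow> 'n \<Rightarrow> int"
  assumes "acyc B" "skew_by d B" "B a b \<noteq> 0"
  shows "\<exists>k. (\<exists>j. B k j \<noteq> 0) \<and> (\<forall>j. B k j \<ge> 0)"
proof -
  define R where "R = {(i, j). B i j > 0}"
  have wfR: "wf R" using assms(1) finite_acyclic_wf[of R] by (simp add: acyc_def R_def)
  obtain k where k: "k \<in> {i. \<exists>j. B i j \<noteq> 0}" "\<And>y. (y, k) \<in> R \<Longrightarrow> y \<notin> {i. \<exists>j. B i j \<noteq> 0}"
    using wfE_min[OF wfR, of a "{i. \<exists>j. B i j \<noteq> 0}"] assms(3) by blast
  have "B k j \<ge> 0" for j
  proof -
    have "\<not> B j k > 0" using k(2)[of j] unfolding R_def by force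
    then show ?thesis using skew_by_nonneg_iff[OF assms(2), of k j] by linarith
  qed
  then show ?thesis using k(1) by blast
qed

lemma acyc_flip:
  assumes "acyc B" "skew_by d B" "\<And>j. B k j \<ge> 0"
  shows "acyc (flip {k} B)"
proof -
  define R where "R = {(i, j). B i j > 0}"
  define R' where "R' = {(i, j). flip {k} B i j > 0}"
  have d: "B k k = 0" by (rule skew_by_diag[OF assms(2)])
  have step: "x \<noteq> k \<and> (y = k \<or> (x, y) \<in> R)" if "(x, y) \<in> R'" for x y
    using that assms(3)[of y] d by (auto simp: R'_def R_def flip_def split: if_splits)
  have "x \<noteq> k \<and> (y = k \<or> (x, y) \<in> R\<^sup>+)" if "(x, y) \<in> R'\<^sup>+" for x y
    using that
  proof (induction rule: trancl_induct)
    case (base y) then show ?case using step by blast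
  next
    case (step y z)
    have "y \<noteq> k" "z = k \<or> (y, z) \<in> R" using \<open>(y, z) \<in> R'\<close> \<open>\<And>y x. (x, y) \<in> R' \<Longrightarrow> x \<noteq> k \<and> (y = k \<or> (x, y) \<in> R)\<close> by auto
    then show ?case using step.IH by (auto intro: trancl_into_trancl)
  qed
  then have "(x, x) \<notin> R'\<^sup>+" for x using assms(1) unfolding acyc_def acyclic_def R_def[symmetric] by blast
  then show ?thesis by (simp add: acyc_def acyclic_def R'_def)
qed

text \<open>Mutate only at sinks (\<open>s = 1\<close>) or only at sources (\<open>s = -1\<close>). As long as these mutations act on \<open>p\<close> as
  simple reflections, the quadratic form of \<open>x\<close> drops each time by a definite amount, because \<open>p\<close> is
  integral; so the process ends at a vertex that can be unlinked.\<close>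

lemma insupp_reflect:
  fixes B :: "'n::finite \<Rightarrow> 'n \<Rightarrow> int" and s :: int
  assumes s: "s = 1 \<or> s = -1"
    and psd: "\<And>x. qform d B x \<ge> 0"
    and nz: "B a b \<noteq> 0"
    and \<rho>: "\<And>i. of_int s * \<rho> i > (0::real)"
    and unl: "\<And>B' k p. skew_by d B' \<Longrightarrow> acyc B' \<Longrightarrow> (\<And>i j. \<bar>B' i j\<bar> = \<bar>B i j\<bar>) \<Longrightarrow> \<exists>j. B' k j \<noteq> 0
        \<Longrightarrow> (\<And>i. p i \<in> \<int>) \<Longrightarrow> insupp (unlink k B') p"
    and skew: "skew_by d B" and ac: "acyc B"
    and int: "\<And>i. p i \<in> \<int>" and px: "\<And>i. p i = \<rho> i + (\<Sum>j\<in>UNIV. cab B i j * x j)"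
  shows "insupp B p"
proof -
  \<comment> \<open>A lower bound for the decrease of the form in one reflection.\<close>
  define c where "c = Min (range (\<lambda>i. 2 * of_int (d i) * (of_int s * \<rho> i)))"
  have cle: "c \<le> 2 * of_int (d i) * (of_int s * \<rho> i)" for i unfolding c_def by (intro Min_le) auto
  have c0: "c > 0" unfolding c_def using \<rho> skew_by_pos[OF skew] by (subst Min_gr_iff) auto
  have main: "insupp B' p" if "qform d B x < of_nat N * c" "skew_by d B'" "acyc B'" "\<And>i j. \<bar>B' i j\<bar> = \<bar>B i j\<bar>"
    "\<And>i. p i \<in> \<int>" "\<And>i. p i = \<rho> i + (\<Sum>j\<in>UNIV. cab B i j * x j)" for N B' p x
    using that
  proof (induction N arbitrary: B' p x)
    case 0 then show ?case using psd[of x] by simp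
  next
    case (Suc N)
    note sk = Suc.prems(2)
    have skN: "skew_by d (\<lambda>i j. - B' i j)" by (rule skew_by_neg[OF sk])
    have B'ab: "B' a b \<noteq> 0" using Suc.prems(4)[of a b] nz by auto
    have "\<exists>k. (\<exists>j. B' k j \<noteq> 0) \<and> (\<forall>j. s * B' k j \<ge> 0)"
    proof (cases "s = 1")
      case True then show ?thesis using acyc_sink[OF Suc.prems(3) sk B'ab] by simp
    next
      case False
      have "acyc (\<lambda>i j. - B' i j)" using acyc_neg[OF sk] Suc.prems(3) by simp
      from acyc_sink[OF this skN, of a b] show ?thesis using B'ab s False by auto
    qed
    then obtain k where k: "\<exists>j. B' k j \<noteq> 0" "\<And>j. s * B' k j \<ge> 0" by blast
    have kk: "B' k k = 0" by (rule skew_by_diag[OF sk])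
    have col: "s * B' i k \<le> 0" for i
      using s k(2)[of i] skew_by_nonneg_iff[OF sk, of k i] skew_by_nonneg_iff[OF sk, of i k] by auto
    have mm: "mmut k B' = flip {k} B'"
    proof (cases "s = 1")
      case True then show ?thesis using col by (intro sink_mmut[OF sk]) auto
    next
      case False
      then have "mmut k (\<lambda>i j. - B' i j) = flip {k} (\<lambda>i j. - B' i j)" using col s by (intro sink_mmut[OF skN]) auto
      then have "- mmut k B' i j = flip {k} (\<lambda>i j. - B' i j) i j" for i j
        unfolding mmut_neg by (rule fun_cong[OF fun_cong])
      then have "mmut k B' i j = - flip {k} (\<lambda>i j. - B' i j) i j" for i j
        by (metis minus_minus)
      then show ?thesis by (intro ext) (simp add: flip_def)
    qed
    have sk': "skew_by d (flip {k} B')" using skew_by_mmut[OF sk, of k] mm by simp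
    have ac': "acyc (flip {k} B')"
    proof (cases "s = 1")
      case True then show ?thesis using k(2) by (intro acyc_flip[OF Suc.prems(3) sk]) auto
    next
      case False
      have "flip {k} (\<lambda>i j. - B' i j) = (\<lambda>i j. - flip {k} B' i j)" by (auto simp: flip_def fun_eq_iff)
      moreover have "acyc (flip {k} (\<lambda>i j. - B' i j))"
        using k(2) s False Suc.prems(3) by (intro acyc_flip[OF _ skN]) (auto simp: acyc_neg[OF sk])
      ultimately show ?thesis using acyc_neg[OF sk'] by simp
    qed
    have abs': "\<bar>flip {k} B' i j\<bar> = \<bar>B i j\<bar>" for i j using Suc.prems(4)[of i j] by (simp add: flip_def)
    show ?case
    proof (cases "of_int s * p k \<ge> 0")
      case True
      show ?thesis
      proof (cases "s = 1")
        case s1: True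
        have "insupp (unlink k B') p" by (rule unl[OF sk Suc.prems(3,4) k(1) Suc.prems(5)])
        then show ?thesis using k(2) True s1 by (intro insupp_unlink[OF sk]) auto
      next
        case False
        \<comment> \<open>One mutation turns a source with nonpositive coordinate into a sink with
          nonnegative coordinate, which can then be isolated.\<close>
        then have s1: "s = -1" using s by simp
        have g: "gmut B' k p = p(k := - p k)"
          using col True s1 by (auto simp: gmut_def posp_def fun_eq_iff)
        have "insupp (unlink k (flip {k} B')) (p(k := - p k))"
          by (rule unl[OF sk' ac' abs']) (use k(1) kk Suc.prems(5) in \<open>auto simp: flip_def\<close>)
        then have "insupp (flip {k} B') (p(k := - p k))"
          using k(2) True s1 kk by (intro insupp_unlink[OF sk', of k]) (auto simp: flip_def)
        then show ?thesis using insupp_gmut[of k B' p] mm g by simp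
      qed
    next
      case False
      have g: "gmut B' k p i = p i + - p k * cab B i k" for i
        using col[of i] False s Suc.prems(4)[of i k]
        by (auto simp: gmut_def cab_def posp_def max_def of_int_abs[symmetric] simp del: of_int_abs)
      \<comment> \<open>On \<open>x\<close> the reflection subtracts \<open>p k\<close> from
        coordinate \<open>k\<close>, while \<open>\<rho>\<close> stays fixed.\<close>
      define x' where "x' = (\<lambda>j. x j + - p k * (if j = k then 1 else 0))"
      have px': "gmut B' k p i = \<rho> i + (\<Sum>j\<in>UNIV. cab B i j * x' j)" for i
        unfolding g x'_def sum_add_unit Suc.prems(6)[of i] by simp
      have int': "gmut B' k p i \<in> \<int>" for i
        using Suc.prems(5)[of i] Suc.prems(5)[of k] by (auto simp: g cab_def)
      obtain z where z: "p k = of_int z" using Suc.prems(5)[of k] by (elim Ints_cases)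
      have "s * z < 0" using False z by (metis not_le of_int_0_le_iff of_int_mult)
      then have "s * z \<le> -1" by simp
      then have "of_int (s * z) \<le> (-1 :: real)" by linarith
      then have sz: "of_int s * p k \<le> -1" by (simp add: z)
      have sx: "(\<Sum>j\<in>UNIV. cab B k j * x j) = p k - \<rho> k" using Suc.prems(6)[of k] by simp
      \<comment> \<open>The terms quadratic in \<open>p k\<close> cancel. Since \<open>p k\<close>
        is an integer of sign opposite to \<open>\<rho> k\<close>, the remaining term is at most
        \<open>- c\<close>.\<close>
      have "qform d B x' = qform d B x + 2 * of_int (d k) * (p k * \<rho> k)"
        unfolding x'_def qform_add_unit[OF skew] sx by (simp add: power2_eq_square algebra_simps)
      also have "p k * \<rho> k = (of_int s * p k) * (of_int s * \<rho> k)" using s by auto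
      also have "2 * of_int (d k) * ((of_int s * p k) * (of_int s * \<rho> k)) \<le> - c"
      proof -
        have "0 \<le> 2 * of_int (d k) * (of_int s * \<rho> k)" using cle[of k] c0 by linarith
        then have "(of_int s * p k) * (2 * of_int (d k) * (of_int s * \<rho> k)) \<le> - 1 * (2 * of_int (d k) * (of_int s * \<rho> k))"
          using sz by (intro mult_right_mono) auto
        then show ?thesis using cle[of k] by (simp add: mult_ac)
      qed
      finally have "qform d B x' \<le> qform d B x - c" by simp
      then have "qform d B x' < of_nat N * c" using Suc.prems(1) by (simp add: algebra_simps)
      then have "insupp (mmut k B') (gmut B' k p)"
        unfolding mm by (rule Suc.IH[OF _ sk' ac' abs' int' px'])
      then show ?thesis by (rule insupp_gmut)
    qed
  qed
  obtain N :: nat where "qform d B x / c < of_nat N" using reals_Archimedean2 by blast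
  then have "qform d B x < of_nat N * c" using c0 by (simp add: field_simps)
  then show ?thesis using skew ac refl int px by (rule main)
qed

text \<open>The mixed terms are rewritten by
  \<open>2 y_i y_j = y_i^2 + y_j^2 - (y_i - y_j)^2\<close>. For positive \<open>w\<close> the second
  sum is nonnegative, so definiteness is governed by the vector \<open>A w\<close>.\<close>

lemma qform_squares:
  fixes B :: "'n::finite \<Rightarrow> 'n \<Rightarrow> int"
  assumes "skew_by d B"
  shows "qform d B (\<lambda>i. w i * y i)
    = (\<Sum>i\<in>UNIV. of_int (d i) * w i * (y i)\<^sup>2 * (\<Sum>j\<in>UNIV. cab B i j * w j))
      + (\<Sum>i\<in>UNIV. \<Sum>j\<in>UNIV. - (of_int (d i) * cab B i j) * w i * w j * (y i - y j)\<^sup>2) / 2"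
proof -
  define S where "S = (\<lambda>i j. of_int (d i) * cab B i j * w i * w j)"
  have sym: "S i j = S j i" for i j using cab_symm[OF assms, of i j] by (simp add: S_def)
  have 1: "qform d B (\<lambda>i. w i * y i) = (\<Sum>i\<in>UNIV. \<Sum>j\<in>UNIV. S i j * (y i * y j))"
    by (simp add: qform_def S_def sum_distrib_left mult_ac)
  have 2: "(\<Sum>i\<in>UNIV. of_int (d i) * w i * (y i)\<^sup>2 * (\<Sum>j\<in>UNIV. cab B i j * w j)) = (\<Sum>i\<in>UNIV. \<Sum>j\<in>UNIV. S i j * (y i)\<^sup>2)"
    by (simp add: S_def sum_distrib_left mult_ac)
  have 3: "(\<Sum>i\<in>UNIV. \<Sum>j\<in>UNIV. S i j * (y j)\<^sup>2) = (\<Sum>i\<in>UNIV. \<Sum>j\<in>UNIV. S i j * (y i)\<^sup>2)"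
    by (subst sum.swap) (simp add: sym)
  have "(\<Sum>i\<in>UNIV. \<Sum>j\<in>UNIV. - (of_int (d i) * cab B i j) * w i * w j * (y i - y j)\<^sup>2)
      = (\<Sum>i\<in>UNIV. \<Sum>j\<in>UNIV. 2 * (S i j * (y i * y j)) - S i j * (y i)\<^sup>2 - S i j * (y j)\<^sup>2)"
    by (intro sum.cong) (auto simp: S_def power2_eq_square algebra_simps)
  also have "\<dots> = 2 * (\<Sum>i\<in>UNIV. \<Sum>j\<in>UNIV. S i j * (y i * y j)) - 2 * (\<Sum>i\<in>UNIV. \<Sum>j\<in>UNIV. S i j * (y i)\<^sup>2)"
    unfolding sum_subtractf 3 sum_distrib_left[symmetric] by simp
  finally show ?thesis unfolding 1 2 by (simp add: diff_divide_distrib)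
qed

lemma offdiag_nonneg:
  assumes "skew_by d B" "w i > 0" "w j > 0"
  shows "- (of_int (d i) * cab B i j) * w i * w j * (y i - y j :: real)\<^sup>2 \<ge> 0"
proof (cases "i = j")
  case False
  then have "- (of_int (d i) * cab B i j) \<ge> 0" using skew_by_pos[OF assms(1), of i] by (simp add: cab_def)
  then show ?thesis using assms(2,3) by (intro mult_nonneg_nonneg) auto
qed simp

lemma qform_pos:
  fixes B :: "'n::finite \<Rightarrow> 'n \<Rightarrow> int"
  assumes skew: "skew_by d B" and w: "\<And>i. w i > 0" and Aw: "\<And>i. (\<Sum>j\<in>UNIV. cab B i j * w j) > 0"
    and x: "x k \<noteq> 0"
  shows "qform d B x > 0"
proof -
  define y where "y = (\<lambda>i. x i / w i)"
  have xy: "x = (\<lambda>i. w i * y i)" using w by (auto simp: y_def fun_eq_iff less_imp_neq[symmetric])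
  have dp: "real_of_int (d i) > 0" for i using skew_by_pos[OF skew, of i] by simp
  have yk: "y k \<noteq> 0" using x w[of k] by (simp add: y_def)
  have "(\<Sum>i\<in>UNIV. of_int (d i) * w i * (y i)\<^sup>2 * (\<Sum>j\<in>UNIV. cab B i j * w j)) > 0"
    using w dp yk less_imp_le[OF w] less_imp_le[OF dp] less_imp_le[OF Aw]
    by (intro sum_pos2[of _ k]) (auto intro!: mult_pos_pos mult_nonneg_nonneg Aw)
  moreover have "(\<Sum>i\<in>UNIV. \<Sum>j\<in>UNIV. - (of_int (d i) * cab B i j) * w i * w j * (y i - y j)\<^sup>2) \<ge> 0"
    by (intro sum_nonneg offdiag_nonneg[OF skew] w)
  ultimately show ?thesis unfolding xy qform_squares[OF skew] by linarith
qed

lemma linked_const: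
  assumes "linked B" "\<And>i j. B i j \<noteq> 0 \<Longrightarrow> P i \<Longrightarrow> P j" "P i"
  shows "P j"
proof -
  have "(i, j) \<in> {(i, j). B i j \<noteq> 0}\<^sup>*" using assms(1) by (simp add: linked_def)
  then show ?thesis by (induction rule: rtrancl_induct) (use assms in auto)
qed

text \<open>With \<open>A w = 0\<close> only the squares of \<open>y i - y j\<close> remain; they
  all vanish only if \<open>y\<close> is constant along edges, hence everywhere on a connected
  diagram.\<close>

lemma
  fixes B :: "'n::finite \<Rightarrow> 'n \<Rightarrow> int"
  assumes skew: "skew_by d B" and w: "\<And>i. w i > 0" and Aw: "\<And>i. (\<Sum>j\<in>UNIV. cab B i j * w j) = 0"
  shows qform_nonneg: "qform d B x \<ge> 0"
    and qform_zero: "linked B \<Longrightarrow> qform d B x = 0 \<Longrightarrow> \<exists>c. \<forall>i. x i = c * w i"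
proof -
  define y where "y = (\<lambda>i. x i / w i)"
  have xy: "x = (\<lambda>i. w i * y i)" using w by (auto simp: y_def fun_eq_iff less_imp_neq[symmetric])
  let ?T = "\<lambda>i j. - (of_int (d i) * cab B i j) * w i * w j * (y i - y j)\<^sup>2"
  have T: "?T i j \<ge> 0" for i j by (rule offdiag_nonneg[OF skew w w])
  have q: "qform d B x = (\<Sum>i\<in>UNIV. \<Sum>j\<in>UNIV. ?T i j) / 2"
    unfolding xy qform_squares[OF skew] Aw by simp
  then show "qform d B x \<ge> 0" using sum_nonneg[of UNIV "\<lambda>i. \<Sum>j\<in>UNIV. ?T i j"] sum_nonneg[of UNIV "?T _"] T by simp
  assume l: "linked B" and "qform d B x = 0"
  then have "(\<Sum>i\<in>UNIV. \<Sum>j\<in>UNIV. ?T i j) = 0" using q by simp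
  then have "(\<Sum>j\<in>UNIV. ?T i j) = 0" for i
    using T by (subst (asm) sum_nonneg_eq_0_iff) (auto intro!: sum_nonneg)
  then have T0: "?T i j = 0" for i j
    using T by (subst (asm) sum_nonneg_eq_0_iff) auto
  have step: "y i = y j" if "B i j \<noteq> 0" for i j
  proof (cases "i = j")
    case False
    then have "of_int (d i) * cab B i j \<noteq> 0" using that skew_by_pos[OF skew, of i] by (simp add: cab_def)
    then show ?thesis using T0[of i j] w[of i] w[of j] by auto
  qed simp
  define c where "c = y undefined"
  have "y i = c" for i
    by (rule linked_const[OF l, of "\<lambda>i. y i = c" undefined]) (use step in \<open>auto simp: c_def\<close>)
  then show "\<exists>c. \<forall>i. x i = c * w i" using xy by (intro exI[of _ c]) (simp add: fun_eq_iff mult.commute)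
qed

lemma linear_system_solvable:
  fixes C :: "'n::finite \<Rightarrow> 'n \<Rightarrow> real"
  assumes "\<And>x. (\<And>i. (\<Sum>j\<in>UNIV. C i j * x j) = 0) \<Longrightarrow> (\<And>i. x i = 0)"
  shows "\<exists>x. \<forall>i. (\<Sum>j\<in>UNIV. C i j * x j) = w i"
proof -
  define L :: "real^'n \<Rightarrow> real^'n" where "L = (\<lambda>x. \<chi> i. \<Sum>j\<in>UNIV. C i j * x $ j)"
  have lin: "linear L" by (rule linearI) (simp_all add: L_def vec_eq_iff sum.distrib algebra_simps sum_distrib_left)
  have "x = 0" if "L x = 0" for x
    using assms[of "\<lambda>j. x $ j"] that by (simp add: L_def vec_eq_iff)
  then have "inj L" using linear_injective_0[OF lin] by blast
  then have "surj L" by (rule linear_inj_imp_surj[OF lin])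
  then obtain x where "L x = (\<chi> i. w i)" by (metis surjD)
  then show ?thesis by (intro exI[of _ "\<lambda>j. x $ j"]) (simp add: L_def vec_eq_iff)
qed

lemma skew_by_unlink:
  assumes "skew_by d B"
  shows "skew_by d (unlink k B)"
  unfolding skew_by_def
proof (intro conjI allI)
  fix i j
  show "d i > 0" by (rule skew_by_pos[OF assms])
  show "d i * unlink k B i j = - (d j * unlink k B j i)"
  proof (cases "i = k \<or> j = k")
    case True then show ?thesis by (auto simp: unlink_def)
  next
    case False
    then have "unlink k B i j = B i j" "unlink k B j i = B j i" by (auto simp: unlink_def)
    then show ?thesis using skew_by_eq[OF assms, of i j] by metis
  qed
qed

lemma acyc_unlink: "acyc B \<Longrightarrow> acyc (unlink k B)"
  unfolding acyc_def by (erule acyclic_subset) (auto simp: unlink_def split: if_splits)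

lemma qform_unlink:
  fixes B :: "'n::finite \<Rightarrow> 'n \<Rightarrow> int"
  assumes "skew_by d B"
  shows "qform d (unlink k B) x = qform d B (x(k := 0)) + 2 * of_int (d k) * (x k)\<^sup>2"
proof -
  define z where "z = x(k := 0)"
  have x: "x = (\<lambda>j. z j + x k * (if j = k then 1 else 0))" by (auto simp: z_def fun_eq_iff)
  have "(\<Sum>j\<in>UNIV. cab (unlink k B) k j * z j) = 0"
    by (intro sum.neutral) (auto simp: cab_def unlink_def z_def)
  moreover have "qform d (unlink k B) z = qform d B z"
  proof -
    have "(\<Sum>j\<in>UNIV. cab (unlink k B) i j * z j) = (\<Sum>j\<in>UNIV. cab B i j * z j)" if "i \<noteq> k" for i
      using that by (intro sum.cong) (auto simp: cab_def unlink_def z_def)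
    then show ?thesis unfolding qform_def by (intro sum.cong) (auto simp: z_def)
  qed
  ultimately show ?thesis
    using qform_add_unit[OF skew_by_unlink[OF assms], of k z "x k" k] unfolding z_def[symmetric]
    by (subst x) simp
qed

lemma cab_cong: "(\<And>i j. \<bar>B' i j\<bar> = \<bar>B i j\<bar>) \<Longrightarrow> cab B' = cab B"
  unfolding cab_def fun_eq_iff by (metis of_int_abs)

text \<open>Induction on the number of nonzero entries: reflections with \<open>\<rho>\<close>
  constantly 1 end at a vertex to be isolated, and isolating it keeps the form positive
  definite.\<close>

lemma insupp_posdef:
  fixes B :: "'n::finite \<Rightarrow> 'n \<Rightarrow> int"
  assumes "skew_by d B" "acyc B" "\<And>x k. x k \<noteq> 0 \<Longrightarrow> qform d B x > 0" "\<And>i. p i \<in> \<int>"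
  shows "insupp B p"
  using assms
proof (induction "card {(i, j). B i j \<noteq> 0}" arbitrary: B p rule: less_induct)
  case less
  show ?case
  proof (cases "\<exists>a b. B a b \<noteq> 0")
    case False
    then have "B = (\<lambda>_ _. 0)" by (intro ext) auto
    then show ?thesis using insupp_zero by simp
  next
    case True
    then obtain a b where ab: "B a b \<noteq> 0" by blast
    have psd: "qform d B x \<ge> 0" for x
    proof (cases "\<exists>k. x k \<noteq> 0")
      case True then show ?thesis using less.prems(3) less_imp_le by blast
    next
      case False then show ?thesis by (simp add: qform_def)
    qed
    have "\<exists>x. \<forall>i. (\<Sum>j\<in>UNIV. cab B i j * x j) = p i - 1"
    proof (rule linear_system_solvable)
      fix x i assume "\<And>i. (\<Sum>j\<in>UNIV. cab B i j * x j) = 0"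
      then have "qform d B x = 0" by (simp add: qform_def)
      then show "x i = 0" using less.prems(3)[of x i] by force
    qed
    then obtain x where x: "\<And>i. (\<Sum>j\<in>UNIV. cab B i j * x j) = p i - 1" by blast
    show ?thesis
    proof (rule insupp_reflect[OF _ psd ab, of 1 "\<lambda>_. 1" p x])
      show "p i = 1 + (\<Sum>j\<in>UNIV. cab B i j * x j)" for i using x[of i] by simp
      fix B' k and p' :: "'n \<Rightarrow> real"
      assume B': "skew_by d B'" "acyc B'" "\<And>i j. \<bar>B' i j\<bar> = \<bar>B i j\<bar>" "\<exists>j. B' k j \<noteq> 0" "\<And>i. p' i \<in> \<int>"
      have nz: "B' i j \<noteq> 0 \<longleftrightarrow> B i j \<noteq> 0" for i j using B'(3)[of i j] by auto
      have q: "qform d B' = qform d B" unfolding qform_def cab_cong[OF B'(3)] ..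
      show "insupp (unlink k B') p'"
      proof (rule less.hyps)
        have "{(i, j). unlink k B' i j \<noteq> 0} \<subset> {(i, j). B i j \<noteq> 0}"
          using B'(4) nz by (force simp: unlink_def)
        then show "card {(i, j). unlink k B' i j \<noteq> 0} < card {(i, j). B i j \<noteq> 0}"
          by (intro psubset_card_mono) auto
        show "skew_by d (unlink k B')" "acyc (unlink k B')" using B' by (simp_all add: skew_by_unlink acyc_unlink)
        fix x and l :: 'n assume xl: "x l \<noteq> (0::real)"
        have dk: "real_of_int (d k) > 0" using skew_by_pos[OF B'(1), of k] by simp
        show "qform d (unlink k B') x > 0"
        proof (cases "x k = 0")
          case True
          then have "(x(k := 0)) l \<noteq> 0" using xl by auto
          from less.prems(3)[of "x(k := 0)" l, OF this] show ?thesis unfolding qform_unlink[OF B'(1)] q using True by simp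
        next
          case False
          then have "2 * of_int (d k) * (x k)\<^sup>2 > 0" using dk by simp
          then show ?thesis unfolding qform_unlink[OF B'(1)] q using psd[of "x(k := 0)"] by linarith
        qed
      qed (rule B'(5))
    qed (use less.prems in auto)
  qed
qed

text \<open>The vector \<open>\<delta>\<close> is a left null vector of \<open>A\<close>. The rank
  one perturbation of \<open>A\<close> by \<open>w\<close> and \<open>\<delta>\<close> is injective,
  and for a right-hand side orthogonal to \<open>\<delta>\<close> its solution is orthogonal to
  \<open>\<delta>\<close> too, hence solves the system of \<open>A\<close>.\<close>

lemma cab_null_solvable:
  fixes B :: "'n::finite \<Rightarrow> 'n \<Rightarrow> int"
  assumes skew: "skew_by d B" and link: "linked B"
    and w: "\<And>i. w i > 0" and Aw: "\<And>i. (\<Sum>j\<in>UNIV. cab B i j * w j) = 0"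
  shows "(\<exists>x. \<forall>i. (\<Sum>j\<in>UNIV. cab B i j * x j) = q i) \<longleftrightarrow> (\<Sum>i\<in>UNIV. of_int (d i) * w i * q i) = 0"
proof -
  define \<delta> where "\<delta> = (\<lambda>i. of_int (d i) * w i)"
  have \<delta>0: "\<delta> i > 0" for i using skew_by_pos[OF skew, of i] w by (simp add: \<delta>_def)
  have A\<delta>: "(\<Sum>i\<in>UNIV. \<delta> i * cab B i j) = 0" for j
  proof -
    have "(\<Sum>i\<in>UNIV. \<delta> i * cab B i j) = (\<Sum>i\<in>UNIV. of_int (d j) * (cab B j i * w i))"
      by (intro sum.cong) (use cab_symm[OF skew, of _ j] in \<open>auto simp: \<delta>_def mult_ac\<close>)
    then show ?thesis using Aw[of j] by (simp add: sum_distrib_left[symmetric])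
  qed
  have A\<delta>x: "(\<Sum>i\<in>UNIV. \<delta> i * (\<Sum>j\<in>UNIV. cab B i j * x j)) = 0" for x
  proof -
    have "(\<Sum>i\<in>UNIV. \<delta> i * (\<Sum>j\<in>UNIV. cab B i j * x j)) = (\<Sum>j\<in>UNIV. (\<Sum>i\<in>UNIV. \<delta> i * cab B i j) * x j)"
      unfolding sum_distrib_left sum_distrib_right by (subst sum.swap) (simp add: mult_ac)
    then show ?thesis using A\<delta> by simp
  qed
  have \<delta>w: "(\<Sum>i\<in>UNIV. \<delta> i * w i) > 0" using \<delta>0 w by (intro sum_pos) auto
  have split: "(\<Sum>j\<in>UNIV. (cab B i j + w i * \<delta> j) * x j) = (\<Sum>j\<in>UNIV. cab B i j * x j) + w i * (\<Sum>j\<in>UNIV. \<delta> j * x j)" for i x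
    unfolding sum_distrib_left sum.distrib[symmetric] by (intro sum.cong) (auto simp: algebra_simps)
  have \<delta>x: "(\<Sum>j\<in>UNIV. \<delta> j * x j) = 0"
    if "(\<Sum>i\<in>UNIV. \<delta> i * ((\<Sum>j\<in>UNIV. cab B i j * x j) + w i * (\<Sum>j\<in>UNIV. \<delta> j * x j))) = 0" for x
  proof -
    have "(\<Sum>i\<in>UNIV. \<delta> i * w i) * (\<Sum>j\<in>UNIV. \<delta> j * x j) = 0"
      using that by (simp add: distrib_left sum.distrib A\<delta>x sum_distrib_right mult.assoc)
    then show ?thesis using \<delta>w by simp
  qed
  have "\<exists>x. \<forall>i. (\<Sum>j\<in>UNIV. (cab B i j + w i * \<delta> j) * x j) = q i"
  proof (rule linear_system_solvable)
    fix x i assume h: "\<And>i. (\<Sum>j\<in>UNIV. (cab B i j + w i * \<delta> j) * x j) = 0"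
    have h': "(\<Sum>j\<in>UNIV. cab B i j * x j) + w i * (\<Sum>j\<in>UNIV. \<delta> j * x j) = 0" for i
      using h[of i] unfolding split .
    have x0: "(\<Sum>j\<in>UNIV. \<delta> j * x j) = 0" by (rule \<delta>x) (simp only: h' mult_zero_right sum.neutral_const)
    then have "qform d B x = 0" using h' by (simp add: qform_def)
    then obtain c where c: "\<And>i. x i = c * w i" using qform_zero[OF skew w Aw link] by blast
    have "c * (\<Sum>j\<in>UNIV. \<delta> j * w j) = 0" using x0 by (simp add: c sum_distrib_left mult_ac)
    then show "x i = 0" using \<delta>w c by simp
  qed
  then obtain x where x: "\<And>i. (\<Sum>j\<in>UNIV. (cab B i j + w i * \<delta> j) * x j) = q i" by blast
  have x': "(\<Sum>j\<in>UNIV. cab B i j * x j) + w i * (\<Sum>j\<in>UNIV. \<delta> j * x j) = q i" for i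
    using x[of i] unfolding split .
  have e: "(\<Sum>i\<in>UNIV. of_int (d i) * w i * q i) = (\<Sum>i\<in>UNIV. \<delta> i * q i)" by (simp add: \<delta>_def)
  show ?thesis unfolding e
  proof
    assume "\<exists>x. \<forall>i. (\<Sum>j\<in>UNIV. cab B i j * x j) = q i"
    then obtain x where x: "\<And>i. (\<Sum>j\<in>UNIV. cab B i j * x j) = q i" by blast
    show "(\<Sum>i\<in>UNIV. \<delta> i * q i) = 0" using A\<delta>x[of x] unfolding x .
  next
    assume q0: "(\<Sum>i\<in>UNIV. \<delta> i * q i) = 0"
    have "(\<Sum>j\<in>UNIV. \<delta> j * x j) = 0" by (rule \<delta>x) (simp only: x' q0)
    then have "(\<Sum>j\<in>UNIV. cab B i j * x j) = q i" for i using x'[of i] by simp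
    then show "\<exists>x. \<forall>i. (\<Sum>j\<in>UNIV. cab B i j * x j) = q i" by blast
  qed
qed

text \<open>The constant vector \<open>r\<close> has the same pairing with the null root as
  \<open>p\<close>, which makes \<open>A x = p - r\<close> solvable; its sign decides between sinks
  and sources. Isolating a vertex leaves a positive definite form, because the radical is spanned by
  a vector without zero coordinates.\<close>

lemma insupp_affine:
  fixes B :: "'n::finite \<Rightarrow> 'n \<Rightarrow> int"
  assumes skew: "skew_by d B" and ac: "acyc B" and link: "linked B"
    and w: "\<And>i. w i > 0" and Aw: "\<And>i. (\<Sum>j\<in>UNIV. cab B i j * w j) = 0"
    and int: "\<And>i. p i \<in> \<int>" and ne: "(\<Sum>i\<in>UNIV. p i * (of_int (d i) * w i)) \<noteq> 0"
  shows "insupp B p"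
proof -
  define \<delta> where "\<delta> = (\<lambda>i. of_int (d i) * w i)"
  have dp: "real_of_int (d i) > 0" for i using skew_by_pos[OF skew, of i] by simp
  have \<delta>0: "\<delta> i > 0" for i using dp w by (simp add: \<delta>_def)
  have \<delta>s: "(\<Sum>i\<in>UNIV. \<delta> i) > 0" using \<delta>0 by (intro sum_pos) auto
  have psd: "qform d B x \<ge> 0" for x by (rule qform_nonneg[OF skew w Aw])
  have zero: "\<exists>c. \<forall>i. x i = c * w i" if "qform d B x = 0" for x by (rule qform_zero[OF skew w Aw link that])
  define \<sigma> where "\<sigma> = (\<Sum>i\<in>UNIV. p i * \<delta> i)"
  have \<sigma>0: "\<sigma> \<noteq> 0" using ne by (simp add: \<sigma>_def \<delta>_def)
  define r where "r = \<sigma> / (\<Sum>i\<in>UNIV. \<delta> i)"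
  have "(\<Sum>i\<in>UNIV. \<delta> i * (p i - r)) = 0"
  proof -
    have "(\<Sum>i\<in>UNIV. \<delta> i * (p i - r)) = \<sigma> - (\<Sum>i\<in>UNIV. \<delta> i) * r"
      by (simp add: right_diff_distrib sum_subtractf \<sigma>_def sum_distrib_right) (simp add: mult.commute)
    then show ?thesis using \<delta>s by (simp add: r_def)
  qed
  then obtain x where x: "\<And>i. (\<Sum>j\<in>UNIV. cab B i j * x j) = p i - r"
    using cab_null_solvable[of d B w "\<lambda>i. p i - r", OF skew link w Aw] unfolding \<delta>_def by blast
  have px: "p i = r + (\<Sum>j\<in>UNIV. cab B i j * x j)" for i using x[of i] by simp
  have "\<exists>a b. B a b \<noteq> 0"
  proof (rule ccontr)
    assume "\<nexists>a b. B a b \<noteq> 0"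
    then have "(\<Sum>j\<in>UNIV. cab B i j * w j) = (\<Sum>j\<in>UNIV. if j = i then 2 * w i else 0)" for i
      by (intro sum.cong) (auto simp: cab_def)
    from this[of undefined] show False using Aw[of undefined] w[of undefined] by simp
  qed
  then obtain a b where ab: "B a b \<noteq> 0" by blast
  define s :: int where "s = (if r > 0 then 1 else -1)"
  have r0: "r \<noteq> 0" using \<sigma>0 \<delta>s by (simp add: r_def)
  show ?thesis
  proof (rule insupp_reflect[OF _ psd ab, of s "\<lambda>_. r" p x])
    show "s = 1 \<or> s = -1" by (simp add: s_def)
    show "of_int s * r > 0" using r0 by (auto simp: s_def)
    fix B' k and p' :: "'n \<Rightarrow> real"
    assume B': "skew_by d B'" "acyc B'" "\<And>i j. \<bar>B' i j\<bar> = \<bar>B i j\<bar>" "\<And>i. p' i \<in> \<int>"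
    have q: "qform d B' = qform d B" unfolding qform_def cab_cong[OF B'(3)] ..
    show "insupp (unlink k B') p'"
    proof (rule insupp_posdef[OF skew_by_unlink[OF B'(1)] acyc_unlink[OF B'(2)]])
      fix x and l :: 'n assume xl: "x l \<noteq> (0::real)"
      show "qform d (unlink k B') x > 0"
      proof (cases "x k = 0")
        case True
        have "qform d B (x(k := 0)) \<noteq> 0"
        proof
          assume "qform d B (x(k := 0)) = 0"
          then obtain c where c: "\<And>i. (x(k := 0)) i = c * w i" using zero by blast
          have "c = 0" using c[of k] w[of k] by simp
          then show False using c[of l] xl True by (auto split: if_splits)
        qed
        then have "qform d B (x(k := 0)) > 0" using psd[of "x(k := 0)"] by linarith
        then show ?thesis unfolding qform_unlink[OF B'(1)] q using True by simp
      next
        case False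
        then have "2 * of_int (d k) * (x k)\<^sup>2 > 0" using dp[of k] by simp
        then show ?thesis unfolding qform_unlink[OF B'(1)] q using psd[of "x(k := 0)"] by linarith
      qed
    qed (rule B'(4))
  qed (use skew ac int px in auto)
qed

lemma insupp_scale: "c > 0 \<Longrightarrow> insupp B (\<lambda>i. c * p i) \<Longrightarrow> insupp B p"
  unfolding insupp_def using gmuts_scale[of c B _ p] by (auto simp: zero_le_mult_iff)

text \<open>A vector \<open>v\<close> is approximated by rounding its coordinates down to multiples
  of \<open>1 / (N + 1)\<close>. The approximations eventually lie in the open cone
  \<open>W\<close>, and scaling by \<open>N + 1\<close> makes them integral.\<close>

lemma gfan_dense_of_integral:
  fixes B :: "'n::finite \<Rightarrow> 'n \<Rightarrow> int"
  assumes skew: "skew_by d B" and W: "open W" "closure W = UNIV"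
    and scale: "\<And>c v. c > 0 \<Longrightarrow> v \<in> W \<Longrightarrow> c *\<^sub>R v \<in> W"
    and int: "\<And>v. v \<in> W \<Longrightarrow> (\<And>i. v $ i \<in> \<int>) \<Longrightarrow> insupp B (\<lambda>i. v $ i)"
  shows "gfan_dense B"
proof -
  have "v \<in> closure (gfan_support B)" if v: "v \<in> W" for v
  proof -
    define f :: "nat \<Rightarrow> real^'n" where "f = (\<lambda>N. \<chi> i. of_int \<lfloor>of_nat (Suc N) * v $ i\<rfloor> / of_nat (Suc N))"
    have "(\<lambda>N. f N $ i) \<longlonglongrightarrow> v $ i" for i
    proof (rule real_tendsto_sandwich)
      have lower: "v $ i - 1 / of_nat (Suc N) \<le> f N $ i" for N
      proof -
        have "v $ i - 1 / of_nat (Suc N) = (of_nat (Suc N) * v $ i - 1) / of_nat (Suc N)"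
          by (simp add: diff_divide_distrib del: of_nat_Suc)
        also have "\<dots> \<le> of_int \<lfloor>of_nat (Suc N) * v $ i\<rfloor> / of_nat (Suc N)"
          by (rule divide_right_mono) linarith+
        finally show ?thesis by (simp add: f_def del: of_nat_Suc)
      qed
      have upper: "f N $ i \<le> v $ i" for N
      proof -
        have "f N $ i \<le> (of_nat (Suc N) * v $ i) / of_nat (Suc N)"
          unfolding f_def vec_lambda_beta by (rule divide_right_mono) linarith+
        then show ?thesis by (simp del: of_nat_Suc)
      qed
      show "\<forall>\<^sub>F N in sequentially. v $ i - 1 / of_nat (Suc N) \<le> f N $ i" using lower by (intro always_eventually allI)
      show "\<forall>\<^sub>F N in sequentially. f N $ i \<le> v $ i" using upper by (intro always_eventually allI)
      show "(\<lambda>N. v $ i - 1 / of_nat (Suc N)) \<longlonglongrightarrow> v $ i"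
        using tendsto_diff[OF tendsto_const LIMSEQ_inverse_real_of_nat] by (simp add: inverse_eq_divide)
    qed auto
    then have lim: "f \<longlonglongrightarrow> v" by (rule vec_tendstoI)
    then have ev: "\<forall>\<^sub>F N in sequentially. f N \<in> W" using W(1) v by (rule topological_tendstoD)
    have "\<forall>\<^sub>F N in sequentially. f N \<in> gfan_support B"
      using ev
    proof (rule eventually_mono)
      fix N assume "f N \<in> W"
      then have "real (Suc N) *\<^sub>R f N \<in> W" by (intro scale) auto
      then have "insupp B (\<lambda>i. (real (Suc N) *\<^sub>R f N) $ i)"
        by (rule int) (simp add: f_def)
      then have "insupp B (\<lambda>i. real (Suc N) * f N $ i)" by simp
      then have "insupp B (\<lambda>i. f N $ i)" by (rule insupp_scale[rotated]) simp
      then show "f N \<in> gfan_support B" unfolding gfan_support_eq[OF skew] insupp_def by simp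
    qed
    then have "\<forall>\<^sub>F N in sequentially. f N \<in> closure (gfan_support B)"
      by (rule eventually_mono) (use closure_subset in blast)
    then show ?thesis by (rule Lim_in_closed_set[OF closed_closure _ _ lim]) simp
  qed
  then have "closure W \<subseteq> closure (gfan_support B)" by (intro closure_minimal) auto
  then show ?thesis using W(2) by (simp add: gfan_dense_def top.extremum_unique)
qed

theorem finite_dense:
  fixes B :: "'n::finite \<Rightarrow> 'n \<Rightarrow> int"
  assumes skew: "skew_by d B" and "acyc B" "\<And>i. w i > 0" "\<And>i. (\<Sum>j\<in>UNIV. cab B i j * w j) > 0"
  shows "gfan_dense B"
proof (rule gfan_dense_of_integral[OF skew, of UNIV])
  fix v :: "real^'n" assume "\<And>i. v $ i \<in> \<int>"
  then show "insupp B (\<lambda>i. v $ i)"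
    using qform_pos[of d B w, OF skew assms(3,4)] by (intro insupp_posdef[OF skew assms(2)])
qed auto

theorem affine_dense:
  fixes B :: "'n::finite \<Rightarrow> 'n \<Rightarrow> int"
  assumes skew: "skew_by d B" and "acyc B" "linked B" and w: "\<And>i. w i > 0" and "\<And>i. (\<Sum>j\<in>UNIV. cab B i j * w j) = 0"
  shows "gfan_dense B"
proof -
  define \<delta> :: "real^'n" where "\<delta> = (\<chi> i. of_int (d i) * w i)"
  have "\<delta> $ i \<noteq> 0" for i using skew_by_pos[OF skew, of i] w[of i] by (simp add: \<delta>_def)
  then have d0: "\<delta> \<noteq> 0" by auto
  have W: "{v. \<delta> \<bullet> v \<noteq> 0} = - {v. \<delta> \<bullet> v = 0}" by auto
  show ?thesis
  proof (rule gfan_dense_of_integral[OF skew, of "{v. \<delta> \<bullet> v \<noteq> 0}"])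
    show "open {v. \<delta> \<bullet> v \<noteq> 0}" unfolding W by (intro open_Compl closed_hyperplane)
    show "closure {v. \<delta> \<bullet> v \<noteq> 0} = UNIV"
      unfolding W closure_complement using interior_hyperplane[OF d0, of 0] by simp
    show "c *\<^sub>R v \<in> {v. \<delta> \<bullet> v \<noteq> 0}" if "c > 0" "v \<in> {v. \<delta> \<bullet> v \<noteq> 0}" for c v using that by simp
    fix v :: "real^'n" assume v: "v \<in> {v. \<delta> \<bullet> v \<noteq> 0}" "\<And>i. v $ i \<in> \<int>"
    have "(\<Sum>i\<in>UNIV. v $ i * (of_int (d i) * w i)) \<noteq> 0"
      using v(1) by (simp add: \<delta>_def inner_vec_def mult_ac)
    then show "insupp B (\<lambda>i. v $ i)" by (rule insupp_affine[OF skew assms(2,3) w assms(5) v(2)])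
  qed
qed

section \<open>Trichotomy of Cartan companions\<close>

lemma linear_term_zero:
  fixes a b :: real
  assumes "\<And>t. 2 * t * a + t\<^sup>2 * b \<ge> 0"
  shows "a = 0"
proof (rule ccontr)
  assume "a \<noteq> 0"
  \<comment> \<open>Chosen so that \<open>b < 2 * c\<close>; then \<open>t = - a / c\<close> makes
    the expression negative.\<close>
  define c where "c = \<bar>b\<bar> + 1"
  have c: "c > 0" "b - 2 * c < 0" by (auto simp: c_def)
  have "0 \<le> (2 * (- a / c) * a + (- a / c)\<^sup>2 * b) * c\<^sup>2" using assms[of "- a / c"] by simp
  also have "\<dots> = a\<^sup>2 * (b - 2 * c)" using c(1) by (simp add: power2_eq_square field_simps)
  also have "\<dots> < 0" using \<open>a \<noteq> 0\<close> c(2) by (simp add: mult_pos_neg)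
  finally show False by simp
qed

lemma cab_zero_propagate:
  fixes B :: "'n::finite \<Rightarrow> 'n \<Rightarrow> int"
  assumes skew: "skew_by d B" and y: "\<And>i. y i \<ge> (0::real)" "y i = 0" "(\<Sum>j\<in>UNIV. cab B i j * y j) \<ge> 0" and "B i j \<noteq> 0"
  shows "y j = 0"
proof -
  have nn: "- (cab B i k * y k) \<ge> 0" for k
    using y(1)[of k] y(2) by (cases "k = i") (auto simp: cab_def)
  have "(\<Sum>k\<in>UNIV. - (cab B i k * y k)) = 0"
    using y(3) sum_nonneg[of UNIV "\<lambda>k. - (cab B i k * y k)"] nn by (simp add: sum_negf)
  then have "- (cab B i j * y j) = 0" using nn by (subst (asm) sum_nonneg_eq_0_iff) auto
  moreover have "cab B i j \<noteq> 0" using assms(5) by (simp add: cab_def)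
  ultimately show ?thesis by simp
qed

text \<open>The form is minimised on the ellipsoid \<open>N = 1\<close>. Off-diagonal entries are
  nonpositive, so absolute values do not increase it and a minimiser can be taken nonnegative; the
  first-order condition makes it an eigenvector, and connectedness makes it positive.\<close>

lemma cab_eigenvector:
  fixes B :: "'n::finite \<Rightarrow> 'n \<Rightarrow> int"
  assumes skew: "skew_by d B" and link: "linked B"
  shows "\<exists>lam y. (\<forall>i. y i > 0) \<and> (\<forall>i. (\<Sum>j\<in>UNIV. cab B i j * y j) = lam * y i)"
proof -
  have d1: "real_of_int (d i) \<ge> 1" for i using skew_by_pos[OF skew, of i] by simp
  define N where "N = (\<lambda>x :: 'n \<Rightarrow> real. \<Sum>i\<in>UNIV. of_int (d i) * (x i)\<^sup>2)"
  define K where "K = {x :: real^'n. N (\<lambda>i. x $ i) = 1}"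
  have contN: "continuous_on UNIV (\<lambda>x :: real^'n. N (\<lambda>i. x $ i))" unfolding N_def by (intro continuous_intros)
  have contq: "continuous_on K (\<lambda>x :: real^'n. qform d B (\<lambda>i. x $ i))" unfolding qform_def by (intro continuous_intros)
  have N_ge: "(x i)\<^sup>2 \<le> N x" for x i
  proof -
    have "(x i)\<^sup>2 \<le> of_int (d i) * (x i)\<^sup>2" using d1[of i] by (simp add: mult_le_cancel_right1)
    also have "\<dots> \<le> N x" unfolding N_def
      by (rule member_le_sum) (use d1 in \<open>auto intro!: mult_nonneg_nonneg order_trans[OF _ d1]\<close>)
    finally show ?thesis .
  qed
  have "closed K" unfolding K_def using continuous_closed_preimage_constant[OF contN closed_UNIV, of 1] by simp
  moreover have "bounded K"
  proof (rule boundedI)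
    fix x assume "x \<in> K"
    then have "(x $ i)\<^sup>2 \<le> 1" for i using N_ge[of "\<lambda>i. x $ i" i] by (simp add: K_def)
    then have "\<bar>x $ i\<bar> \<le> 1" for i by (simp add: abs_square_le_1)
    then have "(\<Sum>i\<in>UNIV. \<bar>x $ i\<bar>) \<le> (\<Sum>i\<in>(UNIV :: 'n set). 1)" by (intro sum_mono)
    then show "norm x \<le> CARD('n)" using norm_le_l1_cart[of x] by simp
  qed
  ultimately have "compact K" by (simp add: compact_eq_bounded_closed)
  moreover have "K \<noteq> {}"
  proof -
    define x :: "real^'n" where "x = (\<chi> i. if i = undefined then 1 / sqrt (of_int (d i)) else 0)"
    have "of_int (d i) * (x $ i)\<^sup>2 = (if i = undefined then 1 else 0)" for i
      using d1[of i] by (auto simp: x_def power_divide)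
    then have "N (\<lambda>i. x $ i) = 1" by (simp add: N_def)
    then have "x \<in> K" by (simp add: K_def)
    then show ?thesis by blast
  qed
  ultimately obtain x where x: "x \<in> K" "\<And>z. z \<in> K \<Longrightarrow> qform d B (\<lambda>i. x $ i) \<le> qform d B (\<lambda>i. z $ i)"
    using continuous_attains_inf[OF _ _ contq] by metis
  define y where "y = (\<lambda>i. \<bar>x $ i\<bar>)"
  define lam where "lam = qform d B (\<lambda>i. x $ i)"
  have Ny: "N y = 1" using x(1) by (simp add: K_def N_def y_def)
  have qy: "qform d B y \<le> lam"
  proof -
    have "y i * (of_int (d i) * (cab B i j * y j)) \<le> x $ i * (of_int (d i) * (cab B i j * x $ j))" for i j
    proof (cases "i = j")
      case True then show ?thesis by (simp add: y_def cab_def)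
    next
      case False
      have c: "- (of_int (d i) * cab B i j) \<ge> 0" using d1[of i] False by (simp add: cab_def)
      have "x $ i * x $ j \<le> y i * y j" unfolding y_def abs_mult[symmetric] by (rule abs_ge_self)
      from mult_left_mono[OF this c] show ?thesis by (simp add: mult_ac)
    qed
    then show ?thesis unfolding lam_def qform_def sum_distrib_left by (intro sum_mono)
  qed
  have low: "lam * N z \<le> qform d B z" for z
  proof (cases "N z = 0")
    case True
    then have "z i = 0" for i using N_ge[of z i] by simp
    then show ?thesis using True by (simp add: qform_def)
  next
    case False
    have "N z \<ge> 0" using N_ge[of z undefined] by (metis order_trans zero_le_power2)
    then have Nz: "N z > 0" using False by simp
    define c where "c = 1 / sqrt (N z)"
    have c2: "c\<^sup>2 = 1 / N z" using Nz by (simp add: c_def power_divide)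
    have "N (\<lambda>i. c * z i) = c\<^sup>2 * N z" by (simp add: N_def power_mult_distrib sum_distrib_left mult_ac)
    moreover have vl: "($) (\<chi> i. c * z i) = (\<lambda>i. c * z i)" by (simp add: fun_eq_iff)
    ultimately have "(\<chi> i. c * z i) \<in> K" using c2 Nz by (simp add: K_def)
    from x(2)[OF this] have "lam \<le> qform d B (\<lambda>i. c * z i)" by (simp add: lam_def vl)
    also have "\<dots> = c\<^sup>2 * qform d B z"
      by (simp add: qform_def sum_distrib_left power2_eq_square mult_ac)
    finally have "lam \<le> qform d B z / N z" by (simp add: c2)
    then show ?thesis using Nz by (simp add: pos_le_divide_eq)
  qed
  have eig: "(\<Sum>j\<in>UNIV. cab B k j * y j) = lam * y k" for k
  proof -
    let ?S = "of_int (d k) * (\<Sum>j\<in>UNIV. cab B k j * y j)"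
    have "2 * t * (?S - lam * (of_int (d k) * y k)) + t\<^sup>2 * (2 * of_int (d k) - lam * of_int (d k)) \<ge> 0" for t
    proof -
      define z where "z = (\<lambda>j. y j + t * (if j = k then 1 else 0))"
      have "N z = (\<Sum>j\<in>UNIV. of_int (d j) * (y j)\<^sup>2 + (if j = k then 2 * t * (of_int (d k) * y k) + of_int (d k) * t\<^sup>2 else 0))"
        unfolding N_def z_def by (intro sum.cong) (auto simp: power2_eq_square algebra_simps)
      also have "\<dots> = 1 + 2 * t * (of_int (d k) * y k) + of_int (d k) * t\<^sup>2"
        using Ny by (simp add: sum.distrib N_def)
      finally have "lam * (1 + 2 * t * (of_int (d k) * y k) + of_int (d k) * t\<^sup>2) \<le> lam + 2 * t * ?S + 2 * of_int (d k) * t\<^sup>2"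
        using low[of z] qy unfolding z_def qform_add_unit[OF skew] by simp
      then show ?thesis by (simp add: algebra_simps)
    qed
    from linear_term_zero[OF this] have "of_int (d k) * ((\<Sum>j\<in>UNIV. cab B k j * y j) - lam * y k) = 0" by (simp add: algebra_simps)
    then show ?thesis using d1[of k] by auto
  qed
  have "y i > 0" for i
  proof (rule ccontr)
    assume "\<not> y i > 0"
    then have yi: "y i = 0" by (simp add: y_def)
    have spread: "y b = 0" if "B a b \<noteq> 0" "y a = 0" for a b
      by (rule cab_zero_propagate[of d B y a, OF skew _ that(2) _ that(1)]) (use eig[of a] that(2) in \<open>auto simp: y_def\<close>)
    have "y j = 0" for j by (rule linked_const[OF link, of "\<lambda>j. y j = 0" i]) (use spread yi in auto)
    then show False using Ny by (simp add: N_def)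
  qed
  then show ?thesis using eig by blast
qed

lemma gcm_finite_typeI:
  fixes B :: "'n::finite \<Rightarrow> 'n \<Rightarrow> int"
  assumes skew: "skew_by d B" and link: "linked B"
    and w: "\<And>i. w i > 0" and Aw: "\<And>i. (\<Sum>j\<in>UNIV. cab B i j * w j) > 0"
  shows "gcm_finite_type (cartan_companion B)"
  unfolding gcm_finite_type_def
proof (intro conjI allI impI)
  have "v = 0" if "cartan_companion B *v v = 0" for v
  proof (rule ccontr)
    assume "v \<noteq> 0"
    then obtain k where "v $ k \<noteq> 0" by (auto simp: vec_eq_iff)
    then have "qform d B (\<lambda>i. v $ i) > 0" by (rule qform_pos[OF skew w Aw])
    moreover have "(\<Sum>j\<in>UNIV. cab B i j * v $ j) = 0" for i
      using that cartan_companion_mult[of B v i] by simp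
    ultimately show False by (simp add: qform_def)
  qed
  then have "inj ((*v) (cartan_companion B))" by (subst linear_injective_0) auto
  then show "det (cartan_companion B) \<noteq> 0"
    using invertible_det_nz invertible_left_inverse matrix_left_invertible_injective by blast
  show "\<exists>u. (\<forall>i. u $ i > 0) \<and> (\<forall>i. (cartan_companion B *v u) $ i > 0)"
    by (rule exI[of _ "\<chi> i. w i"]) (simp add: cartan_companion_mult w Aw)
  fix v assume "\<forall>i. (cartan_companion B *v v) $ i \<ge> 0"
  then have Av: "\<And>i. (\<Sum>j\<in>UNIV. cab B i j * v $ j) \<ge> 0" by (simp add: cartan_companion_mult)
  \<comment> \<open>\<open>t * w\<close> is the largest multiple of \<open>w\<close> below
    \<open>v\<close>. For negative \<open>t\<close> the vector \<open>v - t * w\<close> would be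
    nonnegative with a zero at \<open>k\<close>, and \<open>A v\<close> would be negative
    there.\<close>
  define t where "t = Min (range (\<lambda>i. v $ i / w i))"
  have "t \<in> range (\<lambda>i. v $ i / w i)" unfolding t_def by (rule Min_in) auto
  then obtain k where k: "t = v $ k / w k" by blast
  have tle: "t \<le> v $ i / w i" for i unfolding t_def by (rule Min_le) auto
  have "t \<ge> 0"
  proof (rule ccontr)
    assume t: "\<not> t \<ge> 0"
    have z: "v $ i - t * w i \<ge> 0" for i using tle[of i] w[of i] by (simp add: pos_le_divide_eq)
    have zk: "v $ k - t * w k = 0" using k w[of k] by simp
    have "(\<Sum>j\<in>UNIV. cab B k j * (v $ j - t * w j)) \<le> 0"
    proof (rule sum_nonpos)
      fix j show "cab B k j * (v $ j - t * w j) \<le> 0"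
        using z[of j] zk by (cases "j = k") (auto simp: cab_def)
    qed
    moreover have "(\<Sum>j\<in>UNIV. cab B k j * (v $ j - t * w j)) = (\<Sum>j\<in>UNIV. cab B k j * v $ j) - t * (\<Sum>j\<in>UNIV. cab B k j * w j)"
      by (simp add: right_diff_distrib sum_subtractf sum_distrib_left mult_ac)
    moreover have "- t * (\<Sum>j\<in>UNIV. cab B k j * w j) > 0" using t Aw[of k] by (intro mult_pos_pos) auto
    ultimately show False using Av[of k] by simp
  qed
  have v0: "v $ i \<ge> 0" for i
  proof -
    have "0 \<le> v $ i / w i" using \<open>t \<ge> 0\<close> tle[of i] by linarith
    then show ?thesis using w[of i] by (simp add: zero_le_divide_iff)
  qed
  show "(\<forall>i. v $ i > 0) \<or> v = 0"
  proof (cases "\<forall>i. v $ i > 0")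
    case False
    then obtain i where "\<not> v $ i > 0" by blast
    then have i: "v $ i = 0" using v0[of i] by linarith
    have spread: "v $ b = 0" if "B a b \<noteq> 0" "v $ a = 0" for a b
      by (rule cab_zero_propagate[of d B "\<lambda>i. v $ i" a, OF skew v0 that(2) Av that(1)])
    have "v $ j = 0" for j by (rule linked_const[OF link, of "\<lambda>j. v $ j = 0" i]) (use spread i in auto)
    then show ?thesis by (simp add: vec_eq_iff)
  qed simp
qed

text \<open>The rank is read off from the image, a hyperplane by \<open>cab_null_solvable\<close>;
  its positive normal vector also forces a nonnegative \<open>A v\<close> to vanish.\<close>

lemma gcm_affine_typeI:
  fixes B :: "'n::finite \<Rightarrow> 'n \<Rightarrow> int"
  assumes skew: "skew_by d B" and link: "linked B"
    and w: "\<And>i. w i > 0" and Aw: "\<And>i. (\<Sum>j\<in>UNIV. cab B i j * w j) = 0"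
  shows "gcm_affine_type (cartan_companion B)"
  unfolding gcm_affine_type_def
proof (intro conjI allI impI)
  define \<delta> :: "real^'n" where "\<delta> = (\<chi> i. of_int (d i) * w i)"
  have \<delta>0: "\<delta> $ i > 0" for i using skew_by_pos[OF skew, of i] w[of i] by (simp add: \<delta>_def)
  then have "\<delta> \<noteq> 0" by (metis less_irrefl zero_index)
  note solv = cab_null_solvable[of d B w, OF skew link w Aw]
  have "range ((*v) (cartan_companion B)) = {q. \<delta> \<bullet> q = 0}"
  proof (intro set_eqI)
    fix q :: "real^'n"
    have "q \<in> range ((*v) (cartan_companion B)) \<longleftrightarrow> (\<exists>x. \<forall>i. (\<Sum>j\<in>UNIV. cab B i j * x j) = q $ i)"
    proof
      assume "q \<in> range ((*v) (cartan_companion B))"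
      then obtain v where "q = cartan_companion B *v v" by blast
      then show "\<exists>x. \<forall>i. (\<Sum>j\<in>UNIV. cab B i j * x j) = q $ i"
        by (intro exI[of _ "\<lambda>j. v $ j"]) (simp add: cartan_companion_mult)
    next
      assume "\<exists>x. \<forall>i. (\<Sum>j\<in>UNIV. cab B i j * x j) = q $ i"
      then obtain x where "\<And>i. (\<Sum>j\<in>UNIV. cab B i j * x j) = q $ i" by blast
      then have "cartan_companion B *v (\<chi> j. x j) = q" by (simp add: vec_eq_iff cartan_companion_mult)
      then show "q \<in> range ((*v) (cartan_companion B))" by blast
    qed
    also have "\<dots> \<longleftrightarrow> q \<in> {q. \<delta> \<bullet> q = 0}" unfolding solv by (simp add: \<delta>_def inner_vec_def)
    finally show "q \<in> range ((*v) (cartan_companion B)) \<longleftrightarrow> q \<in> {q. \<delta> \<bullet> q = 0}" .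
  qed
  then show "rank (cartan_companion B) = CARD('n) - 1"
    using rank_dim_range[of "cartan_companion B"] dim_hyperplane[OF \<open>\<delta> \<noteq> 0\<close>] by simp
  show "\<exists>u. (\<forall>i. u $ i > 0) \<and> cartan_companion B *v u = 0"
    by (rule exI[of _ "\<chi> i. w i"]) (simp add: cartan_companion_mult vec_eq_iff w Aw)
  fix v assume Av: "\<forall>i. (cartan_companion B *v v) $ i \<ge> 0"
  have "(\<Sum>i\<in>UNIV. of_int (d i) * w i * (cartan_companion B *v v) $ i) = 0"
    using solv[of "\<lambda>i. (cartan_companion B *v v) $ i"] cartan_companion_mult[of B v] by metis
  then have "\<delta> $ i * (cartan_companion B *v v) $ i = 0" for i
    using Av \<delta>0 by (subst (asm) sum_nonneg_eq_0_iff) (auto simp: \<delta>_def less_imp_le)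
  then show "cartan_companion B *v v = 0" using \<delta>0 unfolding vec_eq_iff by (metis less_irrefl mult_eq_0_iff zero_index)
qed

theorem theorem1p1:
  fixes B :: "'n::finite \<Rightarrow> 'n \<Rightarrow> int"
  assumes "skew_symmetrizable B"
    and "connected_mat B"
    and "\<exists>B'. mut_equiv B B' \<and> acyclic_mat B'"
  shows "gfan_dense B \<longleftrightarrow> finite_type B \<or> affine_type B"
proof -
  obtain d where skew: "skew_by d B" using assms(1) unfolding skew_symmetrizable_iff by blast
  have link: "linked B" using assms(2) connected_mat_linked[OF skew] by simp
  have sk: "skew_by d B'" and lk: "linked B'" and dense: "gfan_dense B' \<longleftrightarrow> gfan_dense B" if me: "mut_equiv B B'" for B'
  proof -
    obtain ks where ks: "B' = mmuts B ks" using me unfolding mut_equiv_def foldl_mmuts by blast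
    show "skew_by d B'" "linked B'" "gfan_dense B' \<longleftrightarrow> gfan_dense B"
      unfolding ks by (rule skew_by_mmuts[OF skew], rule linked_mmuts[OF skew link], rule gfan_dense_mmuts[OF skew])
  qed
  show ?thesis
  proof
    assume "gfan_dense B"
    obtain B' where B': "mut_equiv B B'" "acyclic_mat B'" using assms(3) by blast
    have dense': "gfan_dense B'" using dense[OF B'(1)] \<open>gfan_dense B\<close> by simp
    have ss: "skew_symmetrizable B'" unfolding skew_symmetrizable_iff using sk[OF B'(1)] by blast
    obtain lam y where y: "\<And>i. y i > 0" "\<And>i. (\<Sum>j\<in>UNIV. cab B' i j * y j) = lam * y i"
      using cab_eigenvector[OF sk[OF B'(1)] lk[OF B'(1)]] by blast
    consider "lam > 0" | "lam = 0" | "lam < 0" by linarith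
    then show "finite_type B \<or> affine_type B"
    proof cases
      case 1
      have "gcm_finite_type (cartan_companion B')"
        by (rule gcm_finite_typeI[of d B' y, OF sk[OF B'(1)] lk[OF B'(1)] y(1)]) (use y 1 in simp)
      then show ?thesis using B' ss unfolding finite_type_def by blast
    next
      case 2
      have "gcm_affine_type (cartan_companion B')"
        by (rule gcm_affine_typeI[of d B' y, OF sk[OF B'(1)] lk[OF B'(1)] y(1)]) (use y 2 in simp)
      then show ?thesis using B' ss unfolding affine_type_def by blast
    next
      case 3
      have "\<not> gfan_dense B'"
        by (rule indefinite_not_dense[of d B' y, OF sk[OF B'(1)] B'(2) y(1)]) (use y 3 in \<open>simp add: mult_neg_pos\<close>)
      then show ?thesis using dense' by simp
    qed
  next
    assume "finite_type B \<or> affine_type B"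
    then show "gfan_dense B"
    proof
      assume "finite_type B"
      then obtain B' u where B': "mut_equiv B B'" "acyclic_mat B'" and u: "\<And>i. u $ i > 0" "\<And>i. (cartan_companion B' *v u) $ i > 0"
        unfolding finite_type_def gcm_finite_type_def by blast
      have "gfan_dense B'"
        by (rule finite_dense[of d B' "\<lambda>i. u $ i", OF sk[OF B'(1)] _ u(1)])
          (use u(2) B'(2) in \<open>simp_all add: acyclic_mat_acyc cartan_companion_mult\<close>)
      then show ?thesis using dense[OF B'(1)] by simp
    next
      assume "affine_type B"
      then obtain B' u where B': "mut_equiv B B'" "acyclic_mat B'" and u: "\<And>i. u $ i > 0" "cartan_companion B' *v u = 0"
        unfolding affine_type_def gcm_affine_type_def by blast
      have "(\<Sum>j\<in>UNIV. cab B' i j * u $ j) = 0" for i using cartan_companion_mult[of B' u i] u(2) by simp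
      then have "gfan_dense B'"
        using B'(2) by (intro affine_dense[of d B' "\<lambda>i. u $ i", OF sk[OF B'(1)] _ lk[OF B'(1)] u(1)]) (simp_all add: acyclic_mat_acyc)
      then show ?thesis using dense[OF B'(1)] by simp
    qed
  qed
qed

end
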